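(* Assume the weight functions $\hat w^{(n)}$ are estimated on a data set $\mathbf A$ independent of $(\mathbf X^{(n)},\mathbf Y^{(n)},\mathbf Z^{(n)})$, that $\hat f,\hat g$ are estimated on an auxiliary data set independent of both $(\mathbf X^{(n)},\mathbf Y^{(n)},\mathbf Z^{(n)})$ and $\mathbf A$, and that there exists $C>0$ with $|\hat w^{(n)}(z)|\le C$ for all $n$ and $z$. For $P\in\mathcal E_0$ let $\bar\rho_{P,n}=\mathbb E_P[\epsilon_P\xi_P\hat w^{(n)}(Z)\mid\mathbf A]$ and $\bar\sigma_n^2=\bar\sigma_{P,n}^2=\operatorname{Var}_P(\epsilon_P\xi_P\hat w^{(n)}(Z)\mid\mathbf A)$. 1. Let $P\in\mathcal E_0$. Assume $A_fA_g=o_P(n^{-1})$, $B_f=o_P(1)$, $B_g=o_P(1)$, that there exists $\eta>0$ with $\mathbb E_P[|\epsilon_P\xi_P|^{2+\eta}]<\infty$, and that $P$-almost surely there exists $c>0$ with $\inf_n\bar\sigma_n^2\ge c$. Then $\sup_{t\in\mathbb R}\big|\mathbb P_P\big(T^{(n)}-\sqrt n\,\bar\rho_{P,n}/\tau_D^{(n)}\le t\big)-\Phi(t)\big|\to0$. 2. Let $\mathcal P\subset\mathcal E_0$. Assume $A_fA_g=o_{\mathcal P}(n^{-1})$, $B_f=o_{\mathcal P}(1)$, $B_g=o_{\mathcal P}(1)$, that there exists $\eta>0$ with $\sup_{P\in\mathcal P}\mathbb E_P[|\epsilon_P\xi_P|^{2+\eta}]<\infty$, and that there exists $c>0$ such that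 for all $P\in\mathcal P$, $P$-almost surely $\inf_n\bar\sigma_n^2\ge c$. Then $\sup_{P\in\mathcal P}\sup_{t\in\mathbb R}\big|\mathbb P_P\big(T^{(n)}-\sqrt n\,\bar\rho_{P,n}/\tau_D^{(n)}\le t\big)-\Phi(t)\big|\to0$.
   Context: Let $X,Y$ be real-valued random variables and $Z$ a random vector in $\mathbb R^{d_Z}$. $\mathcal E_0$ is the set of distributions of $(X,Y,Z)$ absolutely continuous with respect to Lebesgue measure. For $P\in\mathcal E_0$: $f_P(z)=\mathbb E_P[X\mid Z=z]$, $g_P(z)=\mathbb E_P[Y\mid Z=z]$, $\epsilon_P=X-f_P(Z)$, $\xi_P=Y-g_P(Z)$, $u_P(z)=\mathbb E_P[\epsilon_P^2\mid Z=z]$, $v_P(z)=\mathbb E_P[\xi_P^2\mid Z=z]$. Data $(x_i,y_i,z_i)$, $i=1,\dots,n$, i.i.d. copies of $(X,Y,Z)$ form $(\mathbf X^{(n)},\mathbf Y^{(n)},\mathbf Z^{(n)})$; $\hat f,\hat g$ are estimates of $f_P,g_P$. $A_f=\frac1n\sum_i(f_P(z_i)-\hat f(z_i))^2$, $A_g=\frac1n\sum_i(g_P(z_i)-\hat g(z_i))^2$, $B_f=\frac1n\sum_i(f_P(z_i)-\hat f(z_i))^2v_P(z_i)$, $B_g=\frac1n\sum_i(g_P(z_i)-\hat g(z_i))^2u_P(z_i)$. With $R_i^{(n)}=(x_i-\hat f(z_i))(y_i-\hat g(z_i))\hat w^{(n)}(z_i)$: $\tau_N^{(n)}=\frac1{\sqrt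 n}\sum_iR_i^{(n)}$, $\tau_D^{(n)}=\big(\frac1n\sum_i(R_i^{(n)})^2-(\frac1n\sum_rR_r^{(n)})^2\big)^{1/2}$, $T^{(n)}=\tau_N^{(n)}/\tau_D^{(n)}$. $\Phi$ is the standard normal distribution function. For a family $\mathcal P$, $V_n=o_{\mathcal P}(W_n)$ means $\sup_{P\in\mathcal P}\mathbb P_P(|V_n/W_n|>\delta)\to0$ for all $\delta>0$; $o_P$ is the case $\mathcal P=\{P\}$. *)

theory Defs
  imports "HOL-Probability.Probability"
begin

type_synonym 'z obs = "real \<times> real \<times> 'z"

definition Xo :: "'z obs \<Rightarrow> real" where "Xo w = fst w"
definition Yo :: "'z obs \<Rightarrow> real" where "Yo w = fst (snd w)"
definition Zo :: "'z obs \<Rightarrow> 'z" where "Zo w = snd (snd w)"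

definition E0 :: "('z::euclidean_space) obs measure \<Rightarrow> bool" where
  "E0 P \<longleftrightarrow> prob_space P \<and> sets P = sets (borel :: 'z obs measure)
             \<and> absolutely_continuous lborel P"

definition cond_exp_version ::
  "('z::euclidean_space) obs measure \<Rightarrow> ('z obs \<Rightarrow> real) \<Rightarrow> ('z \<Rightarrow> real) \<Rightarrow> bool" where
  "cond_exp_version P h f \<longleftrightarrow> integrable P h \<and> f \<in> borel_measurable borel
     \<and> integrable P (\<lambda>w. f (Zo w))
     \<and> (\<forall>B\<in>sets borel. (\<integral>w. indicator B (Zo w) * h w \<partial>P)
                         = (\<integral>w. indicator B (Zo w) * f (Zo w) \<partial>P))"

definition nn_cond_exp_version ::
  "('z::euclidean_space) obs measure \<Rightarrow> ('z obs \<Rightarrow> ennreal) \<Rightarrow> ('z \<Rightarrow> ennreal) \<Rightarrow> bool" where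
  "nn_cond_exp_version P h u \<longleftrightarrow> u \<in> borel_measurable borel
     \<and> (\<forall>B\<in>sets borel. (\<integral>\<^sup>+w. indicator B (Zo w) * h w \<partial>P)
                         = (\<integral>\<^sup>+w. indicator B (Zo w) * u (Zo w) \<partial>P))"

definition eps :: "('z \<Rightarrow> real) \<Rightarrow> 'z obs \<Rightarrow> real" where
  "eps f w = Xo w - f (Zo w)"
definition xi :: "('z \<Rightarrow> real) \<Rightarrow> 'z obs \<Rightarrow> real" where
  "xi g w = Yo w - g (Zo w)"

definition regression_versions ::
  "('z::euclidean_space) obs measure \<Rightarrow> ('z \<Rightarrow> real) \<Rightarrow> ('z \<Rightarrow> real)
     \<Rightarrow> ('z \<Rightarrow> ennreal) \<Rightarrow> ('z \<Rightarrow> ennreal) \<Rightarrow> bool" where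
  "regression_versions P f g u v \<longleftrightarrow>
     cond_exp_version P Xo f \<and> cond_exp_version P Yo g
   \<and> nn_cond_exp_version P (\<lambda>w. ennreal ((eps f w)\<^sup>2)) u
   \<and> nn_cond_exp_version P (\<lambda>w. ennreal ((xi g w)\<^sup>2)) v"

text \<open>Canonical joint probability space: an i.i.d. sequence of observations with law P
  (the first n of which form the sample of size n), independent of the data set A (law QA)
  and of the auxiliary data set D (law QD), which are mutually independent.
  A point is (s, (a, d)).\<close>
definition sample_space ::
  "'z obs measure \<Rightarrow> 'a measure \<Rightarrow> 'b measure \<Rightarrow> ((nat \<Rightarrow> 'z obs) \<times> 'a \<times> 'b) measure" where
  "sample_space P QA QD = (PiM UNIV (\<lambda>_::nat. P)) \<Otimes>\<^sub>M (QA \<Otimes>\<^sub>M QD)"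

definition xs :: "(nat \<Rightarrow> 'z obs) \<times> 'a \<times> 'b \<Rightarrow> nat \<Rightarrow> real" where "xs om i = Xo (fst om i)"
definition ys :: "(nat \<Rightarrow> 'z obs) \<times> 'a \<times> 'b \<Rightarrow> nat \<Rightarrow> real" where "ys om i = Yo (fst om i)"
definition zs :: "(nat \<Rightarrow> 'z obs) \<times> 'a \<times> 'b \<Rightarrow> nat \<Rightarrow> 'z" where "zs om i = Zo (fst om i)"
definition Adata :: "(nat \<Rightarrow> 'z obs) \<times> 'a \<times> 'b \<Rightarrow> 'a" where "Adata om = fst (snd om)"
definition Ddata :: "(nat \<Rightarrow> 'z obs) \<times> 'a \<times> 'b \<Rightarrow> 'b" where "Ddata om = snd (snd om)"

text \<open>A_f (resp. A_g): fh n d is the estimate of f_P computed from auxiliary data d.\<close>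
definition Aerr :: "('z \<Rightarrow> real) \<Rightarrow> (nat \<Rightarrow> 'b \<Rightarrow> 'z \<Rightarrow> real) \<Rightarrow> nat
     \<Rightarrow> (nat \<Rightarrow> 'z obs) \<times> 'a \<times> 'b \<Rightarrow> real" where
  "Aerr f fh n om = (1 / real n) * (\<Sum>i<n. (f (zs om i) - fh n (Ddata om) (zs om i))\<^sup>2)"

text \<open>B_f (with weight v_P) and B_g (with weight u_P); extended-real valued.\<close>
definition Berr :: "('z \<Rightarrow> real) \<Rightarrow> (nat \<Rightarrow> 'b \<Rightarrow> 'z \<Rightarrow> real) \<Rightarrow> ('z \<Rightarrow> ennreal) \<Rightarrow> nat
     \<Rightarrow> (nat \<Rightarrow> 'z obs) \<times> 'a \<times> 'b \<Rightarrow> ennreal" where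
  "Berr f fh v n om = ennreal (1 / real n)
      * (\<Sum>i<n. ennreal ((f (zs om i) - fh n (Ddata om) (zs om i))\<^sup>2) * v (zs om i))"

definition Rres :: "(nat \<Rightarrow> 'b \<Rightarrow> 'z \<Rightarrow> real) \<Rightarrow> (nat \<Rightarrow> 'b \<Rightarrow> 'z \<Rightarrow> real)
     \<Rightarrow> (nat \<Rightarrow> 'a \<Rightarrow> 'z \<Rightarrow> real) \<Rightarrow> nat \<Rightarrow> (nat \<Rightarrow> 'z obs) \<times> 'a \<times> 'b \<Rightarrow> nat \<Rightarrow> real" where
  "Rres fh gh W n om i = (xs om i - fh n (Ddata om) (zs om i))
                        * (ys om i - gh n (Ddata om) (zs om i)) * W n (Adata om) (zs om i)"

definition tauN where
  "tauN fh gh W n om = (1 / sqrt (real n)) * (\<Sum>i<n. Rres fh gh W n om i)"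

definition tauD where
  "tauD fh gh W n om = sqrt ((1 / real n) * (\<Sum>i<n. (Rres fh gh W n om i)\<^sup>2)
                             - ((1 / real n) * (\<Sum>r<n. Rres fh gh W n om r))\<^sup>2)"

definition Tstat where
  "Tstat fh gh W n om = tauN fh gh W n om / tauD fh gh W n om"

text \<open>rho-bar and sigma-bar^2: conditional mean and variance of eps*xi*w(Z) given A = a.
  Since A is independent of the observation, these are integrals over P with a fixed.\<close>
definition rho_bar :: "'z obs measure \<Rightarrow> ('z \<Rightarrow> real) \<Rightarrow> ('z \<Rightarrow> real)
     \<Rightarrow> (nat \<Rightarrow> 'a \<Rightarrow> 'z \<Rightarrow> real) \<Rightarrow> nat \<Rightarrow> 'a \<Rightarrow> real" where
  "rho_bar P f g W n a = (\<integral>w. eps f w * xi g w * W n a (Zo w) \<partial>P)"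

definition sigma2_bar :: "'z obs measure \<Rightarrow> ('z \<Rightarrow> real) \<Rightarrow> ('z \<Rightarrow> real)
     \<Rightarrow> (nat \<Rightarrow> 'a \<Rightarrow> 'z \<Rightarrow> real) \<Rightarrow> nat \<Rightarrow> 'a \<Rightarrow> real" where
  "sigma2_bar P f g W n a =
     (\<integral>w. (eps f w * xi g w * W n a (Zo w) - rho_bar P f g W n a)\<^sup>2 \<partial>P)"

definition Phi :: "real \<Rightarrow> real" where
  "Phi t = measure (density lborel std_normal_density) {..t}"

definition Tcent where
  "Tcent P f g fh gh W n om =
     Tstat fh gh W n om - sqrt (real n) * rho_bar P f g W n (Adata om) / tauD fh gh W n om"

definition kol_dist where
  "kol_dist P QA QD f g fh gh W n =
     (SUP t. \<bar>measure (sample_space P QA QD)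
                {om \<in> space (sample_space P QA QD). Tcent P f g fh gh W n om \<le> t} - Phi t\<bar>)"

end

theory Submission
  imports Defs
begin

text \<open>
  Put \<open>M\<^sub>i = \<epsilon>\<^sub>i \<xi>\<^sub>i w(z\<^sub>i)\<close>, with conditional mean \<open>\<rho>\<close> and variance \<open>\<sigma>\<^sup>2\<close> given the data set A, and let
  \<open>m\<^sub>i = (M\<^sub>i - \<rho>) / \<sigma>\<close>. The residual products are \<open>R\<^sub>i = M\<^sub>i + E\<^sub>i\<close>, so that the centred statistic
  equals \<open>(U + r / \<sigma>) / (\<tau>\<^sub>D / \<sigma>)\<close> with \<open>U = \<Sum> m\<^sub>i / sqrt n\<close> and \<open>r = \<Sum> E\<^sub>i / sqrt n\<close>, and \<open>\<tau>\<^sub>D\<close> is a seminorm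
  (the empirical standard deviation) of \<open>R\<close>.

  The part of \<open>r\<close> containing the product of the two estimation errors is at most \<open>C sqrt (n A\<^sub>f A\<^sub>g)\<close> by
  Cauchy-Schwarz. The two parts that are linear in \<open>\<xi>\<close> or \<open>\<epsilon>\<close> are sums of terms that are centred and
  uncorrelated given all \<open>z\<^sub>i\<close>, even after restriction to the event \<open>B\<^sub>f \<le> \<kappa>\<close>, which depends on the
  \<open>z\<^sub>i\<close> and the auxiliary data only; on it their second moment is at most \<open>C\<^sup>2 \<kappa>\<close>. Given A the \<open>m\<^sub>i\<close> are
  i.i.d. with bounded moments of order \<open>2 + \<eta>\<close>, which yields explicit bounds for the characteristic
  function of \<open>U\<close> and a truncated law of large numbers for \<open>m\<^sub>i\<^sup>2\<close>; integrating these over A and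
  neglecting the event that \<open>\<sigma>\<^sup>2\<close> is small gives the limit law along every sequence \<open>P\<^sub>n\<close> of
  distributions. Polya's argument makes it uniform in \<open>t\<close>, and uniformity in \<open>P\<close> follows since the
  sequence \<open>P\<^sub>n\<close> may be chosen to be the least favourable one.
\<close>

section \<open>Conditionally centred noise under a product measure\<close>

text \<open>The conditional second moments \<open>u\<close> and \<open>v\<close> may be infinite,
  and B_f, B_g are small only in probability, so the noise sums need not have finite variance. This
  forces the restriction to the event that B_f is small; for frozen auxiliary data it is an event in
  the z's, so its indicator is just one more weight and leaves the conditional centring intact.

  In the first part the lower bound for the variance is random. It enters only as tightness: for
  every e > 0 some constant c > 0 exceeds the variance with probability at most e, for each n \<ge>
  1. Elsewhere all constants are built from c, C, \<theta> and the moment bound K and do not see P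
  or A. So one argument about sequences serves both parts, a single P being a constant sequence.

  Replacing \<eta> by min \<eta> 1 lets the moment of order 2 + \<theta> interpolate between second
  and third order errors of the characteristic function.

  Since x / 0 = 0, the quotient formula for the statistic can fail where a denominator vanishes. The
  limit is therefore derived from the product of the statistic with \<open>tauD\<close> / sigma,
  needed only up to a term vanishing in probability.\<close>

text \<open>Redrawing one coordinate keeps the product law; integrating over the new coordinate first then
  plays the role of conditioning on all other coordinates.\<close>

lemma nn_integral_PiM_resample:
  fixes i :: 'i
  assumes "prob_space P" and [measurable]: "F \<in> borel_measurable (PiM UNIV (\<lambda>_::'i. P))"
  shows "(\<integral>\<^sup>+w. F w \<partial>PiM UNIV (\<lambda>_. P)) = (\<integral>\<^sup>+w. \<integral>\<^sup>+x. F (w(i := x)) \<partial>P \<partial>PiM UNIV (\<lambda>_. P))"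
proof -
  let ?S = "PiM UNIV (\<lambda>_::'i. P)"
  interpret P: prob_space P by fact
  interpret S: prob_space ?S using assms(1) by (intro prob_space_PiM)
  interpret PS: pair_sigma_finite P ?S ..
  have up[measurable]: "(\<lambda>(x, w). w(i := x)) \<in> P \<Otimes>\<^sub>M ?S \<rightarrow>\<^sub>M ?S"
    unfolding split_beta'
    by (rule measurable_fun_upd[where J=UNIV]) auto
  have "distr (P \<Otimes>\<^sub>M ?S) ?S (\<lambda>(x, w). w(i := x)) = ?S"
    using distr_pair_PiM_eq_PiM[of UNIV "\<lambda>_. P" i] assms(1) by simp
  then have "(\<integral>\<^sup>+w. F w \<partial>?S) = (\<integral>\<^sup>+w. F w \<partial>distr (P \<Otimes>\<^sub>M ?S) ?S (\<lambda>(x, w). w(i := x)))" by simp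
  also have "\<dots> = (\<integral>\<^sup>+p. F ((\<lambda>(x, w). w(i := x)) p) \<partial>(P \<Otimes>\<^sub>M ?S))"
    by (rule nn_integral_distr) simp_all
  also have "\<dots> = (\<integral>\<^sup>+w. \<integral>\<^sup>+x. F (w(i := x)) \<partial>P \<partial>?S)"
    by (subst PS.nn_integral_snd[symmetric]) simp_all
  finally show ?thesis .
qed

lemma integral_PiM_resample:
  fixes i :: 'i and F :: "_ \<Rightarrow> real"
  assumes "prob_space P" and F: "integrable (PiM UNIV (\<lambda>_::'i. P)) F"
  shows "(\<integral>w. F w \<partial>PiM UNIV (\<lambda>_. P)) = (\<integral>w. \<integral>x. F (w(i := x)) \<partial>P \<partial>PiM UNIV (\<lambda>_. P))"
proof -
  let ?S = "PiM UNIV (\<lambda>_::'i. P)"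
  interpret P: prob_space P by fact
  interpret S: prob_space ?S using assms(1) by (intro prob_space_PiM)
  interpret PS: pair_sigma_finite P ?S ..
  have [measurable]: "F \<in> borel_measurable ?S" using F by auto
  have up[measurable]: "(\<lambda>(x, w). w(i := x)) \<in> P \<Otimes>\<^sub>M ?S \<rightarrow>\<^sub>M ?S"
    unfolding split_beta'
    by (rule measurable_fun_upd[where J=UNIV]) auto
  have eq: "distr (P \<Otimes>\<^sub>M ?S) ?S (\<lambda>(x, w). w(i := x)) = ?S"
    using distr_pair_PiM_eq_PiM[of UNIV "\<lambda>_. P" i] assms(1) by simp
  then have "(\<integral>w. F w \<partial>?S) = (\<integral>w. F w \<partial>distr (P \<Otimes>\<^sub>M ?S) ?S (\<lambda>(x, w). w(i := x)))" by simp
  also have "\<dots> = (\<integral>p. F ((\<lambda>(x, w). w(i := x)) p) \<partial>(P \<Otimes>\<^sub>M ?S))"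
    by (rule integral_distr) simp_all
  also have "(\<lambda>p. F ((\<lambda>(x, w). w(i := x)) p)) = case_prod (\<lambda>x w. F (w(i := x)))" by auto
  also have "integral\<^sup>L (P \<Otimes>\<^sub>M ?S) \<dots> = (\<integral>w. \<integral>x. F (w(i := x)) \<partial>P \<partial>?S)"
  proof (rule PS.integral_snd[symmetric])
    have "integrable (P \<Otimes>\<^sub>M ?S) (\<lambda>p. F ((\<lambda>(x, w). w(i := x)) p))"
      using F eq by (subst integrable_distr_eq[symmetric, where N="?S"]) auto
    then show "integrable (P \<Otimes>\<^sub>M ?S) (\<lambda>(x, w). F (w(i := x)))" by (simp add: split_beta')
  qed
  finally show ?thesis .
qed

text \<open>The second moment of \<open>\<xi>\<close> given \<open>\<zeta>\<close> may be infinite, and \<open>\<xi>\<close> only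
  averages out against those weights \<open>\<psi>\<close> for which the product is integrable.\<close>

locale cond_noise = prob_space P for P :: "'w measure" +
  fixes N :: "'z measure" and \<zeta> :: "'w \<Rightarrow> 'z" and \<xi> :: "'w \<Rightarrow> real" and v :: "'z \<Rightarrow> ennreal"
  assumes zeta_meas[measurable]: "\<zeta> \<in> P \<rightarrow>\<^sub>M N"
    and xi_meas[measurable]: "\<xi> \<in> borel_measurable P"
    and v_meas[measurable]: "v \<in> borel_measurable N"
    and mean_zero: "\<And>\<psi>. \<psi> \<in> borel_measurable N \<Longrightarrow> integrable P (\<lambda>x. \<psi> (\<zeta> x) * \<xi> x) \<Longrightarrow>
        (\<integral>x. \<psi> (\<zeta> x) * \<xi> x \<partial>P) = 0"
    and second_moment: "\<And>\<psi>. \<psi> \<in> borel_measurable N \<Longrightarrow>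
        (\<integral>\<^sup>+x. \<psi> (\<zeta> x) * ennreal ((\<xi> x)\<^sup>2) \<partial>P) = (\<integral>\<^sup>+x. \<psi> (\<zeta> x) * v (\<zeta> x) \<partial>P)"
begin

abbreviation S :: "(nat \<Rightarrow> 'w) measure" where "S \<equiv> PiM UNIV (\<lambda>_. P)"

lemma zeta_seq_meas[measurable]: "(\<lambda>w. (\<lambda>k. \<zeta> (w k))) \<in> S \<rightarrow>\<^sub>M PiM UNIV (\<lambda>_::nat. N)"
  by (rule measurable_abs_UNIV) measurable

lemma upd_meas[measurable]:
  assumes "y \<in> space (PiM UNIV (\<lambda>_::nat. N))"
  shows "(\<lambda>z. y(i := z)) \<in> N \<rightarrow>\<^sub>M PiM UNIV (\<lambda>_::nat. N)"
  by (rule measurable_fun_upd[where J=UNIV]) (use assms in auto)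

text \<open>Redrawing coordinate i leaves \<open>\<xi> (w j)\<close> and the other \<zeta>-values
  fixed because i and j differ, so the inner integral pairs \<xi> with a weight in \<zeta> alone and
  vanishes by \<open>mean_zero\<close>.\<close>

lemma noise_offdiag:
  assumes [measurable]: "F \<in> borel_measurable (PiM UNIV (\<lambda>_::nat. N))" and "i \<noteq> j"
    and int: "integrable S (\<lambda>w. F (\<lambda>k. \<zeta> (w k)) * \<xi> (w i) * \<xi> (w j))" (is "integrable S ?F")
  shows "(\<integral>w. F (\<lambda>k. \<zeta> (w k)) * \<xi> (w i) * \<xi> (w j) \<partial>S) = 0"
proof -
  have inner: "(\<integral>x. ?F (w(i := x)) \<partial>P) = 0" if w: "w \<in> space S" for w
  proof -
    define \<psi> where "\<psi> z = F ((\<lambda>k. \<zeta> (w k))(i := z)) * \<xi> (w j)" for z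
    have sp: "(\<lambda>k. \<zeta> (w k)) \<in> space (PiM UNIV (\<lambda>_::nat. N))"
      using measurable_space[OF zeta_seq_meas w] .
    note [measurable] = upd_meas[OF sp]
    have \<psi>: "\<psi> \<in> borel_measurable N" unfolding \<psi>_def by measurable
    have "(\<lambda>k. \<zeta> ((w(i := x)) k)) = (\<lambda>k. \<zeta> (w k))(i := \<zeta> x)" for x by auto
    then have eq: "?F (w(i := x)) = \<psi> (\<zeta> x) * \<xi> x" for x
      using \<open>i \<noteq> j\<close> by (simp add: \<psi>_def del: fun_upd_apply) (simp add: mult.commute)
    show ?thesis
      unfolding eq
    \<comment> \<open>\<open>mean_zero\<close> speaks of integrable products only. A section that is
      not integrable has Bochner integral 0 by convention, so no almost-everywhere argument is
      needed.\<close>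
    proof (cases "integrable P (\<lambda>x. \<psi> (\<zeta> x) * \<xi> x)")
      case True
      then show "(\<integral>x. \<psi> (\<zeta> x) * \<xi> x \<partial>P) = 0" by (rule mean_zero[OF \<psi>])
    next
      case False
      then show "(\<integral>x. \<psi> (\<zeta> x) * \<xi> x \<partial>P) = 0" by (rule not_integrable_integral_eq)
    qed
  qed
  have "(\<integral>w. ?F w \<partial>S) = (\<integral>w. (\<integral>x. ?F (w(i := x)) \<partial>P) \<partial>S)"
    by (rule integral_PiM_resample[OF prob_space_axioms int])
  also have "\<dots> = (\<integral>w. 0 \<partial>S)"
    by (rule Bochner_Integration.integral_cong[OF refl inner])
  finally show ?thesis by (simp only: Bochner_Integration.integral_zero)
qed

text \<open>The same redrawing of coordinate i, now in \<open>ennreal\<close>: Tonelli holds without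
  integrability, so v may be infinite.\<close>

lemma noise_diag:
  assumes [measurable]: "F \<in> borel_measurable (PiM UNIV (\<lambda>_::nat. N))"
  shows "(\<integral>\<^sup>+w. F (\<lambda>k. \<zeta> (w k)) * ennreal ((\<xi> (w i))\<^sup>2) \<partial>S)
       = (\<integral>\<^sup>+w. F (\<lambda>k. \<zeta> (w k)) * v (\<zeta> (w i)) \<partial>S)" (is "(\<integral>\<^sup>+w. ?F w \<partial>S) = (\<integral>\<^sup>+w. ?G w \<partial>S)")
proof -
  have inner: "(\<integral>\<^sup>+x. ?F (w(i := x)) \<partial>P) = (\<integral>\<^sup>+x. ?G (w(i := x)) \<partial>P)" if w: "w \<in> space S" for w
  proof -
    define \<psi> where "\<psi> z = F ((\<lambda>k. \<zeta> (w k))(i := z))" for z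
    have sp: "(\<lambda>k. \<zeta> (w k)) \<in> space (PiM UNIV (\<lambda>_::nat. N))"
      using measurable_space[OF zeta_seq_meas w] .
    note [measurable] = upd_meas[OF sp]
    have \<psi>: "\<psi> \<in> borel_measurable N" unfolding \<psi>_def by measurable
    have "(\<lambda>k. \<zeta> ((w(i := x)) k)) = (\<lambda>k. \<zeta> (w k))(i := \<zeta> x)" for x by auto
    then have eq: "?F (w(i := x)) = \<psi> (\<zeta> x) * ennreal ((\<xi> x)\<^sup>2)" "?G (w(i := x)) = \<psi> (\<zeta> x) * v (\<zeta> x)" for x
      by (simp_all add: \<psi>_def fun_upd_same del: fun_upd_apply)
    show ?thesis
      unfolding eq by (rule second_moment[OF \<psi>])
  qed
  have "(\<integral>\<^sup>+w. ?F w \<partial>S) = (\<integral>\<^sup>+w. (\<integral>\<^sup>+x. ?F (w(i := x)) \<partial>P) \<partial>S)"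
    by (rule nn_integral_PiM_resample[OF prob_space_axioms]) measurable
  also have "\<dots> = (\<integral>\<^sup>+w. (\<integral>\<^sup>+x. ?G (w(i := x)) \<partial>P) \<partial>S)"
    by (rule nn_integral_cong[OF inner])
  also have "\<dots> = (\<integral>\<^sup>+w. ?G w \<partial>S)"
    by (rule nn_integral_PiM_resample[OF prob_space_axioms, symmetric]) measurable
  finally show ?thesis .
qed

text \<open>The event \<Gamma> concerns the \<zeta>-values only, so its indicator may be absorbed
  into the weight: cross terms still cancel, and on the diagonal v replaces the squared noise, where
  the bound on \<Gamma> applies. Without \<Gamma> the second moment may be infinite.\<close>

lemma noise_second_moment:
  assumes k[measurable]: "k \<in> borel_measurable N" and \<Gamma>[measurable]: "\<Gamma> \<in> sets (PiM UNIV (\<lambda>_::nat. N))"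
    and b: "\<And>z. z \<in> \<Gamma> \<Longrightarrow> (\<Sum>i<n. ennreal ((k (z i))\<^sup>2) * v (z i)) \<le> ennreal b" and "0 \<le> b"
  shows "(\<integral>\<^sup>+w. indicator \<Gamma> (\<lambda>k. \<zeta> (w k)) * (\<Sum>i<n. ennreal ((k (\<zeta> (w i)) * \<xi> (w i))\<^sup>2)) \<partial>S) \<le> ennreal b" (is ?A)
    and "(\<integral>\<^sup>+w. indicator \<Gamma> (\<lambda>k. \<zeta> (w k)) * ennreal ((\<Sum>i<n. k (\<zeta> (w i)) * \<xi> (w i))\<^sup>2) \<partial>S) \<le> ennreal b" (is ?B)
proof -
  interpret S: prob_space S by (rule prob_space_PiM) (rule prob_space_axioms)
  let ?I = "\<lambda>w. indicator \<Gamma> (\<lambda>k. \<zeta> (w k))"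
  define q where "q i w = indicator \<Gamma> (\<lambda>k. \<zeta> (w k)) * (k (\<zeta> (w i)) * \<xi> (w i))" for i and w :: "nat \<Rightarrow> 'w"
  have [measurable]: "q i \<in> borel_measurable S" for i unfolding q_def by measurable
  have qq: "ennreal ((q i w)\<^sup>2) = ?I w * ennreal ((k (\<zeta> (w i)) * \<xi> (w i))\<^sup>2)" for i w
    by (auto simp: q_def indicator_def)
  have eq: "(\<integral>\<^sup>+w. ?I w * ennreal ((k (\<zeta> (w i)) * \<xi> (w i))\<^sup>2) \<partial>S) = (\<integral>\<^sup>+w. ?I w * (ennreal ((k (\<zeta> (w i)))\<^sup>2) * v (\<zeta> (w i))) \<partial>S)" for i
    using noise_diag[of "\<lambda>z. indicator \<Gamma> z * ennreal ((k (z i))\<^sup>2)" i]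
    by (simp add: power_mult_distrib ennreal_mult mult.assoc)
  have "(\<integral>\<^sup>+w. ?I w * (\<Sum>i<n. ennreal ((k (\<zeta> (w i)) * \<xi> (w i))\<^sup>2)) \<partial>S)
      = (\<Sum>i<n. \<integral>\<^sup>+w. ?I w * ennreal ((k (\<zeta> (w i)) * \<xi> (w i))\<^sup>2) \<partial>S)"
    unfolding sum_distrib_left by (rule nn_integral_sum) measurable
  also have "\<dots> = (\<integral>\<^sup>+w. ?I w * (\<Sum>i<n. (ennreal ((k (\<zeta> (w i)))\<^sup>2) * v (\<zeta> (w i)))) \<partial>S)"
    unfolding eq sum_distrib_left by (rule nn_integral_sum[symmetric]) measurable
  also have "\<dots> \<le> (\<integral>\<^sup>+w. ennreal b \<partial>S)"
    using b by (intro nn_integral_mono) (auto simp: indicator_def)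
  also have "\<dots> = ennreal b" by (simp add: S.emeasure_space_1)
  finally show A: ?A .
  have sumq: "(\<Sum>i<n. \<integral>\<^sup>+w. ennreal ((q i w)\<^sup>2) \<partial>S) \<le> ennreal b"
    using A unfolding qq sum_distrib_left by (subst (asm) nn_integral_sum) measurable
  \<comment> \<open>The diagonal bound comes first because it supplies the integrability of products
    that \<open>noise_offdiag\<close> requires.\<close>
  have fin: "(\<integral>\<^sup>+w. ennreal ((q i w)\<^sup>2) \<partial>S) < \<infinity>" if "i < n" for i
  proof -
    have "(\<integral>\<^sup>+w. ennreal ((q i w)\<^sup>2) \<partial>S) \<le> (\<Sum>i<n. \<integral>\<^sup>+w. ennreal ((q i w)\<^sup>2) \<partial>S)"
      using that by (intro member_le_sum) auto
    also note sumq
    finally show ?thesis by (simp add: order_le_less_trans)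
  qed
  have int2: "integrable S (\<lambda>w. (q i w)\<^sup>2)" if "i < n" for i
    using fin[OF that] by (intro integrableI_nonneg) auto
  have intp: "integrable S (\<lambda>w. q i w * q j w)" if "i < n" "j < n" for i j
  proof (rule Bochner_Integration.integrable_bound)
    show "integrable S (\<lambda>w. (q i w)\<^sup>2 + (q j w)\<^sup>2)" using int2 that by simp
    show "AE w in S. norm (q i w * q j w) \<le> norm ((q i w)\<^sup>2 + (q j w)\<^sup>2)"
    proof (rule AE_I2)
      fix w
      have "2 * (\<bar>q i w\<bar> * \<bar>q j w\<bar>) \<le> (q i w)\<^sup>2 + (q j w)\<^sup>2"
        using sum_squares_bound[of "\<bar>q i w\<bar>" "\<bar>q j w\<bar>"] by simp
      moreover have "0 \<le> \<bar>q i w\<bar> * \<bar>q j w\<bar>" by simp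
      ultimately show "norm (q i w * q j w) \<le> norm ((q i w)\<^sup>2 + (q j w)\<^sup>2)"
        unfolding real_norm_def abs_mult by linarith
    qed
  qed measurable
  have off: "(\<integral>w. q i w * q j w \<partial>S) = 0" if "i < n" "j < n" "i \<noteq> j" for i j
  proof -
    have eq: "(\<lambda>w. q i w * q j w) = (\<lambda>w. (indicator \<Gamma> (\<lambda>k. \<zeta> (w k)) * k (\<zeta> (w i)) * k (\<zeta> (w j))) * \<xi> (w i) * \<xi> (w j))"
      by (auto simp: q_def indicator_def)
    show ?thesis
      using intp[OF that(1,2)] unfolding eq
      by (intro noise_offdiag[of "\<lambda>z. indicator \<Gamma> z * k (z i) * k (z j)" i j]) (use that in simp_all)
  qed
  have sq: "(\<Sum>i<n. q i w)\<^sup>2 = (\<Sum>i<n. \<Sum>j<n. q i w * q j w)" for w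
    by (simp add: power2_eq_square sum_product)
  have ints: "integrable S (\<lambda>w. (\<Sum>i<n. q i w)\<^sup>2)"
    unfolding sq using intp by (intro Bochner_Integration.integrable_sum) auto
  have "(\<integral>w. (\<Sum>i<n. q i w)\<^sup>2 \<partial>S) = (\<Sum>i<n. \<integral>w. (\<Sum>j<n. q i w * q j w) \<partial>S)"
    unfolding sq by (rule Bochner_Integration.integral_sum) (rule Bochner_Integration.integrable_sum, use intp in simp)
  also have "\<dots> = (\<Sum>i<n. \<Sum>j<n. \<integral>w. q i w * q j w \<partial>S)"
    by (intro sum.cong refl Bochner_Integration.integral_sum) (use intp in simp)
  also have "\<dots> = (\<Sum>i<n. \<integral>w. (q i w)\<^sup>2 \<partial>S)"
  proof (intro sum.cong refl)
    fix i assume i: "i \<in> {..<n}"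
    have "(\<Sum>j<n. \<integral>w. q i w * q j w \<partial>S) = (\<Sum>j<n. if j = i then \<integral>w. (q i w)\<^sup>2 \<partial>S else 0)"
      using off i by (intro sum.cong refl) (auto simp: power2_eq_square)
    then show "(\<Sum>j<n. \<integral>w. q i w * q j w \<partial>S) = (\<integral>w. (q i w)\<^sup>2 \<partial>S)" using i by simp
  qed
  finally have main: "(\<integral>w. (\<Sum>i<n. q i w)\<^sup>2 \<partial>S) = (\<Sum>i<n. \<integral>w. (q i w)\<^sup>2 \<partial>S)" .
  have "(\<integral>\<^sup>+w. ?I w * ennreal ((\<Sum>i<n. k (\<zeta> (w i)) * \<xi> (w i))\<^sup>2) \<partial>S) = (\<integral>\<^sup>+w. ennreal ((\<Sum>i<n. q i w)\<^sup>2) \<partial>S)"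
    by (intro nn_integral_cong) (auto simp: q_def indicator_def)
  also have "\<dots> = ennreal (\<Sum>i<n. \<integral>w. (q i w)\<^sup>2 \<partial>S)"
    using ints by (subst nn_integral_eq_integral) (auto simp: main)
  also have "\<dots> = (\<Sum>i<n. \<integral>\<^sup>+w. ennreal ((q i w)\<^sup>2) \<partial>S)"
    by (subst sum_ennreal[symmetric]) (use int2 in \<open>auto simp: nn_integral_eq_integral simp del: sum_ennreal intro!: sum.cong\<close>)
  also note sumq
  finally show ?B .
qed

end

section \<open>Quantitative limit theorems for i.i.d. sums\<close>

text \<open>In terms of y = s |x| this is min 6 y \<le> 6 y powr \<theta>, clear from y \<le> y powr
  \<theta> for y \<le> 1 and from 1 \<le> y powr \<theta> beyond. The left side occurs in the Taylor
  error of a characteristic function, \<open>char_approx3'\<close>.\<close>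

lemma min_le_powr:
  fixes s x \<theta> :: real
  assumes "0 < \<theta>" "\<theta> \<le> 1" "0 \<le> s"
  shows "min (6 * x\<^sup>2) (s * \<bar>x\<bar> ^ 3) \<le> 6 * s powr \<theta> * \<bar>x\<bar> powr (2 + \<theta>)"
proof (cases "x = 0")
  case False
  have x2: "x\<^sup>2 = \<bar>x\<bar> powr 2" "0 < \<bar>x\<bar>" using False by simp_all
  have r: "6 * s powr \<theta> * \<bar>x\<bar> powr (2 + \<theta>) = x\<^sup>2 * (6 * (s * \<bar>x\<bar>) powr \<theta>)"
    using assms x2 by (simp add: powr_add powr_mult)
  show ?thesis
  proof (cases "s * \<bar>x\<bar> \<le> 1")
    case True
    have "s * \<bar>x\<bar> \<le> (s * \<bar>x\<bar>) powr \<theta>"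
    proof (cases "s = 0")
      case False
      then show ?thesis
        using powr_mono'[of \<theta> 1 "s * \<bar>x\<bar>"] True assms x2 by simp
    qed simp
    also have "\<dots> \<le> 6 * (s * \<bar>x\<bar>) powr \<theta>" by simp
    finally have "x\<^sup>2 * (s * \<bar>x\<bar>) \<le> x\<^sup>2 * (6 * (s * \<bar>x\<bar>) powr \<theta>)"
      by (intro mult_left_mono) auto
    moreover have "s * \<bar>x\<bar> ^ 3 = x\<^sup>2 * (s * \<bar>x\<bar>)"
      by (simp add: power3_eq_cube power2_eq_square)
    ultimately show ?thesis unfolding r by linarith
  next
    case False
    then have "1 \<le> (s * \<bar>x\<bar>) powr \<theta>" using assms by (simp add: ge_one_powr_ge_zero)
    then have "x\<^sup>2 * 6 \<le> x\<^sup>2 * (6 * (s * \<bar>x\<bar>) powr \<theta>)"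
      by (intro mult_left_mono) auto
    then show ?thesis unfolding r by linarith
  qed
qed simp

lemma restrict_UNIV: "restrict x UNIV = x"
  by auto

lemma char_iid_sum:
  fixes h :: "'w \<Rightarrow> real"
  assumes "prob_space P" and [measurable]: "h \<in> borel_measurable P"
  shows "(\<integral>w. iexp (t * (\<Sum>i<n. h (w i))) \<partial>PiM UNIV (\<lambda>_::nat. P)) = char (distr P borel h) t ^ n"
proof -
  let ?S = "PiM UNIV (\<lambda>_::nat. P)"
  interpret P: prob_space P by fact
  interpret S: prob_space ?S using assms(1) by (intro prob_space_PiM)
  have comp: "distr ?S P (\<lambda>w. w i) = P" for i
    using distr_PiM_component[of UNIV "\<lambda>_. P" i] assms(1) by simp
  have "S.indep_vars (\<lambda>_. P) (\<lambda>i w. w i) UNIV"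
    by (subst S.indep_vars_iff_distr_eq_PiM) (simp_all add: comp restrict_UNIV)
  then have ind: "S.indep_vars (\<lambda>_. borel) (\<lambda>i w. h (w i)) {..<n}"
    by (intro S.indep_vars_subset[OF S.indep_vars_compose2[where Y="\<lambda>_. h"]]) auto
  have d: "distr ?S borel (\<lambda>w. h (w i)) = distr P borel h" for i
    using distr_distr[of h P borel "\<lambda>w. w i" ?S] by (simp add: comp comp_def)
  have "(\<integral>w. iexp (t * (\<Sum>i<n. h (w i))) \<partial>?S) = char (distr ?S borel (\<lambda>w. \<Sum>i<n. h (w i))) t"
    by (simp add: char_def integral_distr)
  also have "\<dots> = (\<Prod>i<n. char (distr ?S borel (\<lambda>w. h (w i))) t)"
    by (rule S.char_distr_sum[OF ind])
  finally show ?thesis by (simp add: d)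
qed

text \<open>Compares the n-th power of the characteristic function at t / sqrt n with that of its
  quadratic Taylor polynomial, by |a^n - b^n| \<le> n |a - b| in the unit disc. The bound sees h
  only through \<theta> and K, and the comparison value depends on t and n alone, so the estimate is
  uniform in the law and in frozen data.\<close>

lemma char_iid_approx:
  fixes h :: "'w \<Rightarrow> real"
  assumes "prob_space P" and [measurable]: "h \<in> borel_measurable P"
    and h1: "integrable P h" "(\<integral>x. h x \<partial>P) = 0"
    and h2: "integrable P (\<lambda>x. (h x)\<^sup>2)" "(\<integral>x. (h x)\<^sup>2 \<partial>P) = 1"
    and \<theta>: "0 < \<theta>" "\<theta> \<le> 1"
    and h3: "integrable P (\<lambda>x. \<bar>h x\<bar> powr (2 + \<theta>))" "(\<integral>x. \<bar>h x\<bar> powr (2 + \<theta>) \<partial>P) \<le> K"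
    and n: "0 < n" "t\<^sup>2 / 4 \<le> real n"
  shows "cmod ((\<integral>w. iexp (t * ((1 / sqrt n) * (\<Sum>i<n. h (w i)))) \<partial>PiM UNIV (\<lambda>_::nat. P))
           - complex_of_real ((1 + (- t\<^sup>2 / 2) / n) ^ n)) \<le> t\<^sup>2 * (\<bar>t\<bar> / sqrt n) powr \<theta> * K"
proof -
  interpret P: prob_space P by fact
  let ?t = "t / sqrt n"
  interpret h: real_distribution "distr P borel h" by (rule P.real_distribution_distr) simp
  have t2: "?t\<^sup>2 = t\<^sup>2 / n" by (simp add: power_divide)
  have int: "integrable P (\<lambda>x. min (6 * (h x)\<^sup>2) (\<bar>?t\<bar> * \<bar>h x\<bar> ^ 3))"
    using h2(1) by (rule Bochner_Integration.integrable_bound[OF integrable_mult_right[of 6]]) auto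
  have "cmod (char (distr P borel h) ?t - (1 - ?t\<^sup>2 * 1 / 2))
      \<le> (?t\<^sup>2 / 6) * (\<integral>x. min (6 * (h x)\<^sup>2) (\<bar>?t\<bar> * \<bar>h x\<bar> ^ 3) \<partial>P)"
    by (rule P.char_approx3') (use h1 h2 in auto)
  also have "\<dots> \<le> (?t\<^sup>2 / 6) * (6 * \<bar>?t\<bar> powr \<theta> * K)"
  proof (rule mult_left_mono)
    have "(\<integral>x. min (6 * (h x)\<^sup>2) (\<bar>?t\<bar> * \<bar>h x\<bar> ^ 3) \<partial>P)
        \<le> (\<integral>x. 6 * \<bar>?t\<bar> powr \<theta> * \<bar>h x\<bar> powr (2 + \<theta>) \<partial>P)"
    proof (rule integral_mono[OF int])
      show "min (6 * (h x)\<^sup>2) (\<bar>?t\<bar> * \<bar>h x\<bar> ^ 3) \<le> 6 * \<bar>?t\<bar> powr \<theta> * \<bar>h x\<bar> powr (2 + \<theta>)" for x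
        by (rule min_le_powr[OF \<theta>]) simp
    qed (use h3(1) in simp)
    also have "\<dots> = 6 * \<bar>?t\<bar> powr \<theta> * (\<integral>x. \<bar>h x\<bar> powr (2 + \<theta>) \<partial>P)" by simp
    also have "\<dots> \<le> 6 * \<bar>?t\<bar> powr \<theta> * K" using h3(2) by (intro mult_left_mono) auto
    finally show "(\<integral>x. min (6 * (h x)\<^sup>2) (\<bar>?t\<bar> * \<bar>h x\<bar> ^ 3) \<partial>P) \<le> 6 * \<bar>?t\<bar> powr \<theta> * K" .
  qed simp
  also have "\<dots> = t\<^sup>2 * (\<bar>t\<bar> / sqrt n) powr \<theta> * K / n" by (simp add: t2)
  also have "complex_of_real (1 - ?t\<^sup>2 * 1 / 2) = complex_of_real (1 + (- t\<^sup>2 / 2) / n)"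
    by (simp add: t2)
  finally have 1: "cmod (char (distr P borel h) ?t - complex_of_real (1 + (- t\<^sup>2 / 2) / n)) \<le> t\<^sup>2 * (\<bar>t\<bar> / sqrt n) powr \<theta> * K / n" .
  \<comment> \<open>The hypothesis t^2 / 4 \<le> n keeps this base at or above -1, as the comparison
    of powers needs.\<close>
  have "\<bar>1 + (- t\<^sup>2 / 2) / n\<bar> \<le> 1" using n by (auto simp: abs_le_iff field_simps)
  then have "cmod (complex_of_real (1 + (- t\<^sup>2 / 2) / n)) \<le> 1"
    unfolding norm_of_real .
  then have "cmod (char (distr P borel h) ?t ^ n - complex_of_real (1 + (- t\<^sup>2 / 2) / n) ^ n)
     \<le> n * cmod (char (distr P borel h) ?t - complex_of_real (1 + (- t\<^sup>2 / 2) / n))"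
    by (intro norm_power_diff h.cmod_char_le_1)
  also have "\<dots> \<le> n * (t\<^sup>2 * (\<bar>t\<bar> / sqrt n) powr \<theta> * K / n)"
    using 1 by (intro mult_left_mono) auto
  also have "\<dots> = t\<^sup>2 * (\<bar>t\<bar> / sqrt n) powr \<theta> * K" using n by simp
  finally show ?thesis
    using char_iid_sum[OF assms(1,2), of ?t n] by (simp add: mult.assoc)
qed

text \<open>Conditioning on a constant is no conditioning: with \<zeta> valued in
  \<open>unit\<close>, \<open>cond_noise\<close> only asks for a centred variable, so the second
  moment bound for noise sums also serves i.i.d. sums.\<close>

lemma cond_noise_trivial:
  assumes "prob_space P" "q \<in> borel_measurable P" "integrable P q" "(\<integral>x. q x \<partial>P) = 0"
  shows "cond_noise P (count_space (UNIV :: unit set)) (\<lambda>_. ()) q (\<lambda>_. \<integral>\<^sup>+x. ennreal ((q x)\<^sup>2) \<partial>P)"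
proof -
  interpret prob_space P by fact
  show ?thesis
    by unfold_locales (use assms in \<open>auto simp: nn_integral_cmult emeasure_space_1\<close>)
qed

lemma iid_chebyshev:
  fixes q :: "'w \<Rightarrow> real"
  assumes P: "prob_space P" and [measurable]: "q \<in> borel_measurable P"
    and q: "integrable P q" "(\<integral>x. q x \<partial>P) = 0" "integrable P (\<lambda>x. (q x)\<^sup>2)" "(\<integral>x. (q x)\<^sup>2 \<partial>P) \<le> b"
    and "0 < n" "0 < \<delta>"
  shows "measure (PiM UNIV (\<lambda>_::nat. P)) {w \<in> space (PiM UNIV (\<lambda>_::nat. P)). \<delta> \<le> \<bar>(1 / n) * (\<Sum>i<n. q (w i))\<bar>} \<le> b / (n * \<delta>\<^sup>2)"
proof -
  let ?S = "PiM UNIV (\<lambda>_::nat. P)"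
  interpret P: prob_space P by fact
  interpret S: prob_space ?S using P by (intro prob_space_PiM)
  interpret cond_noise P "count_space (UNIV :: unit set)" "\<lambda>_. ()" q "\<lambda>_. \<integral>\<^sup>+x. ennreal ((q x)\<^sup>2) \<partial>P"
    by (rule cond_noise_trivial) fact+
  have b0: "0 \<le> b" using q(4) by (rule order_trans[rotated]) simp
  have qb: "(\<integral>\<^sup>+x. ennreal ((q x)\<^sup>2) \<partial>P) \<le> ennreal b"
    using q by (subst nn_integral_eq_integral) (auto intro: ennreal_leI)
  have "(\<integral>\<^sup>+w. indicator UNIV (\<lambda>k::nat. ()) * ennreal ((\<Sum>i<n. 1 * q (w i))\<^sup>2) \<partial>?S) \<le> ennreal (n * b)"
  proof (rule noise_second_moment(2)[where k="\<lambda>_. 1" and \<Gamma>=UNIV])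
    show "UNIV \<in> sets (PiM UNIV (\<lambda>_::nat. count_space (UNIV :: unit set)))"
      using sets.top[of "PiM UNIV (\<lambda>_::nat. count_space (UNIV :: unit set))"] by (simp add: space_PiM)
    have "of_nat n * (\<integral>\<^sup>+x. ennreal ((q x)\<^sup>2) \<partial>P) \<le> of_nat n * ennreal b"
      using qb by (intro mult_left_mono) auto
    then show "(\<Sum>i<n. ennreal (1\<^sup>2) * (\<integral>\<^sup>+x. ennreal ((q x)\<^sup>2) \<partial>P)) \<le> ennreal (n * b)"
      using b0 by (simp add: ennreal_mult ennreal_of_nat_eq_real_of_nat)
  qed (use b0 in auto)
  then have main: "(\<integral>\<^sup>+w. ennreal ((\<Sum>i<n. q (w i))\<^sup>2) \<partial>?S) \<le> ennreal (n * b)" by simp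
  then have int: "integrable ?S (\<lambda>w. (\<Sum>i<n. q (w i))\<^sup>2)"
    by (intro integrableI_nonneg) (auto intro: order_le_less_trans)
  have le: "(\<integral>w. (\<Sum>i<n. q (w i))\<^sup>2 \<partial>?S) \<le> n * b"
    using main b0 int by (subst (asm) nn_integral_eq_integral) auto
  have "{w \<in> space ?S. \<delta> \<le> \<bar>(1 / n) * (\<Sum>i<n. q (w i))\<bar>} \<subseteq> {w \<in> space ?S. (n * \<delta>)\<^sup>2 \<le> (\<Sum>i<n. q (w i))\<^sup>2}"
  proof clarsimp
    fix w :: "nat \<Rightarrow> 'w" assume "\<delta> \<le> \<bar>\<Sum>i<n. q (w i)\<bar> / real n"
    then have "n * \<delta> \<le> \<bar>\<Sum>i<n. q (w i)\<bar>" using \<open>0 < n\<close> by (simp add: field_simps)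
    then show "(n * \<delta>)\<^sup>2 \<le> (\<Sum>i<n. q (w i))\<^sup>2"
      using power_mono[of "n * \<delta>" "\<bar>\<Sum>i<n. q (w i)\<bar>" 2] assms(8) by simp
  qed
  then have "measure ?S {w \<in> space ?S. \<delta> \<le> \<bar>(1 / n) * (\<Sum>i<n. q (w i))\<bar>}
      \<le> measure ?S {w \<in> space ?S. (n * \<delta>)\<^sup>2 \<le> (\<Sum>i<n. q (w i))\<^sup>2}"
    by (rule S.finite_measure_mono) measurable
  also have "\<dots> \<le> (\<integral>w. (\<Sum>i<n. q (w i))\<^sup>2 \<partial>?S) / (n * \<delta>)\<^sup>2"
    by (rule integral_Markov_inequality_measure[where A="{}"]) (use int assms in auto)
  also have "\<dots> \<le> (n * b) / (n * \<delta>)\<^sup>2" using le by (intro divide_right_mono) auto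
  also have "\<dots> = b / (n * \<delta>\<^sup>2)" using assms by (simp add: power2_eq_square)
  finally show ?thesis .
qed

text \<open>Meant for squares with little more than one moment, to which Chebyshev does not apply
  directly. Values up to L have variance at most L^2; the rest has mean at most
  \<open>K * L powr - \<theta>\<close> and is controlled by Markov's inequality. L stays free so
  that it can be fixed according to the tolerance before n grows.\<close>

lemma iid_lln_truncated:
  fixes h :: "'w \<Rightarrow> real"
  assumes P: "prob_space P" and [measurable]: "h \<in> borel_measurable P" and h0: "\<And>x. 0 \<le> h x"
    and h: "integrable P h" "integrable P (\<lambda>x. h x powr (1 + \<theta>))" "(\<integral>x. h x powr (1 + \<theta>) \<partial>P) \<le> K"
    and pos: "0 < \<theta>" "0 < n" "0 < \<delta>" "0 < L"
  shows "measure (PiM UNIV (\<lambda>_::nat. P)) {w \<in> space (PiM UNIV (\<lambda>_::nat. P)). \<delta> \<le> \<bar>(1 / n) * (\<Sum>i<n. h (w i)) - (\<integral>x. h x \<partial>P)\<bar>}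
    \<le> 4 * L\<^sup>2 / (n * \<delta>\<^sup>2) + 4 * K * L powr - \<theta> / \<delta>"
proof -
  let ?S = "PiM UNIV (\<lambda>_::nat. P)"
  interpret P: prob_space P by fact
  interpret S: prob_space ?S using P by (intro prob_space_PiM)
  define h1 where "h1 x = (if h x \<le> L then h x else 0)" for x
  define h2 where "h2 x = (if h x \<le> L then 0 else h x)" for x
  have [measurable]: "h1 \<in> borel_measurable P" "h2 \<in> borel_measurable P"
    unfolding h1_def h2_def by measurable
  have h12: "h x = h1 x + h2 x" for x by (simp add: h1_def h2_def)
  have b: "0 \<le> h1 x" "h1 x \<le> L" "0 \<le> h2 x" for x using h0 pos by (auto simp: h1_def h2_def)
  have i1: "integrable P h1" and i1': "integrable P (\<lambda>x. (h1 x)\<^sup>2)"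
    using b pos by (auto intro!: P.integrable_const_bound[where B=L and f=h1] P.integrable_const_bound[where B="L\<^sup>2" and f="\<lambda>x. (h1 x)\<^sup>2"] AE_I2 power_mono simp: abs_le_square_iff[symmetric])
  have i2: "integrable P h2"
    using Bochner_Integration.integrable_diff[OF h(1) i1] by (simp add: h12)
  have h2_le: "h2 x \<le> L powr - \<theta> * h x powr (1 + \<theta>)" for x
  proof (cases "h x \<le> L")
    case False
    then have "L powr \<theta> \<le> h x powr \<theta>" "0 < h x" using pos by (auto intro!: powr_mono2)
    then have "h x * L powr \<theta> \<le> h x * h x powr \<theta>" by (intro mult_left_mono) auto
    then have "h x * L powr \<theta> \<le> h x powr (1 + \<theta>)" using \<open>0 < h x\<close> by (simp add: powr_add)
    then show ?thesis using False pos by (simp add: h2_def powr_minus field_simps)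
  qed (simp add: h2_def)
  have m2: "(\<integral>x. h2 x \<partial>P) \<le> K * L powr - \<theta>"
  proof -
    have "(\<integral>x. h2 x \<partial>P) \<le> (\<integral>x. L powr - \<theta> * h x powr (1 + \<theta>) \<partial>P)"
      by (rule integral_mono[OF i2 _ h2_le]) (use h in simp)
    also have "\<dots> \<le> L powr - \<theta> * K" using h by (simp add: mult_left_mono)
    finally show ?thesis by (simp add: mult.commute)
  qed
  define q where "q x = h1 x - (\<integral>x. h1 x \<partial>P)" for x
  have [measurable]: "q \<in> borel_measurable P" unfolding q_def by measurable
  have q1: "integrable P q" "(\<integral>x. q x \<partial>P) = 0"
    unfolding q_def using i1 by (auto simp: P.prob_space)
  have q_sq: "(q x)\<^sup>2 = (h1 x)\<^sup>2 - 2 * (\<integral>x. h1 x \<partial>P) * h1 x + (\<integral>x. h1 x \<partial>P)\<^sup>2" for x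
    by (simp add: q_def power2_diff)
  have q2: "integrable P (\<lambda>x. (q x)\<^sup>2)" unfolding q_sq using i1 i1' by simp
  have "(\<integral>x. (q x)\<^sup>2 \<partial>P) = (\<integral>x. (h1 x)\<^sup>2 \<partial>P) - (\<integral>x. h1 x \<partial>P)\<^sup>2"
    unfolding q_sq using i1 i1' by (simp add: P.prob_space power2_eq_square)
  also have "\<dots> \<le> (\<integral>x. (h1 x)\<^sup>2 \<partial>P)" by simp
  also have "\<dots> \<le> (\<integral>x. L\<^sup>2 \<partial>P)" by (rule integral_mono[OF i1']) (use b in \<open>auto intro!: power_mono\<close>)
  finally have q3: "(\<integral>x. (q x)\<^sup>2 \<partial>P) \<le> L\<^sup>2" by (simp add: P.prob_space)
  have E1: "measure ?S {w \<in> space ?S. \<delta> / 2 \<le> \<bar>(1 / n) * (\<Sum>i<n. q (w i))\<bar>} \<le> L\<^sup>2 / (n * (\<delta> / 2)\<^sup>2)"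
    by (rule iid_chebyshev[OF P]) (use q1 q2 q3 pos in auto)
  have comp: "distr ?S P (\<lambda>w. w i) = P" for i
    using distr_PiM_component[of UNIV "\<lambda>_. P" i] P by simp
  have i2S: "integrable ?S (\<lambda>w. h2 (w i))" for i
    using i2 integrable_distr_eq[of "\<lambda>w. w i" ?S P h2] by (simp add: comp)
  have e2S: "(\<integral>w. h2 (w i) \<partial>?S) = (\<integral>x. h2 x \<partial>P)" for i
    using integral_distr[of "\<lambda>w. w i" ?S P h2] by (simp add: comp)
  \<comment> \<open>\<open>G\<close> collects both effects of the large values: their empirical
    average and their share of the expectation. It is nonnegative with twice the mean of
    \<open>h2\<close>, which together with the threshold \<delta> / 2 gives the factor 4.\<close>
  define G where "G w = (1 / n) * (\<Sum>i<n. h2 (w i)) + (\<integral>x. h2 x \<partial>P)" for w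
  have h2m: "0 \<le> (\<integral>x. h2 x \<partial>P)" using b by simp
  have GI: "integrable ?S G" unfolding G_def using i2S by simp
  have GE: "(\<integral>w. G w \<partial>?S) = 2 * (\<integral>x. h2 x \<partial>P)"
    unfolding G_def using i2S pos by (simp add: e2S S.prob_space)
  have [measurable]: "G \<in> borel_measurable ?S" using GI by auto
  have G0: "0 \<le> G w" for w unfolding G_def using b h2m by (simp add: sum_nonneg)
  have "measure ?S {w \<in> space ?S. \<delta> / 2 \<le> G w} \<le> (\<integral>w. G w \<partial>?S) / (\<delta> / 2)"
    by (rule integral_Markov_inequality_measure[where A="{}"])
       (use GI pos G0 in auto)
  also have "\<dots> \<le> (2 * (K * L powr - \<theta>)) / (\<delta> / 2)"
    unfolding GE using m2 pos by (intro divide_right_mono mult_left_mono) auto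
  finally have E2: "measure ?S {w \<in> space ?S. \<delta> / 2 \<le> G w} \<le> 4 * K * L powr - \<theta> / \<delta>" by simp
  have "{w \<in> space ?S. \<delta> \<le> \<bar>(1 / n) * (\<Sum>i<n. h (w i)) - (\<integral>x. h x \<partial>P)\<bar>}
     \<subseteq> {w \<in> space ?S. \<delta> / 2 \<le> \<bar>(1 / n) * (\<Sum>i<n. q (w i))\<bar>} \<union> {w \<in> space ?S. \<delta> / 2 \<le> G w}"
  proof clarify
    fix w
    assume w: "\<delta> \<le> \<bar>(1 / n) * (\<Sum>i<n. h (w i)) - (\<integral>x. h x \<partial>P)\<bar>" "\<not> \<delta> / 2 \<le> G w"
    let ?a = "(1 / n) * (\<Sum>i<n. h2 (w i))"
    have a0: "0 \<le> ?a" using b by (simp add: sum_nonneg)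
    have "(1 / n) * (\<Sum>i<n. q (w i)) = (1 / n) * (\<Sum>i<n. h1 (w i)) - (\<integral>x. h1 x \<partial>P)"
      using pos by (simp add: q_def sum_subtractf field_simps)
    moreover have "(\<integral>x. h x \<partial>P) = (\<integral>x. h1 x \<partial>P) + (\<integral>x. h2 x \<partial>P)"
      unfolding h12 using i1 i2 by simp
    moreover have "(1 / n) * (\<Sum>i<n. h (w i)) = (1 / n) * (\<Sum>i<n. h1 (w i)) + ?a"
      unfolding h12 by (simp add: sum.distrib add_divide_distrib)
    ultimately show "\<delta> / 2 \<le> \<bar>(1 / n) * (\<Sum>i<n. q (w i))\<bar>"
      using w a0 h2m unfolding G_def by linarith
  qed
  then have "measure ?S {w \<in> space ?S. \<delta> \<le> \<bar>(1 / n) * (\<Sum>i<n. h (w i)) - (\<integral>x. h x \<partial>P)\<bar>}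
     \<le> measure ?S ({w \<in> space ?S. \<delta> / 2 \<le> \<bar>(1 / n) * (\<Sum>i<n. q (w i))\<bar>} \<union> {w \<in> space ?S. \<delta> / 2 \<le> G w})"
    by (rule S.finite_measure_mono) measurable
  also have "\<dots> \<le> measure ?S {w \<in> space ?S. \<delta> / 2 \<le> \<bar>(1 / n) * (\<Sum>i<n. q (w i))\<bar>} + measure ?S {w \<in> space ?S. \<delta> / 2 \<le> G w}"
    by (rule measure_Un_le) measurable
  also have "\<dots> \<le> L\<^sup>2 / (n * (\<delta> / 2)\<^sup>2) + 4 * K * L powr - \<theta> / \<delta>"
    using E1 E2 by simp
  finally show ?thesis by (simp add: power_divide mult.commute)
qed

section \<open>Convergence to the normal distribution function\<close>

lemma Phi_eq_cdf: "Phi = cdf std_normal_distribution"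
  by (rule ext) (simp add: Phi_def cdf_def)

lemma isCont_Phi: "isCont Phi t"
proof -
  interpret real_distribution std_normal_distribution by (rule real_dist_normal_dist)
  have "emeasure std_normal_distribution {t} = 0"
    by (subst emeasure_density) (auto intro!: nn_integral_null_set[where N=lborel] simp: null_sets_def)
  then show ?thesis unfolding Phi_eq_cdf isCont_cdf by (simp add: measure_def)
qed

lemma mono_Phi: "mono Phi"
proof -
  interpret real_distribution std_normal_distribution by (rule real_dist_normal_dist)
  show ?thesis unfolding Phi_eq_cdf by (auto intro!: monoI cdf_nondecreasing)
qed

lemma Phi_nonneg: "0 \<le> Phi t" and Phi_le_1: "Phi t \<le> 1"
proof -
  interpret real_distribution std_normal_distribution by (rule real_dist_normal_dist)
  show "0 \<le> Phi t" "Phi t \<le> 1" unfolding Phi_eq_cdf by (auto intro: cdf_nonneg cdf_bounded_prob)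
qed

lemma Phi_surj:
  assumes "0 < p" "p < 1"
  shows "\<exists>t. Phi t = p"
proof -
  interpret real_distribution std_normal_distribution by (rule real_dist_normal_dist)
  have "eventually (\<lambda>t. Phi t < p) at_bot"
    unfolding Phi_eq_cdf by (rule order_tendstoD(2)[OF cdf_lim_at_bot assms(1)])
  then obtain a where a: "Phi a < p" by (auto simp: eventually_at_bot_linorder)
  have "eventually (\<lambda>t. Phi t > p) at_top"
    unfolding Phi_eq_cdf by (rule order_tendstoD(1)[OF cdf_lim_at_top_prob assms(2)])
  then obtain b where b: "Phi b > p" by (auto simp: eventually_at_top_linorder)
  have "a \<le> b" using a b monoD[OF mono_Phi, of b a] by (cases "a \<le> b") auto
  then show ?thesis using IVT[of Phi a p b] a b isCont_Phi by auto
qed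

text \<open>Convergence at the finitely many quantiles of the levels j / N is simultaneous, and
  monotonicity of both functions carries it to every t with a loss of at most two levels, 2 / N
  \<le> e / 2.\<close>

lemma polya_Phi:
  fixes F :: "nat \<Rightarrow> real \<Rightarrow> real"
  assumes mono: "\<And>n. mono (F n)" and F0: "\<And>n t. 0 \<le> F n t" and F1: "\<And>n t. F n t \<le> 1"
    and lim: "\<And>t. (\<lambda>n. F n t) \<longlonglongrightarrow> Phi t" and "0 < e"
  shows "\<forall>\<^sub>F n in sequentially. \<forall>t. \<bar>F n t - Phi t\<bar> \<le> e"
proof -
  obtain N :: nat where N: "4 / e < real N" using reals_Archimedean2 by blast
  then have N0: "0 < real N" using \<open>0 < e\<close> by (meson divide_pos_pos less_trans zero_less_numeral)
  then have N2: "2 / real N \<le> e / 2" using N \<open>0 < e\<close> by (simp add: field_simps)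
  have N1: "1 / real N \<le> 2 / real N" by (simp add: divide_right_mono)
  have "\<exists>t. Phi t = real j / real N" if "j \<in> {1..<N}" for j
    using that by (intro Phi_surj) auto
  then obtain q where q: "\<And>j. j \<in> {1..<N} \<Longrightarrow> Phi (q j) = real j / real N" by metis
  have "\<forall>\<^sub>F n in sequentially. \<bar>F n (q j) - Phi (q j)\<bar> < e / 2" for j
    using tendstoD[OF lim[of "q j"], of "e / 2"] \<open>0 < e\<close> by (simp add: dist_real_def)
  then have "\<forall>\<^sub>F n in sequentially. \<forall>j\<in>{1..<N}. \<bar>F n (q j) - Phi (q j)\<bar> < e / 2"
    by (intro eventually_ball_finite) auto
  then show ?thesis
  proof eventually_elim
    fix n assume n: "\<forall>j\<in>{1..<N}. \<bar>F n (q j) - Phi (q j)\<bar> < e / 2"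
    show "\<forall>t. \<bar>F n t - Phi t\<bar> \<le> e"
    proof
      fix t
      \<comment> \<open>The bracket for t runs from \<open>q (j - 1)\<close> to
        \<open>q (j + 1)\<close>: weak monotonicity of \<open>Phi\<close> locates t only from strict
        inequalities between values, and at \<open>q j\<close> equality is possible. Where a
        neighbour is not among the chosen quantiles, the bounds 0 and 1 on F suffice.\<close>
      define j where "j = nat \<lfloor>real N * Phi t\<rfloor>"
      have j: "real j \<le> real N * Phi t" "real N * Phi t < real j + 1"
        using Phi_nonneg[of t] N0 unfolding j_def by (auto simp: of_nat_nat)
      then have j': "real j / N \<le> Phi t" "Phi t < real j / N + 1 / N" using N0 by (auto simp: field_simps)
      have jN: "j \<le> N"
      proof -
        have "real N * Phi t \<le> real N" using Phi_le_1[of t] N0 by (simp add: mult_left_le)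
        then show ?thesis using j(1) by linarith
      qed
      have "F n t \<le> Phi t + e"
      proof (cases "j + 1 < N")
        case True
        then have J: "j + 1 \<in> {1..<N}" by auto
        have "Phi t < Phi (q (j + 1))" using j' q[OF J] by (simp add: add_divide_distrib)
        then have "t \<le> q (j + 1)" using monoD[OF mono_Phi, of "q (j + 1)" t] by (cases "t \<le> q (j + 1)") auto
        then have "F n t \<le> F n (q (j + 1))" by (rule monoD[OF mono])
        moreover have "F n (q (j + 1)) < Phi (q (j + 1)) + e / 2" using bspec[OF n J] by linarith
        moreover have "Phi (q (j + 1)) \<le> Phi t + 1 / N" using j' q[OF J] by (simp add: add_divide_distrib)
        ultimately show ?thesis using N1 N2 by linarith
      next
        case False
        then have "N \<le> j + 1" by simp
        then have "1 \<le> (real j + 1) / N" using N0 by simp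
        also have "\<dots> \<le> Phi t + 1 / N" using j' by (simp add: add_divide_distrib)
        finally show ?thesis using F1[of n t] N1 N2 \<open>0 < e\<close> by linarith
      qed
      moreover have "Phi t - e \<le> F n t"
      proof (cases "2 \<le> j")
        case True
        then have J: "j - 1 \<in> {1..<N}" using jN by auto
        have qj: "Phi (q (j - 1)) = real j / N - 1 / N" using q[OF J] True by (simp add: of_nat_diff diff_divide_distrib)
        then have "Phi (q (j - 1)) < Phi t" using j' N0 by (smt (verit) divide_pos_pos)
        then have "q (j - 1) \<le> t" using monoD[OF mono_Phi, of t "q (j - 1)"] by (cases "q (j - 1) \<le> t") auto
        then have "F n (q (j - 1)) \<le> F n t" by (rule monoD[OF mono])
        moreover have "Phi (q (j - 1)) - e / 2 < F n (q (j - 1))" using bspec[OF n J] by linarith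
        moreover have "Phi t \<le> Phi (q (j - 1)) + 2 / N" using j' qj by simp
        ultimately show ?thesis using N2 by linarith
      next
        case False
        then have "real j / N \<le> 1 / N" by (simp add: divide_right_mono)
        then have "Phi t \<le> 2 / N" using j' by simp
        then show ?thesis using F0[of n t] N2 \<open>0 < e\<close> by linarith
      qed
      ultimately show "\<bar>F n t - Phi t\<bar> \<le> e" by linarith
    qed
  qed
qed

text \<open>The space may change with n, as the law does. Measurability is included because
  \<open>measure\<close> is 0 on non-measurable sets, which would make the limit
  meaningless.\<close>

definition vanishes_in_prob :: "(nat \<Rightarrow> 'a measure) \<Rightarrow> (nat \<Rightarrow> 'a \<Rightarrow> real) \<Rightarrow> bool" where
  "vanishes_in_prob M X \<longleftrightarrow> (\<forall>n. X n \<in> borel_measurable (M n)) \<and>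
     (\<forall>\<delta>>0. (\<lambda>n. measure (M n) {x \<in> space (M n). \<delta> < \<bar>X n x\<bar>}) \<longlonglongrightarrow> 0)"

lemma vanishes_in_prob_meas: "vanishes_in_prob M X \<Longrightarrow> X n \<in> borel_measurable (M n)"
  by (simp add: vanishes_in_prob_def)

lemma vanishes_in_prob_add:
  assumes M: "\<And>n. prob_space (M n)" and X: "vanishes_in_prob M X" and Y: "vanishes_in_prob M Y"
  shows "vanishes_in_prob M (\<lambda>n x. X n x + Y n x)"
  unfolding vanishes_in_prob_def
proof (intro conjI allI impI)
  note [measurable] = vanishes_in_prob_meas[OF X] vanishes_in_prob_meas[OF Y]
  show "(\<lambda>x. X n x + Y n x) \<in> borel_measurable (M n)" for n by measurable
  fix \<delta> :: real assume "0 < \<delta>"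
  then have lim: "(\<lambda>n. measure (M n) {x \<in> space (M n). \<delta> / 2 < \<bar>X n x\<bar>} + measure (M n) {x \<in> space (M n). \<delta> / 2 < \<bar>Y n x\<bar>}) \<longlonglongrightarrow> 0 + 0"
    using X Y half_gt_zero[OF \<open>0 < \<delta>\<close>] unfolding vanishes_in_prob_def by (intro tendsto_add) blast+
  have "measure (M n) {x \<in> space (M n). \<delta> < \<bar>X n x + Y n x\<bar>}
      \<le> measure (M n) {x \<in> space (M n). \<delta> / 2 < \<bar>X n x\<bar>} + measure (M n) {x \<in> space (M n). \<delta> / 2 < \<bar>Y n x\<bar>}" for n
  proof -
    interpret prob_space "M n" by (rule M)
    have "measure (M n) {x \<in> space (M n). \<delta> < \<bar>X n x + Y n x\<bar>}
      \<le> measure (M n) ({x \<in> space (M n). \<delta> / 2 < \<bar>X n x\<bar>} \<union> {x \<in> space (M n). \<delta> / 2 < \<bar>Y n x\<bar>})"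
      by (rule finite_measure_mono) auto
    also have "\<dots> \<le> measure (M n) {x \<in> space (M n). \<delta> / 2 < \<bar>X n x\<bar>} + measure (M n) {x \<in> space (M n). \<delta> / 2 < \<bar>Y n x\<bar>}"
      by (rule measure_Un_le) measurable
    finally show ?thesis .
  qed
  then show "(\<lambda>n. measure (M n) {x \<in> space (M n). \<delta> < \<bar>X n x + Y n x\<bar>}) \<longlonglongrightarrow> 0"
    by (intro tendsto_sandwich[OF _ _ tendsto_const lim[simplified]]) auto
qed

text \<open>The passage from \<delta> to \<delta>' need not be linear: it covers multiples, square
  roots, and a variable that is nonzero only where Y exceeds a fixed threshold.\<close>

lemma vanishes_in_prob_bound:
  assumes M: "\<And>n. prob_space (M n)" and Y: "vanishes_in_prob M Y"
    and X: "\<And>n. X n \<in> borel_measurable (M n)"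
    and le: "\<And>\<delta>. 0 < \<delta> \<Longrightarrow> \<exists>\<delta>'>0. \<forall>n. \<forall>x\<in>space (M n). \<delta> < \<bar>X n x\<bar> \<longrightarrow> \<delta>' < \<bar>Y n x\<bar>"
  shows "vanishes_in_prob M X"
  unfolding vanishes_in_prob_def
proof (intro conjI allI impI X)
  note [measurable] = vanishes_in_prob_meas[OF Y] X
  fix \<delta> :: real assume "0 < \<delta>"
  then obtain \<delta>' where d: "\<delta>' > 0" "\<And>n x. x \<in> space (M n) \<Longrightarrow> \<delta> < \<bar>X n x\<bar> \<Longrightarrow> \<delta>' < \<bar>Y n x\<bar>" using le by blast
  have le: "measure (M n) {x \<in> space (M n). \<delta> < \<bar>X n x\<bar>} \<le> measure (M n) {x \<in> space (M n). \<delta>' < \<bar>Y n x\<bar>}" for n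
  proof -
    interpret prob_space "M n" by (rule M)
    show ?thesis by (rule finite_measure_mono, use d in blast) measurable
  qed
  have lim: "(\<lambda>n. measure (M n) {x \<in> space (M n). \<delta>' < \<bar>Y n x\<bar>}) \<longlonglongrightarrow> 0"
    using Y d(1) unfolding vanishes_in_prob_def by blast
  show "(\<lambda>n. measure (M n) {x \<in> space (M n). \<delta> < \<bar>X n x\<bar>}) \<longlonglongrightarrow> 0"
    by (rule tendsto_sandwich[OF always_eventually always_eventually tendsto_const[of 0] lim]) (use le in simp_all)
qed

lemma vanishes_in_prob_le_mult:
  assumes "\<And>n. prob_space (M n)" "vanishes_in_prob M Y" "\<And>n. X n \<in> borel_measurable (M n)" "0 < B"
    and le: "\<And>n x. x \<in> space (M n) \<Longrightarrow> \<bar>X n x\<bar> \<le> B * \<bar>Y n x\<bar>"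
  shows "vanishes_in_prob M X"
proof (rule vanishes_in_prob_bound[OF assms(1-3)])
  fix \<delta> :: real assume "0 < \<delta>"
  have "\<delta> / B < \<bar>Y n x\<bar>" if "x \<in> space (M n)" "\<delta> < \<bar>X n x\<bar>" for n x
    using le[OF that(1)] that(2) assms(4) by (simp add: field_simps)
  then show "\<exists>\<delta>'>0. \<forall>n. \<forall>x\<in>space (M n). \<delta> < \<bar>X n x\<bar> \<longrightarrow> \<delta>' < \<bar>Y n x\<bar>"
    using assms(4) \<open>0 < \<delta>\<close> by (intro exI[of _ "\<delta> / B"]) auto
qed

lemma vanishes_in_prob_sqrt:
  assumes "\<And>n. prob_space (M n)" "vanishes_in_prob M Y" 
  shows "vanishes_in_prob M (\<lambda>n x. sqrt (Y n x))"
proof (rule vanishes_in_prob_bound[OF assms])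
  note [measurable] = vanishes_in_prob_meas[OF assms(2)]
  show "(\<lambda>x. sqrt (Y n x)) \<in> borel_measurable (M n)" for n by measurable
  fix \<delta> :: real assume "0 < \<delta>"
  have "\<delta>\<^sup>2 < \<bar>Y n x\<bar>" if "\<delta> < \<bar>sqrt (Y n x)\<bar>" for n x
  proof -
    have "\<delta>\<^sup>2 < (sqrt \<bar>Y n x\<bar>)\<^sup>2"
      by (rule power_strict_mono) (use that \<open>0 < \<delta>\<close> in \<open>simp_all only: real_sqrt_abs' less_imp_le pos2\<close>)
    then show ?thesis by simp
  qed
  then show "\<exists>\<delta>'>0. \<forall>n. \<forall>x\<in>space (M n). \<delta> < \<bar>sqrt (Y n x)\<bar> \<longrightarrow> \<delta>' < \<bar>Y n x\<bar>"
    using \<open>0 < \<delta>\<close> by (intro exI[of _ "\<delta>\<^sup>2"]) auto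
qed

text \<open>A random scale bounded away from 0 merely in probability is enough: restrict to c \<le>
  s with a fixed c, then let the exceptional probability shrink. Index 0 is exempt because the
  variance is bounded below only from n = 1 on.\<close>

lemma vanishes_in_prob_tight:
  fixes s :: "nat \<Rightarrow> 'a \<Rightarrow> real"
  assumes M: "\<And>n. prob_space (M n)" and X[measurable]: "\<And>n. X n \<in> borel_measurable (M n)"
    and s[measurable]: "\<And>n. s n \<in> borel_measurable (M n)"
    and tight: "\<And>e. 0 < e \<Longrightarrow> \<exists>c>0. \<forall>n\<ge>1. measure (M n) {x \<in> space (M n). s n x < c} \<le> e"
    and good: "\<And>c \<delta>. 0 < c \<Longrightarrow> 0 < \<delta> \<Longrightarrow> (\<lambda>n. measure (M n) {x \<in> space (M n). \<delta> < \<bar>X n x\<bar> \<and> c \<le> s n x}) \<longlonglongrightarrow> 0"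
  shows "vanishes_in_prob M X"
  unfolding vanishes_in_prob_def
proof (intro conjI allI impI X)
  fix \<delta> :: real assume "0 < \<delta>"
  show "(\<lambda>n. measure (M n) {x \<in> space (M n). \<delta> < \<bar>X n x\<bar>}) \<longlonglongrightarrow> 0"
  proof (rule LIMSEQ_I)
    fix e :: real assume "0 < e"
    obtain c where c: "c > 0" "\<And>n. n \<ge> 1 \<Longrightarrow> measure (M n) {x \<in> space (M n). s n x < c} \<le> e / 2"
      using tight[of "e / 2"] \<open>0 < e\<close> by auto
    obtain n0 where n0: "\<And>n. n \<ge> n0 \<Longrightarrow> measure (M n) {x \<in> space (M n). \<delta> < \<bar>X n x\<bar> \<and> c \<le> s n x} < e / 2"
      using LIMSEQ_D[OF good[OF c(1) \<open>0 < \<delta>\<close>], of "e / 2"] \<open>0 < e\<close> by auto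
    show "\<exists>no. \<forall>n\<ge>no. norm (measure (M n) {x \<in> space (M n). \<delta> < \<bar>X n x\<bar>} - 0) < e"
    proof (intro exI[of _ "max 1 n0"] allI impI)
      fix n assume n: "max 1 n0 \<le> n"
      interpret prob_space "M n" by (rule M)
      have "measure (M n) {x \<in> space (M n). \<delta> < \<bar>X n x\<bar>}
         \<le> measure (M n) ({x \<in> space (M n). \<delta> < \<bar>X n x\<bar> \<and> c \<le> s n x} \<union> {x \<in> space (M n). s n x < c})"
        by (rule finite_measure_mono) auto
      also have "\<dots> \<le> measure (M n) {x \<in> space (M n). \<delta> < \<bar>X n x\<bar> \<and> c \<le> s n x} + measure (M n) {x \<in> space (M n). s n x < c}"
        by (rule measure_Un_le) measurable
      finally show "norm (measure (M n) {x \<in> space (M n). \<delta> < \<bar>X n x\<bar>} - 0) < e"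
        using n0[of n] c(2)[of n] n by simp
    qed
  qed
qed

text \<open>The hypothesis on T * s, instead of T = (U + R) / s, tolerates events on which a
  denominator is 0 and the quotient identity breaks down.\<close>

lemma slutsky_Phi:
  assumes M: "\<And>n. prob_space (M n)" and U[measurable]: "\<And>n. U n \<in> borel_measurable (M n)"
    and R: "vanishes_in_prob M R" and s: "vanishes_in_prob M (\<lambda>n x. s n x - 1)"
    and T[measurable]: "\<And>n. T n \<in> borel_measurable (M n)"
    and T_eq: "vanishes_in_prob M (\<lambda>n x. T n x * s n x - (U n x + R n x))"
    and clt: "\<And>t. (\<lambda>n. measure (M n) {x \<in> space (M n). U n x \<le> t}) \<longlonglongrightarrow> Phi t"
  shows "(\<lambda>n. measure (M n) {x \<in> space (M n). T n x \<le> t}) \<longlonglongrightarrow> Phi t"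
proof (rule LIMSEQ_I)
  fix e :: real assume "0 < e"
  have "\<forall>e>0. \<exists>\<eta>>0. \<forall>y. \<bar>y - t\<bar> < \<eta> \<longrightarrow> \<bar>Phi y - Phi t\<bar> < e"
    using isCont_Phi[of t] unfolding continuous_at_eps_delta dist_real_def .
  then have "\<exists>\<eta>>0. \<forall>y. \<bar>y - t\<bar> < \<eta> \<longrightarrow> \<bar>Phi y - Phi t\<bar> < e / 4"
    using \<open>0 < e\<close> by (elim allE[of _ "e / 4"]) simp
  then obtain \<eta> where \<eta>: "\<eta> > 0" "\<And>y. \<bar>y - t\<bar> < \<eta> \<Longrightarrow> \<bar>Phi y - Phi t\<bar> < e / 4" by blast
  \<comment> \<open>On the good event U differs from T * s by at most 2 * \<kappa>, and t * s from t
    by at most \<kappa> * |t|. The second argument of \<open>min\<close> keeps the total within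
    \<eta> / 2, the first keeps s positive.\<close>
  define \<kappa> where "\<kappa> = min (1 / 2) (\<eta> / (2 * (\<bar>t\<bar> + 2)))"
  have \<kappa>: "0 < \<kappa>" "\<kappa> < 1" using \<eta> by (auto simp: \<kappa>_def)
  have "\<kappa> * (\<bar>t\<bar> + 2) \<le> (\<eta> / (2 * (\<bar>t\<bar> + 2))) * (\<bar>t\<bar> + 2)"
    unfolding \<kappa>_def by (rule mult_right_mono) auto
  also have "\<dots> = \<eta> / 2" by (simp add: field_simps)
  finally have \<kappa>t: "\<kappa> * \<bar>t\<bar> + 2 * \<kappa> \<le> \<eta> / 2" by (simp add: algebra_simps)
  let ?pr = "\<lambda>n A. measure (M n) {x \<in> space (M n). A x}"
  have Rm[measurable]: "R n \<in> borel_measurable (M n)" for n using R by (rule vanishes_in_prob_meas)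
  have [measurable]: "(\<lambda>x. s n x - 1) \<in> borel_measurable (M n)" for n using s by (rule vanishes_in_prob_meas)
  have [measurable]: "(\<lambda>x. T n x * s n x - (U n x + R n x)) \<in> borel_measurable (M n)" for n using T_eq by (rule vanishes_in_prob_meas)
  define bad where "bad n = ?pr n (\<lambda>x. \<kappa> < \<bar>R n x\<bar>) + ?pr n (\<lambda>x. \<kappa> < \<bar>s n x - 1\<bar>)
     + ?pr n (\<lambda>x. \<kappa> < \<bar>T n x * s n x - (U n x + R n x)\<bar>)" for n
  have "bad \<longlonglongrightarrow> 0 + 0 + 0"
    unfolding bad_def using R s T_eq \<kappa>(1) unfolding vanishes_in_prob_def by (intro tendsto_add) auto
  then have b: "\<forall>\<^sub>F n in sequentially. bad n < e / 4"
    using \<open>0 < e\<close> by (intro order_tendstoD(2)[of bad 0]) auto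
  have *: "\<forall>\<^sub>F n in sequentially. \<bar>?pr n (\<lambda>x. U n x \<le> y) - Phi y\<bar> < e / 4" for y
    using tendstoD[OF clt[of y], of "e / 4"] \<open>0 < e\<close> by (simp add: dist_real_def)
  have "\<forall>\<^sub>F n in sequentially. \<bar>?pr n (\<lambda>x. T n x \<le> t) - Phi t\<bar> < e"
    using b *[of "t + \<eta> / 2"] *[of "t - \<eta> / 2"]
  proof eventually_elim
    fix n assume b: "bad n < e / 4" and u1: "\<bar>?pr n (\<lambda>x. U n x \<le> t + \<eta> / 2) - Phi (t + \<eta> / 2)\<bar> < e / 4"
      and u2: "\<bar>?pr n (\<lambda>x. U n x \<le> t - \<eta> / 2) - Phi (t - \<eta> / 2)\<bar> < e / 4"
    interpret prob_space "M n" by (rule M)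
    let ?B1 = "{x \<in> space (M n). \<kappa> < \<bar>R n x\<bar>}" and ?B2 = "{x \<in> space (M n). \<kappa> < \<bar>s n x - 1\<bar>}"
      and ?B3 = "{x \<in> space (M n). \<kappa> < \<bar>T n x * s n x - (U n x + R n x)\<bar>}"
    have [measurable]: "?B1 \<in> sets (M n)" "?B2 \<in> sets (M n)" "?B3 \<in> sets (M n)" by measurable
    have bad3: "measure (M n) (A \<union> (?B1 \<union> ?B2 \<union> ?B3)) \<le> measure (M n) A + bad n" if [measurable]: "A \<in> sets (M n)" for A
    proof -
      have "measure (M n) (A \<union> (?B1 \<union> ?B2 \<union> ?B3)) \<le> measure (M n) A + measure (M n) (?B1 \<union> ?B2 \<union> ?B3)"
        by (rule measure_Un_le) measurable
      also have "measure (M n) (?B1 \<union> ?B2 \<union> ?B3) \<le> measure (M n) (?B1 \<union> ?B2) + measure (M n) ?B3"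
        by (rule measure_Un_le) measurable
      also have "measure (M n) (?B1 \<union> ?B2) \<le> measure (M n) ?B1 + measure (M n) ?B2"
        by (rule measure_Un_le) measurable
      finally show ?thesis unfolding bad_def by simp
    qed
    have st: "\<bar>t * s n x - t\<bar> \<le> \<kappa> * \<bar>t\<bar>" if "\<bar>s n x - 1\<bar> \<le> \<kappa>" for x
    proof -
      have "\<bar>t * s n x - t\<bar> = \<bar>s n x - 1\<bar> * \<bar>t\<bar>" by (simp add: abs_mult[symmetric] algebra_simps)
      then show ?thesis using that by (simp add: mult_right_mono)
    qed
    have "?pr n (\<lambda>x. T n x \<le> t) \<le> measure (M n) ({x \<in> space (M n). U n x \<le> t + \<eta> / 2} \<union> (?B1 \<union> ?B2 \<union> ?B3))"
    proof (rule finite_measure_mono, rule subsetI, rule ccontr, goal_cases)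
      case (1 x)
      then have x: "T n x \<le> t" "\<not> U n x \<le> t + \<eta> / 2" "\<bar>R n x\<bar> \<le> \<kappa>" "\<bar>s n x - 1\<bar> \<le> \<kappa>"
        "\<bar>T n x * s n x - (U n x + R n x)\<bar> \<le> \<kappa>" by auto
      then have "T n x * s n x \<le> t * s n x" using \<kappa> by (intro mult_right_mono) auto
      then show ?case using x st[OF x(4)] \<kappa>t by linarith
    qed measurable
    also note bad3
    finally have up: "?pr n (\<lambda>x. T n x \<le> t) \<le> ?pr n (\<lambda>x. U n x \<le> t + \<eta> / 2) + bad n" by simp
    have "?pr n (\<lambda>x. U n x \<le> t - \<eta> / 2) \<le> measure (M n) ({x \<in> space (M n). T n x \<le> t} \<union> (?B1 \<union> ?B2 \<union> ?B3))"
    proof (rule finite_measure_mono, rule subsetI, rule ccontr, goal_cases)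
      case (1 x)
      then have x: "U n x \<le> t - \<eta> / 2" "t < T n x" "\<bar>R n x\<bar> \<le> \<kappa>" "\<bar>s n x - 1\<bar> \<le> \<kappa>"
        "\<bar>T n x * s n x - (U n x + R n x)\<bar> \<le> \<kappa>" by auto
      then have "T n x * s n x \<le> t * s n x" using st[OF x(4)] \<kappa>t by linarith
      moreover have "0 < s n x" using x \<kappa> by linarith
      ultimately show ?case using x(2) by simp
    qed measurable
    also note bad3
    finally have low: "?pr n (\<lambda>x. U n x \<le> t - \<eta> / 2) \<le> ?pr n (\<lambda>x. T n x \<le> t) + bad n" by simp
    have p1: "\<bar>Phi (t + \<eta> / 2) - Phi t\<bar> < e / 4" using \<eta>(1) by (intro \<eta>(2)) simp
    have p2: "\<bar>Phi (t - \<eta> / 2) - Phi t\<bar> < e / 4" using \<eta>(1) by (intro \<eta>(2)) simp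
    have "?pr n (\<lambda>x. T n x \<le> t) < Phi t + e" using up b u1 p1 by linarith
    moreover have "Phi t - e < ?pr n (\<lambda>x. T n x \<le> t)" using low b u2 p2 by linarith
    ultimately show "\<bar>?pr n (\<lambda>x. T n x \<le> t) - Phi t\<bar> < e" by linarith
  qed
  then show "\<exists>no. \<forall>n\<ge>no. norm (?pr n (\<lambda>x. T n x \<le> t) - Phi t) < e"
    by (simp add: eventually_sequentially)
qed

section \<open>The setting for a single distribution\<close>

text \<open>Testing e against indicators says that its conditional expectation given Z is 0 almost
  surely; the pull-out property then handles every weight with integrable product, bounded or
  not.\<close>

lemma cond_mean_zero:
  fixes e :: "'w \<Rightarrow> real"
  assumes P: "prob_space P" and Z[measurable]: "Z \<in> P \<rightarrow>\<^sub>M N" and e: "integrable P e"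
    and zero: "\<And>B. B \<in> sets N \<Longrightarrow> (\<integral>x. indicator B (Z x) * e x \<partial>P) = 0"
    and \<psi>[measurable]: "\<psi> \<in> borel_measurable N" and int: "integrable P (\<lambda>x. \<psi> (Z x) * e x)"
  shows "(\<integral>x. \<psi> (Z x) * e x \<partial>P) = 0"
proof -
  interpret prob_space P by fact
  let ?F = "vimage_algebra (space P) Z N"
  have sp: "Z \<in> space P \<rightarrow> space N" using measurable_space[OF Z] by auto
  have sub: "subalgebra P ?F"
    unfolding subalgebra_def using sets_vimage_algebra2[OF sp] measurable_sets[OF Z] by auto
  interpret finite_measure_subalgebra P ?F by unfold_locales (rule sub)
  have [measurable]: "e \<in> borel_measurable P" using e by auto
  have ZF: "Z \<in> ?F \<rightarrow>\<^sub>M N" by (rule measurable_vimage_algebra1[OF sp])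
  have ae: "AE x in P. real_cond_exp P ?F e x = 0"
  proof (rule real_cond_exp_charact)
    fix A assume "A \<in> sets ?F"
    then obtain B where B: "B \<in> sets N" "A = Z -` B \<inter> space P"
      using sets_vimage_algebra2[OF sp] by auto
    have "(\<integral>x\<in>A. e x \<partial>P) = (\<integral>x. indicator B (Z x) * e x \<partial>P)"
      unfolding set_lebesgue_integral_def
      by (rule Bochner_Integration.integral_cong) (auto simp: B indicator_def)
    then show "(\<integral>x\<in>A. e x \<partial>P) = (\<integral>x\<in>A. 0 \<partial>P)" using zero[OF B(1)] by simp
  qed (use e in auto)
  have "(\<integral>x. \<psi> (Z x) * e x \<partial>P) = (\<integral>x. \<psi> (Z x) * real_cond_exp P ?F e x \<partial>P)"
    by (rule real_cond_exp_intg(2)[symmetric]) (use int measurable_compose[OF ZF \<psi>] in auto)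
  also have "\<dots> = (\<integral>x. 0 \<partial>P)"
    by (rule integral_cong_AE) (use ae in auto)
  finally show ?thesis by simp
qed

lemma nn_cond_integral_eq:
  assumes Z[measurable]: "Z \<in> P \<rightarrow>\<^sub>M N" and h[measurable]: "h \<in> borel_measurable P" and v[measurable]: "v \<in> borel_measurable N"
    and eq: "\<And>B. B \<in> sets N \<Longrightarrow> (\<integral>\<^sup>+x. indicator B (Z x) * h x \<partial>P) = (\<integral>\<^sup>+x. indicator B (Z x) * v (Z x) \<partial>P)"
    and \<psi>[measurable]: "\<psi> \<in> borel_measurable N"
  shows "(\<integral>\<^sup>+x. \<psi> (Z x) * h x \<partial>P) = (\<integral>\<^sup>+x. \<psi> (Z x) * v (Z x) \<partial>P)"
proof -
  have dm: "distr (density P h) N Z = distr (density P (\<lambda>x. v (Z x))) N Z"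
  proof (rule measure_eqI)
    fix B assume "B \<in> sets (distr (density P h) N Z)"
    then have B[measurable]: "B \<in> sets N" by simp
    have *: "emeasure (distr (density P k) N Z) B = (\<integral>\<^sup>+x. indicator B (Z x) * k x \<partial>P)"
      if [measurable]: "k \<in> borel_measurable P" for k
      by (subst emeasure_distr, simp_all, subst emeasure_density)
         (auto intro!: nn_integral_cong simp: indicator_def measurable_sets[OF Z B])
    show "emeasure (distr (density P h) N Z) B = emeasure (distr (density P (\<lambda>x. v (Z x))) N Z) B"
      using eq[OF B] by (simp add: *)
  qed simp
  have *: "(\<integral>\<^sup>+x. \<psi> (Z x) * k x \<partial>P) = (\<integral>\<^sup>+z. \<psi> z \<partial>distr (density P k) N Z)"
    if [measurable]: "k \<in> borel_measurable P" for k
    by (subst nn_integral_distr, simp_all, subst nn_integral_density)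
       (auto intro!: nn_integral_cong simp: mult.commute)
  show ?thesis by (simp add: * dm)
qed

lemma markov_on:
  fixes X :: "'w \<Rightarrow> real"
  assumes N: "prob_space N" and [measurable]: "X \<in> borel_measurable N" "G \<in> sets N"
    and le: "(\<integral>\<^sup>+w. indicator G w * ennreal (X w) \<partial>N) \<le> ennreal b" and "0 \<le> b" "0 < t"
  shows "measure N {w \<in> space N. t < X w \<and> w \<in> G} \<le> b / t"
proof -
  interpret N: prob_space N by fact
  let ?E = "{w \<in> space N. t < X w \<and> w \<in> G}"
  have "ennreal t * emeasure N ?E = (\<integral>\<^sup>+w. ennreal t * indicator ?E w \<partial>N)"
    by (rule nn_integral_cmult_indicator[symmetric]) measurable
  also have "\<dots> \<le> (\<integral>\<^sup>+w. indicator G w * ennreal (X w) \<partial>N)"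
    by (intro nn_integral_mono) (auto simp: indicator_def intro!: ennreal_leI)
  also note le
  finally have "ennreal (t * measure N ?E) \<le> ennreal b"
    using \<open>0 < t\<close> by (simp add: N.emeasure_eq_measure ennreal_mult)
  then show ?thesis using assms by (simp add: field_simps)
qed

section \<open>The joint space of the sample and the auxiliary data\<close>

lemma measurable_Xo[measurable]: "Xo \<in> borel_measurable borel"
  unfolding Xo_def[abs_def] by (intro borel_measurable_continuous_onI continuous_intros)
lemma measurable_Yo[measurable]: "Yo \<in> borel_measurable borel"
  unfolding Yo_def[abs_def] by (intro borel_measurable_continuous_onI continuous_intros)
lemma measurable_Zo[measurable]: "Zo \<in> (borel :: ('z::euclidean_space) obs measure) \<rightarrow>\<^sub>M borel"
  unfolding Zo_def[abs_def] by (intro borel_measurable_continuous_onI continuous_intros)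

text \<open>C, \<theta> and K are parameters, not existentially quantified, so that all members of a
  sequence of laws can share them. The bound \<theta> \<le> 1 is what \<open>min_le_powr\<close>
  needs.\<close>

locale wgcm =
  fixes MA :: "'a measure" and MD :: "'b measure"
    and W :: "nat \<Rightarrow> 'a \<Rightarrow> 'z::euclidean_space \<Rightarrow> real"
    and fh gh :: "nat \<Rightarrow> 'b \<Rightarrow> 'z \<Rightarrow> real"
    and P :: "'z obs measure" and QA :: "'a measure" and QD :: "'b measure"
    and f g :: "'z \<Rightarrow> real" and u v :: "'z \<Rightarrow> ennreal" and C \<theta> K :: real
  assumes W_meas: "\<And>n. (\<lambda>(a, z). W n a z) \<in> borel_measurable (MA \<Otimes>\<^sub>M borel)"
    and fh_meas: "\<And>n. (\<lambda>(d, z). fh n d z) \<in> borel_measurable (MD \<Otimes>\<^sub>M borel)"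
    and gh_meas: "\<And>n. (\<lambda>(d, z). gh n d z) \<in> borel_measurable (MD \<Otimes>\<^sub>M borel)"
    and C_pos: "0 < C" and W_le: "\<And>n a z. \<bar>W n a z\<bar> \<le> C"
    and E0_P: "E0 P" and regr: "regression_versions P f g u v"
    and QA: "prob_space QA" "sets QA = sets MA" and QD: "prob_space QD" "sets QD = sets MD"
    and \<theta>: "0 < \<theta>" "\<theta> \<le> 1" and K: "0 \<le> K"
    and moment: "(\<integral>\<^sup>+w. ennreal (\<bar>eps f w * xi g w\<bar> powr (2 + \<theta>)) \<partial>P) \<le> ennreal K"
begin

abbreviation S :: "(nat \<Rightarrow> 'z obs) measure" where "S \<equiv> PiM UNIV (\<lambda>_. P)"
abbreviation Om :: "((nat \<Rightarrow> 'z obs) \<times> 'a \<times> 'b) measure" where "Om \<equiv> sample_space P QA QD"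

lemma prob_P: "prob_space P" and sets_P[measurable_cong]: "sets P = sets borel"
  using E0_P by (auto simp: E0_def)

sublocale P: prob_space P by (rule prob_P)
sublocale QA: prob_space QA by (rule QA)
sublocale QD: prob_space QD by (rule QD)
sublocale S: prob_space S by (rule prob_space_PiM) (rule prob_P)
sublocale QAD: pair_prob_space QA QD ..
sublocale OmP: pair_prob_space S "QA \<Otimes>\<^sub>M QD" ..

declare QA(2)[measurable_cong] QD(2)[measurable_cong]

lemma Om_eq: "Om = S \<Otimes>\<^sub>M (QA \<Otimes>\<^sub>M QD)" by (simp add: sample_space_def)

sublocale Om: prob_space Om unfolding Om_eq by unfold_locales

lemma sets_Om[measurable_cong]: "sets Om = sets (S \<Otimes>\<^sub>M (MA \<Otimes>\<^sub>M MD))"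
  unfolding Om_eq by (intro sets_pair_measure_cong refl QA QD)

lemma space_QA: "space QA = space MA" and space_QD: "space QD = space MD"
  using QA(2) QD(2) by (auto dest: sets_eq_imp_space_eq)

lemma f_meas[measurable]: "f \<in> borel_measurable borel" and g_meas[measurable]: "g \<in> borel_measurable borel"
  and u_meas[measurable]: "u \<in> borel_measurable borel" and v_meas[measurable]: "v \<in> borel_measurable borel"
  using regr by (auto simp: regression_versions_def cond_exp_version_def nn_cond_exp_version_def)

lemma eps_meas[measurable]: "eps f \<in> borel_measurable P" and xi_meas[measurable]: "xi g \<in> borel_measurable P"
  unfolding eps_def[abs_def] xi_def[abs_def] by measurable

lemma W_meas'[measurable (raw)]:
  assumes "\<alpha> \<in> M \<rightarrow>\<^sub>M MA" "\<zeta> \<in> M \<rightarrow>\<^sub>M borel" shows "(\<lambda>x. W n (\<alpha> x) (\<zeta> x)) \<in> borel_measurable M"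
  using measurable_compose[OF measurable_Pair[OF assms] W_meas[of n]] by simp
lemma fh_meas'[measurable (raw)]:
  assumes "\<alpha> \<in> M \<rightarrow>\<^sub>M MD" "\<zeta> \<in> M \<rightarrow>\<^sub>M borel" shows "(\<lambda>x. fh n (\<alpha> x) (\<zeta> x)) \<in> borel_measurable M"
  using measurable_compose[OF measurable_Pair[OF assms] fh_meas[of n]] by simp
lemma gh_meas'[measurable (raw)]:
  assumes "\<alpha> \<in> M \<rightarrow>\<^sub>M MD" "\<zeta> \<in> M \<rightarrow>\<^sub>M borel" shows "(\<lambda>x. gh n (\<alpha> x) (\<zeta> x)) \<in> borel_measurable M"
  using measurable_compose[OF measurable_Pair[OF assms] gh_meas[of n]] by simp

lemma Om_component[measurable]: "(\<lambda>om. fst om i) \<in> Om \<rightarrow>\<^sub>M P"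
  by measurable
lemma zs_meas[measurable]: "(\<lambda>om. zs om i) \<in> Om \<rightarrow>\<^sub>M borel"
  unfolding zs_def by measurable
lemma xs_meas[measurable]: "(\<lambda>om. xs om i) \<in> Om \<rightarrow>\<^sub>M borel"
  unfolding xs_def by measurable
lemma ys_meas[measurable]: "(\<lambda>om. ys om i) \<in> Om \<rightarrow>\<^sub>M borel"
  unfolding ys_def by measurable
lemma Adata_meas[measurable]: "Adata \<in> Om \<rightarrow>\<^sub>M MA"
  unfolding Adata_def[abs_def] by measurable
lemma Ddata_meas[measurable]: "Ddata \<in> Om \<rightarrow>\<^sub>M MD"
  unfolding Ddata_def[abs_def] by measurable

lemma space_Om: "space Om = space S \<times> space MA \<times> space MD"
  unfolding Om_eq by (simp add: space_pair_measure space_QA space_QD)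

text \<open>Conditioning on both auxiliary data sets: by Tonelli, with (a, d) frozen the
  observations are still i.i.d. from P. The independence assumptions enter here and in
  \<open>Ustat_char\<close>, through the product form of the space.\<close>

lemma measure_fiber_le:
  assumes E[measurable]: "E \<in> sets Om" and "0 \<le> c"
    and fib: "\<And>a d. a \<in> space MA \<Longrightarrow> d \<in> space MD \<Longrightarrow> measure S {w \<in> space S. (w, a, d) \<in> E} \<le> c"
  shows "measure Om E \<le> c"
proof -
  have E': "E \<in> sets (S \<Otimes>\<^sub>M (QA \<Otimes>\<^sub>M QD))" using E unfolding Om_eq .
  have "emeasure Om E = (\<integral>\<^sup>+y. emeasure S ((\<lambda>x. (x, y)) -` E) \<partial>(QA \<Otimes>\<^sub>M QD))"
    unfolding Om_eq by (rule OmP.emeasure_pair_measure_alt2[OF E'])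
  also have "\<dots> \<le> (\<integral>\<^sup>+y. ennreal c \<partial>(QA \<Otimes>\<^sub>M QD))"
  proof (rule nn_integral_mono)
    fix y assume y: "y \<in> space (QA \<Otimes>\<^sub>M QD)"
    have "(\<lambda>x. (x, y)) -` E = {w \<in> space S. (w, fst y, snd y) \<in> E}"
      using sets.sets_into_space[OF E] by (auto simp: space_Om)
    then show "emeasure S ((\<lambda>x. (x, y)) -` E) \<le> ennreal c"
      using fib[of "fst y" "snd y"] y assms(2)
      by (auto simp: S.emeasure_eq_measure space_pair_measure space_QA space_QD intro!: ennreal_leI)
  qed
  also have "\<dots> = ennreal c" by (simp add: QAD.emeasure_space_1)
  finally show ?thesis using assms(2) by (simp add: Om.emeasure_eq_measure)
qed

text \<open>Used for both regressions. The defining identities involve indicators only;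
  \<open>cond_mean_zero\<close> and \<open>nn_cond_integral_eq\<close> extend them to general
  weights.\<close>

lemma cond_noise_residual:
  assumes Y: "cond_exp_version P Y h" and V: "nn_cond_exp_version P (\<lambda>w. ennreal ((Y w - h (Zo w))\<^sup>2)) s"
  shows "cond_noise P borel Zo (\<lambda>w. Y w - h (Zo w)) s"
proof
  have iY: "integrable P Y" and ih: "integrable P (\<lambda>w. h (Zo w))"
    and [measurable]: "h \<in> borel_measurable borel" and s[measurable]: "s \<in> borel_measurable borel"
    using Y V by (auto simp: cond_exp_version_def nn_cond_exp_version_def)
  have [measurable]: "Y \<in> borel_measurable P" using iY by auto
  show "(\<lambda>w. Y w - h (Zo w)) \<in> borel_measurable P" by measurable
  show "s \<in> borel_measurable borel" by (rule s)
  have iR: "integrable P (\<lambda>w. Y w - h (Zo w))" using iY ih by simp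
  have zero: "(\<integral>w. indicator B (Zo w) * (Y w - h (Zo w)) \<partial>P) = 0" if B[measurable]: "B \<in> sets borel" for B
  proof -
    have "integrable P (\<lambda>w. indicator B (Zo w) * Y w)" "integrable P (\<lambda>w. indicator B (Zo w) * h (Zo w))"
      by (rule Bochner_Integration.integrable_bound[OF iY], measurable, simp add: indicator_def)
         (rule Bochner_Integration.integrable_bound[OF ih], measurable, simp add: indicator_def)
    then show ?thesis
      using Y B unfolding cond_exp_version_def by (simp add: right_diff_distrib)
  qed
  show "(\<integral>x. \<psi> (Zo x) * (Y x - h (Zo x)) \<partial>P) = 0"
    if "\<psi> \<in> borel_measurable borel" "integrable P (\<lambda>x. \<psi> (Zo x) * (Y x - h (Zo x)))" for \<psi> :: "'z \<Rightarrow> real"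
    by (rule cond_mean_zero[OF prob_P _ iR zero that]; (assumption | measurable))
  show "(\<integral>\<^sup>+x. \<psi> (Zo x) * ennreal ((Y x - h (Zo x))\<^sup>2) \<partial>P) = (\<integral>\<^sup>+x. \<psi> (Zo x) * s (Zo x) \<partial>P)"
    if "\<psi> \<in> borel_measurable borel" for \<psi> :: "'z \<Rightarrow> ennreal"
  proof (rule nn_cond_integral_eq[OF _ _ s _ that])
    fix B :: "'z set" assume "B \<in> sets borel"
    then show "(\<integral>\<^sup>+x. indicator B (Zo x) * ennreal ((Y x - h (Zo x))\<^sup>2) \<partial>P) = (\<integral>\<^sup>+x. indicator B (Zo x) * s (Zo x) \<partial>P)"
      using V unfolding nn_cond_exp_version_def by blast
  qed measurable
qed measurable

lemma noise_xi: "cond_noise P borel Zo (xi g) v"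
  unfolding xi_def[abs_def]
  by (rule cond_noise_residual) (use regr in \<open>simp_all add: regression_versions_def xi_def\<close>)

lemma noise_eps: "cond_noise P borel Zo (eps f) u"
  unfolding eps_def[abs_def]
  by (rule cond_noise_residual) (use regr in \<open>simp_all add: regression_versions_def eps_def\<close>)

text \<open>For frozen (a, d), \<open>Bk om \<le> ennreal \<kappa>\<close> is an event in the z's,
  so \<open>noise_second_moment\<close> followed by Markov's inequality applies. The first bound
  feeds the numerator, with the weight function absorbed into the multiplier at the price C^2; the
  second, without weights, feeds the denominator.\<close>

lemma noise_sum_bounds:
  fixes k :: "'b \<Rightarrow> 'z \<Rightarrow> real" and n :: nat
  assumes noise: "cond_noise P borel Zo \<nu> vv"
    and k_meas: "(\<lambda>(d, z). k d z) \<in> borel_measurable (MD \<Otimes>\<^sub>M borel)"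
    and pos: "0 < n" "0 < \<delta>" "0 \<le> \<kappa>"
  defines "Bk \<equiv> \<lambda>om. ennreal (1 / real n) * (\<Sum>i<n. ennreal ((k (Ddata om) (zs om i))\<^sup>2) * vv (zs om i))"
  shows "measure Om {om \<in> space Om. \<delta> < \<bar>(1 / sqrt n) * (\<Sum>i<n. k (Ddata om) (zs om i) * W n (Adata om) (zs om i) * \<nu> (fst om i))\<bar> \<and> Bk om \<le> ennreal \<kappa>}
      \<le> C\<^sup>2 * \<kappa> / \<delta>\<^sup>2" (is "measure Om ?E1 \<le> _")
    and "measure Om {om \<in> space Om. \<delta> < (1 / n) * (\<Sum>i<n. (k (Ddata om) (zs om i) * \<nu> (fst om i))\<^sup>2) \<and> Bk om \<le> ennreal \<kappa>}
      \<le> \<kappa> / \<delta>" (is "measure Om ?E2 \<le> _")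
proof -
  interpret noise: cond_noise P borel Zo \<nu> vv by (rule noise)
  note noise.xi_meas[measurable] noise.v_meas[measurable]
  have k_meas'[measurable (raw)]: "(\<lambda>x. k (\<alpha> x) (\<zeta> x)) \<in> borel_measurable Om"
    if "\<alpha> \<in> Om \<rightarrow>\<^sub>M MD" "\<zeta> \<in> Om \<rightarrow>\<^sub>M borel" for \<alpha> \<zeta>
    using measurable_compose[OF measurable_Pair[OF that] k_meas] by simp
  have [measurable]: "Bk \<in> borel_measurable Om" unfolding Bk_def by measurable
  define \<Gamma> where "\<Gamma> d = {z \<in> space (PiM UNIV (\<lambda>_::nat. borel)). ennreal (1 / real n) * (\<Sum>i<n. ennreal ((k d (z i))\<^sup>2) * vv (z i)) \<le> ennreal \<kappa>}" for d
  have kd[measurable]: "k d \<in> borel_measurable borel" if "d \<in> space MD" for d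
    using measurable_compose[OF measurable_Pair1' k_meas] that by simp
  have \<Gamma>_sets: "\<Gamma> d \<in> sets (PiM UNIV (\<lambda>_::nat. borel))" if "d \<in> space MD" for d
  proof -
    note [measurable] = kd[OF that]
    show ?thesis unfolding \<Gamma>_def by measurable
  qed
  have \<Gamma>_bound: "(\<Sum>i<n. ennreal ((k d (z i))\<^sup>2) * vv (z i)) \<le> ennreal (n * \<kappa>)" if "z \<in> \<Gamma> d" for d z
  proof -
    let ?s = "\<Sum>i<n. ennreal ((k d (z i))\<^sup>2) * vv (z i)"
    have "?s = ennreal n * (ennreal (1 / real n) * ?s)"
      using pos by (simp add: mult.assoc[symmetric] ennreal_mult[symmetric])
    also have "\<dots> \<le> ennreal n * ennreal \<kappa>" using that by (intro mult_left_mono) (auto simp: \<Gamma>_def)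
    finally show ?thesis using pos by (simp add: ennreal_mult)
  qed
  have G_sets: "{w \<in> space S. (\<lambda>k. Zo (w k)) \<in> \<Gamma> d} \<in> sets S" if "d \<in> space MD" for d
    using measurable_sets[OF noise.zeta_seq_meas \<Gamma>_sets[OF that]] by (simp add: vimage_def Int_def conj_commute)
  show "measure Om ?E1 \<le> C\<^sup>2 * \<kappa> / \<delta>\<^sup>2"
  proof (rule measure_fiber_le)
    show "?E1 \<in> sets Om" by measurable
    show "0 \<le> C\<^sup>2 * \<kappa> / \<delta>\<^sup>2" using pos by simp
    fix a d assume ad: "a \<in> space MA" "d \<in> space MD"
    note [measurable] = kd[OF ad(2)]
    let ?k = "\<lambda>z. k d z * W n a z"
    have [measurable]: "?k \<in> borel_measurable borel" using ad by measurable
    let ?X = "\<lambda>w. (\<Sum>i<n. ?k (Zo (w i)) * \<nu> (w i))\<^sup>2"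
    let ?G = "{w \<in> space S. (\<lambda>k. Zo (w k)) \<in> \<Gamma> d}"
    have "(\<Sum>i<n. ennreal ((?k (z i))\<^sup>2) * vv (z i)) \<le> ennreal (C\<^sup>2 * (n * \<kappa>))" if "z \<in> \<Gamma> d" for z
    proof -
      have "(\<Sum>i<n. ennreal ((?k (z i))\<^sup>2) * vv (z i)) \<le> (\<Sum>i<n. ennreal (C\<^sup>2) * (ennreal ((k d (z i))\<^sup>2) * vv (z i)))"
      proof (rule sum_mono)
        fix i
        have "(W n a (z i))\<^sup>2 \<le> C\<^sup>2" using W_le[of n a "z i"] C_pos by (simp add: abs_le_square_iff[symmetric])
        then have "(?k (z i))\<^sup>2 \<le> C\<^sup>2 * (k d (z i))\<^sup>2"
          unfolding power_mult_distrib by (subst mult.commute) (rule mult_right_mono, auto)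
        then have "ennreal ((?k (z i))\<^sup>2) \<le> ennreal (C\<^sup>2) * ennreal ((k d (z i))\<^sup>2)"
          by (simp add: ennreal_mult[symmetric] ennreal_leI)
        then show "ennreal ((?k (z i))\<^sup>2) * vv (z i) \<le> ennreal (C\<^sup>2) * (ennreal ((k d (z i))\<^sup>2) * vv (z i))"
          unfolding mult.assoc[symmetric] by (rule mult_right_mono) simp
      qed
      also have "\<dots> = ennreal (C\<^sup>2) * (\<Sum>i<n. ennreal ((k d (z i))\<^sup>2) * vv (z i))" by (simp only: sum_distrib_left)
      also have "\<dots> \<le> ennreal (C\<^sup>2) * ennreal (n * \<kappa>)" by (intro mult_left_mono \<Gamma>_bound[OF that]) simp
      finally show ?thesis using pos by (simp add: ennreal_mult)
    qed
    from noise.noise_second_moment(2)[of ?k "\<Gamma> d" n "C\<^sup>2 * (n * \<kappa>)", OF _ \<Gamma>_sets[OF ad(2)] this]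
    have "(\<integral>\<^sup>+w. indicator (\<Gamma> d) (\<lambda>k. Zo (w k)) * ennreal (?X w) \<partial>S) \<le> ennreal (C\<^sup>2 * (n * \<kappa>))"
      using pos by simp
    then have "(\<integral>\<^sup>+w. indicator ?G w * ennreal (?X w) \<partial>S) \<le> ennreal (C\<^sup>2 * (n * \<kappa>))"
      by (subst nn_integral_cong[where v="\<lambda>w. indicator (\<Gamma> d) (\<lambda>k. Zo (w k)) * ennreal (?X w)"]) (auto simp: indicator_def)
    then have m: "measure S {w \<in> space S. n * \<delta>\<^sup>2 < ?X w \<and> w \<in> ?G} \<le> (C\<^sup>2 * (n * \<kappa>)) / (n * \<delta>\<^sup>2)"
      using pos by (intro markov_on S.prob_space_axioms G_sets ad) auto
    have "measure S {w \<in> space S. (w, a, d) \<in> ?E1} \<le> measure S {w \<in> space S. n * \<delta>\<^sup>2 < ?X w \<and> w \<in> ?G}"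
    proof (rule S.finite_measure_mono)
      show "{w \<in> space S. (w, a, d) \<in> ?E1} \<subseteq> {w \<in> space S. n * \<delta>\<^sup>2 < ?X w \<and> w \<in> ?G}"
      proof clarsimp
        fix w assume w: "w \<in> space S" "Bk (w, a, d) \<le> ennreal \<kappa>"
          and d: "\<delta> < \<bar>\<Sum>i<n. k (Ddata (w, a, d)) (zs (w, a, d) i) * W n (Adata (w, a, d)) (zs (w, a, d) i) * \<nu> (w i)\<bar> / sqrt n"
        have "\<delta> * sqrt n < \<bar>\<Sum>i<n. ?k (Zo (w i)) * \<nu> (w i)\<bar>"
          using d pos by (simp add: Ddata_def Adata_def zs_def field_simps)
        then have "(\<delta> * sqrt n)\<^sup>2 < \<bar>\<Sum>i<n. ?k (Zo (w i)) * \<nu> (w i)\<bar>\<^sup>2"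
          using pos by (intro power_strict_mono) auto
        moreover have "(\<lambda>k. Zo (w k)) \<in> \<Gamma> d"
          using w measurable_space[OF noise.zeta_seq_meas w(1)] by (simp add: \<Gamma>_def Bk_def Ddata_def zs_def)
        ultimately show "n * \<delta>\<^sup>2 < ?X w \<and> (\<lambda>k. Zo (w k)) \<in> \<Gamma> d"
          by (simp add: power_mult_distrib mult.commute)
      qed
      have [measurable]: "?G \<in> sets S" by (rule G_sets[OF ad(2)])
      show "{w \<in> space S. n * \<delta>\<^sup>2 < ?X w \<and> w \<in> ?G} \<in> sets S" by measurable
    qed
    also note m
    also have "(C\<^sup>2 * (n * \<kappa>)) / (n * \<delta>\<^sup>2) = C\<^sup>2 * \<kappa> / \<delta>\<^sup>2" using pos by simp
    finally show "measure S {w \<in> space S. (w, a, d) \<in> ?E1} \<le> C\<^sup>2 * \<kappa> / \<delta>\<^sup>2" .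
  qed
  show "measure Om ?E2 \<le> \<kappa> / \<delta>"
  proof (rule measure_fiber_le)
    show "?E2 \<in> sets Om" by measurable
    show "0 \<le> \<kappa> / \<delta>" using pos by simp
    fix a d assume ad: "a \<in> space MA" "d \<in> space MD"
    note [measurable] = kd[OF ad(2)]
    let ?X = "\<lambda>w. (\<Sum>i<n. (k d (Zo (w i)) * \<nu> (w i))\<^sup>2)"
    let ?G = "{w \<in> space S. (\<lambda>k. Zo (w k)) \<in> \<Gamma> d}"
    from noise.noise_second_moment(1)[of "k d" "\<Gamma> d" n "n * \<kappa>", OF _ \<Gamma>_sets[OF ad(2)] \<Gamma>_bound]
    have "(\<integral>\<^sup>+w. indicator (\<Gamma> d) (\<lambda>k. Zo (w k)) * ennreal (?X w) \<partial>S) \<le> ennreal (n * \<kappa>)"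
      using pos by simp
    then have "(\<integral>\<^sup>+w. indicator ?G w * ennreal (?X w) \<partial>S) \<le> ennreal (n * \<kappa>)"
      by (subst nn_integral_cong[where v="\<lambda>w. indicator (\<Gamma> d) (\<lambda>k. Zo (w k)) * ennreal (?X w)"]) (auto simp: indicator_def)
    then have m: "measure S {w \<in> space S. n * \<delta> < ?X w \<and> w \<in> ?G} \<le> (n * \<kappa>) / (n * \<delta>)"
      using pos by (intro markov_on S.prob_space_axioms G_sets ad) auto
    have "measure S {w \<in> space S. (w, a, d) \<in> ?E2} \<le> measure S {w \<in> space S. n * \<delta> < ?X w \<and> w \<in> ?G}"
    proof (rule S.finite_measure_mono)
      show "{w \<in> space S. (w, a, d) \<in> ?E2} \<subseteq> {w \<in> space S. n * \<delta> < ?X w \<and> w \<in> ?G}"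
      proof clarsimp
        fix w assume w: "w \<in> space S" "Bk (w, a, d) \<le> ennreal \<kappa>"
          and d: "\<delta> < (\<Sum>i<n. (k (Ddata (w, a, d)) (zs (w, a, d) i) * \<nu> (w i))\<^sup>2) / n"
        have "n * \<delta> < ?X w"
          using d pos by (simp add: Ddata_def zs_def field_simps)
        moreover have "(\<lambda>k. Zo (w k)) \<in> \<Gamma> d"
          using w measurable_space[OF noise.zeta_seq_meas w(1)] by (simp add: \<Gamma>_def Bk_def Ddata_def zs_def)
        ultimately show "n * \<delta> < ?X w \<and> (\<lambda>k. Zo (w k)) \<in> \<Gamma> d" by simp
      qed
      have [measurable]: "?G \<in> sets S" by (rule G_sets[OF ad(2)])
      show "{w \<in> space S. n * \<delta> < ?X w \<and> w \<in> ?G} \<in> sets S" by measurable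
    qed
    also note m
    also have "(n * \<kappa>) / (n * \<delta>) = \<kappa> / \<delta>" using pos by simp
    finally show "measure S {w \<in> space S. (w, a, d) \<in> ?E2} \<le> \<kappa> / \<delta>" .
  qed
qed

end

section \<open>Standardised residual products\<close>

lemma powr_abs_ge:
  fixes x p :: real
  assumes "2 \<le> p"
  shows "\<bar>x\<bar> \<le> 1 + \<bar>x\<bar> powr p" and "x\<^sup>2 \<le> 1 + \<bar>x\<bar> powr p"
proof -
  have "\<bar>x\<bar> \<le> 1 + \<bar>x\<bar> powr p \<and> x\<^sup>2 \<le> 1 + \<bar>x\<bar> powr p"
  proof (cases "\<bar>x\<bar> \<le> 1")
    case True
    then have "x\<^sup>2 \<le> 1" by (simp add: abs_square_le_1)
    then show ?thesis using True by (smt (verit) powr_ge_zero)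
  next
    case False
    then have 1: "\<bar>x\<bar> powr 1 \<le> \<bar>x\<bar> powr p" "\<bar>x\<bar> powr 2 \<le> \<bar>x\<bar> powr p"
      using assms by (intro powr_mono; simp)+
    have "\<bar>x\<bar> powr 2 = x\<^sup>2" using False by simp
    then show ?thesis using 1 False by simp
  qed
  then show "\<bar>x\<bar> \<le> 1 + \<bar>x\<bar> powr p" "x\<^sup>2 \<le> 1 + \<bar>x\<bar> powr p" by auto
qed

lemma powr_abs_diff_le:
  fixes x y p :: real
  assumes "0 \<le> p"
  shows "\<bar>x - y\<bar> powr p \<le> 2 powr p * (\<bar>x\<bar> powr p + \<bar>y\<bar> powr p)"
proof -
  have "\<bar>x - y\<bar> \<le> 2 * max \<bar>x\<bar> \<bar>y\<bar>" by linarith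
  then have "\<bar>x - y\<bar> powr p \<le> (2 * max \<bar>x\<bar> \<bar>y\<bar>) powr p" using assms by (intro powr_mono2) auto
  also have "\<dots> = 2 powr p * (max \<bar>x\<bar> \<bar>y\<bar>) powr p" by (simp add: powr_mult)
  also have "(max \<bar>x\<bar> \<bar>y\<bar>) powr p \<le> \<bar>x\<bar> powr p + \<bar>y\<bar> powr p" by (simp add: max_def)
  finally show ?thesis by simp
qed

context wgcm
begin

abbreviation rho where "rho n a \<equiv> rho_bar P f g W n a"
abbreviation sig2 where "sig2 n a \<equiv> sigma2_bar P f g W n a"

definition prodres :: "nat \<Rightarrow> 'a \<Rightarrow> 'z obs \<Rightarrow> real" where
  "prodres n a w = eps f w * xi g w * W n a (Zo w)"

text \<open>Where \<open>sig2\<close> is 0 the quotient is 0, so centring holds without a lower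
  bound on the variance; only the second and higher moments need one.\<close>

definition stdres :: "nat \<Rightarrow> 'a \<Rightarrow> 'z obs \<Rightarrow> real" where
  "stdres n a w = (prodres n a w - rho n a) / sqrt (sig2 n a)"

text \<open>Bounds the moment of order 2 + \<theta> of \<open>stdres\<close> when the variance is at
  least c: \<open>C powr (2 + \<theta>) * K\<close> bounds that of \<open>prodres\<close>, one more
  than this bounds the absolute value of \<open>rho\<close>, and the leading power of 2 comes from
  splitting their difference. Neither P nor n nor a occurs.\<close>

definition Kstd :: "real \<Rightarrow> real" where
  "Kstd c = 2 powr (2 + \<theta>) * (C powr (2 + \<theta>) * K + (1 + C powr (2 + \<theta>) * K) powr (2 + \<theta>)) / sqrt c powr (2 + \<theta>)"

lemma prodres_meas[measurable (raw)]:
  assumes "\<alpha> \<in> M \<rightarrow>\<^sub>M MA" "\<beta> \<in> M \<rightarrow>\<^sub>M P" shows "(\<lambda>x. prodres n (\<alpha> x) (\<beta> x)) \<in> borel_measurable M"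
proof -
  note [measurable] = assms measurable_compose[OF assms(2) eps_meas] measurable_compose[OF assms(2) xi_meas]
  have [measurable]: "(\<lambda>x. Zo (\<beta> x)) \<in> M \<rightarrow>\<^sub>M borel" by (rule measurable_compose[OF assms(2)]) measurable
  show ?thesis unfolding prodres_def by measurable
qed

lemma rho_meas[measurable]: "(\<lambda>a. rho n a) \<in> borel_measurable MA"
  unfolding rho_bar_def by measurable

lemma sig2_meas[measurable]: "(\<lambda>a. sig2 n a) \<in> borel_measurable MA"
  unfolding sigma2_bar_def by measurable

lemma stdres_meas[measurable (raw)]:
  assumes "\<alpha> \<in> M \<rightarrow>\<^sub>M MA" "\<beta> \<in> M \<rightarrow>\<^sub>M P" shows "(\<lambda>x. stdres n (\<alpha> x) (\<beta> x)) \<in> borel_measurable M"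
  using assms unfolding stdres_def by measurable

context
  fixes n :: nat and a :: 'a
  assumes a: "a \<in> space MA"
begin

lemma prodres_a_meas[measurable]: "prodres n a \<in> borel_measurable P"
  using a by measurable

lemma prodres_moment:
  "integrable P (\<lambda>w. \<bar>prodres n a w\<bar> powr (2 + \<theta>))"
  "(\<integral>w. \<bar>prodres n a w\<bar> powr (2 + \<theta>) \<partial>P) \<le> C powr (2 + \<theta>) * K"
proof -
  let ?p = "2 + \<theta>"
  let ?e = "\<lambda>w. \<bar>eps f w * xi g w\<bar> powr ?p"
  have ie: "integrable P ?e"
    using moment by (intro integrableI_nonneg) (auto intro: order_le_less_trans)
  have Ee: "(\<integral>w. ?e w \<partial>P) \<le> K"
    using moment ie K by (subst (asm) nn_integral_eq_integral) auto
  have le: "\<bar>prodres n a w\<bar> powr ?p \<le> C powr ?p * ?e w" for w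
  proof -
    have "\<bar>prodres n a w\<bar> \<le> C * \<bar>eps f w * xi g w\<bar>"
      unfolding prodres_def abs_mult using W_le[of n a "Zo w"]
      by (subst mult.commute) (intro mult_right_mono, auto)
    then have "\<bar>prodres n a w\<bar> powr ?p \<le> (C * \<bar>eps f w * xi g w\<bar>) powr ?p"
      using \<theta> by (intro powr_mono2) auto
    also have "\<dots> = C powr ?p * ?e w" using C_pos by (simp add: powr_mult)
    finally show ?thesis .
  qed
  show i: "integrable P (\<lambda>w. \<bar>prodres n a w\<bar> powr ?p)"
    by (rule Bochner_Integration.integrable_bound[OF integrable_mult_right[OF ie, of "C powr ?p"]])
       (use le in auto)
  have "(\<integral>w. \<bar>prodres n a w\<bar> powr ?p \<partial>P) \<le> (\<integral>w. C powr ?p * ?e w \<partial>P)"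
    by (rule integral_mono[OF i _ le]) (use ie in simp)
  also have "\<dots> \<le> C powr ?p * K" using Ee by (simp add: mult_left_mono)
  finally show "(\<integral>w. \<bar>prodres n a w\<bar> powr ?p \<partial>P) \<le> C powr ?p * K" .
qed

lemma prodres_integrable: "integrable P (prodres n a)" "integrable P (\<lambda>w. (prodres n a w)\<^sup>2)"
proof -
  have p: "2 \<le> 2 + \<theta>" using \<theta> by simp
  have i: "integrable P (\<lambda>w. 1 + \<bar>prodres n a w\<bar> powr (2 + \<theta>))" using prodres_moment(1) by simp
  show "integrable P (prodres n a)"
    by (rule Bochner_Integration.integrable_bound[OF i]) (use powr_abs_ge(1)[OF p] in \<open>auto intro!: AE_I2 simp: abs_of_nonneg\<close>)
  show "integrable P (\<lambda>w. (prodres n a w)\<^sup>2)"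
    by (rule Bochner_Integration.integrable_bound[OF i]) (use powr_abs_ge(2)[OF p] in \<open>auto intro!: AE_I2 simp: abs_of_nonneg\<close>)
qed

lemma rho_eq: "rho n a = (\<integral>w. prodres n a w \<partial>P)"
  by (simp add: rho_bar_def prodres_def)

lemma sig2_eq: "sig2 n a = (\<integral>w. (prodres n a w - rho n a)\<^sup>2 \<partial>P)"
  by (simp add: sigma2_bar_def prodres_def)

lemma rho_le: "\<bar>rho n a\<bar> \<le> 1 + C powr (2 + \<theta>) * K"
proof -
  have p: "2 \<le> 2 + \<theta>" using \<theta> by simp
  have "\<bar>rho n a\<bar> \<le> (\<integral>w. \<bar>prodres n a w\<bar> \<partial>P)" unfolding rho_eq by (rule integral_abs_bound)
  also have "\<dots> \<le> (\<integral>w. 1 + \<bar>prodres n a w\<bar> powr (2 + \<theta>) \<partial>P)"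
    by (rule integral_mono) (use prodres_integrable(1) prodres_moment(1) powr_abs_ge(1)[OF p] in auto)
  also have "\<dots> \<le> 1 + C powr (2 + \<theta>) * K" using prodres_moment by (simp add: P.prob_space)
  finally show ?thesis .
qed

lemma stdres_a_meas: "stdres n a \<in> borel_measurable P"
  using a by measurable

lemma stdres_mean: "integrable P (stdres n a)" "(\<integral>w. stdres n a w \<partial>P) = 0"
  unfolding stdres_def using prodres_integrable(1) by (auto simp: rho_eq P.prob_space)

context
  fixes c :: real
  assumes c: "0 < c" "c \<le> sig2 n a"
begin

lemma stdres_var: "integrable P (\<lambda>w. (stdres n a w)\<^sup>2)" "(\<integral>w. (stdres n a w)\<^sup>2 \<partial>P) = 1"
proof -
  have eq: "(stdres n a w)\<^sup>2 = (prodres n a w - rho n a)\<^sup>2 / sig2 n a" for w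
    using c by (simp add: stdres_def power_divide)
  have "integrable P (\<lambda>w. (prodres n a w - rho n a)\<^sup>2)"
    unfolding power2_diff using prodres_integrable by simp
  then show "integrable P (\<lambda>w. (stdres n a w)\<^sup>2)" "(\<integral>w. (stdres n a w)\<^sup>2 \<partial>P) = 1"
    unfolding eq using c by (simp_all add: sig2_eq[symmetric])
qed

lemma stdres_moment:
  "integrable P (\<lambda>w. \<bar>stdres n a w\<bar> powr (2 + \<theta>))"
  "(\<integral>w. \<bar>stdres n a w\<bar> powr (2 + \<theta>) \<partial>P) \<le> Kstd c"
proof -
  let ?p = "2 + \<theta>" and ?D = "1 + C powr (2 + \<theta>) * K"
  let ?B = "\<lambda>w. 2 powr ?p * (\<bar>prodres n a w\<bar> powr ?p + ?D powr ?p) / sqrt c powr ?p"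
  have p: "0 \<le> ?p" using \<theta> by simp
  have le: "\<bar>stdres n a w\<bar> powr ?p \<le> ?B w" for w
  proof -
    have "\<bar>stdres n a w\<bar> = \<bar>prodres n a w - rho n a\<bar> / sqrt (sig2 n a)"
      using c by (simp add: stdres_def)
    then have "\<bar>stdres n a w\<bar> powr ?p = \<bar>prodres n a w - rho n a\<bar> powr ?p / sqrt (sig2 n a) powr ?p"
      using c by (simp add: powr_divide)
    also have "\<dots> \<le> \<bar>prodres n a w - rho n a\<bar> powr ?p / sqrt c powr ?p"
      using c p by (intro divide_left_mono powr_mono2 mult_pos_pos) auto
    also have "\<bar>prodres n a w - rho n a\<bar> powr ?p \<le> 2 powr ?p * (\<bar>prodres n a w\<bar> powr ?p + \<bar>rho n a\<bar> powr ?p)"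
      by (rule powr_abs_diff_le[OF p])
    also have "\<bar>rho n a\<bar> powr ?p \<le> ?D powr ?p" using rho_le p by (intro powr_mono2) auto
    finally show ?thesis by (simp add: divide_right_mono)
  qed
  have iB: "integrable P ?B" using prodres_moment(1) by simp
  show i: "integrable P (\<lambda>w. \<bar>stdres n a w\<bar> powr ?p)"
    by (rule Bochner_Integration.integrable_bound[OF iB])
       (use le stdres_a_meas in \<open>auto intro!: AE_I2 order_trans[OF le]\<close>)
  have "(\<integral>w. \<bar>stdres n a w\<bar> powr ?p \<partial>P) \<le> (\<integral>w. ?B w \<partial>P)" by (rule integral_mono[OF i iB le])
  also have "\<dots> = 2 powr ?p * ((\<integral>w. \<bar>prodres n a w\<bar> powr ?p \<partial>P) + ?D powr ?p) / sqrt c powr ?p"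
    using prodres_moment(1) by (simp add: P.prob_space)
  also have "\<dots> \<le> Kstd c" unfolding Kstd_def using prodres_moment(2)
    by (intro divide_right_mono mult_left_mono) auto
  finally show "(\<integral>w. \<bar>stdres n a w\<bar> powr ?p \<partial>P) \<le> Kstd c" .
qed

end
end

text \<open>The power 1 + \<theta> / 2 of a square is the power 2 + \<theta> of the absolute value,
  so the available moment is just the one that \<open>iid_lln_truncated\<close> asks of the
  squares.\<close>

lemma stdres_lln:
  assumes n: "0 < n" and pos: "0 < c" "0 < \<delta>" "0 < L"
  shows "measure Om {om \<in> space Om. \<delta> \<le> \<bar>(1 / n) * (\<Sum>i<n. (stdres n (Adata om) (fst om i))\<^sup>2) - 1\<bar> \<and> c \<le> sig2 n (Adata om)}
    \<le> 4 * L\<^sup>2 / (n * \<delta>\<^sup>2) + 4 * Kstd c * L powr - (\<theta> / 2) / \<delta>" (is "measure Om ?E \<le> ?b")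
proof (rule measure_fiber_le)
  have Kc: "0 \<le> Kstd c" unfolding Kstd_def using K C_pos by simp
  then show b0: "0 \<le> ?b" using n pos by simp
  show "?E \<in> sets Om" by measurable
  fix a d assume ad: "a \<in> space MA" "d \<in> space MD"
  show "measure S {w \<in> space S. (w, a, d) \<in> ?E} \<le> ?b"
  proof (cases "c \<le> sig2 n a")
    case False
    then have e: "{w \<in> space S. (w, a, d) \<in> ?E} = {}" by (auto simp: Adata_def)
    show ?thesis unfolding e using b0 by simp
  next
    case True
    note [measurable] = stdres_a_meas[OF ad(1)]
    have eq: "((stdres n a w)\<^sup>2) powr (1 + \<theta> / 2) = \<bar>stdres n a w\<bar> powr (2 + \<theta>)" for w
    proof (cases "stdres n a w = 0")
      case nz: False
      have "(stdres n a w)\<^sup>2 = \<bar>stdres n a w\<bar> powr 2" using nz by simp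
      then have "((stdres n a w)\<^sup>2) powr (1 + \<theta> / 2) = \<bar>stdres n a w\<bar> powr (2 * (1 + \<theta> / 2))"
        by (simp only: powr_powr)
      then show ?thesis by (simp add: algebra_simps)
    qed simp
    have "measure S {w \<in> space S. \<delta> \<le> \<bar>(1 / n) * (\<Sum>i<n. (stdres n a (w i))\<^sup>2) - (\<integral>x. (stdres n a x)\<^sup>2 \<partial>P)\<bar>} \<le> ?b"
      using iid_lln_truncated[OF prob_P, of "\<lambda>x. (stdres n a x)\<^sup>2" "\<theta> / 2" "Kstd c" n \<delta> L]
        stdres_var[OF ad(1) pos(1) True] stdres_moment[OF ad(1) pos(1) True] n pos \<theta>
      by (simp add: eq)
    moreover have "{w \<in> space S. (w, a, d) \<in> ?E} = {w \<in> space S. \<delta> \<le> \<bar>(1 / n) * (\<Sum>i<n. (stdres n a (w i))\<^sup>2) - (\<integral>x. (stdres n a x)\<^sup>2 \<partial>P)\<bar>}"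
      using True ad stdres_var(2)[OF ad(1) pos(1) True] by (auto simp: Adata_def space_Om)
    ultimately show ?thesis by simp
  qed
qed

lemma stdres_mean_bound:
  assumes n: "0 < n" and pos: "0 < c" "0 < \<delta>"
  shows "measure Om {om \<in> space Om. \<delta> \<le> \<bar>(1 / n) * (\<Sum>i<n. stdres n (Adata om) (fst om i))\<bar> \<and> c \<le> sig2 n (Adata om)}
    \<le> 1 / (n * \<delta>\<^sup>2)" (is "measure Om ?E \<le> ?b")
proof (rule measure_fiber_le)
  show b0: "0 \<le> ?b" using n pos by simp
  show "?E \<in> sets Om" by measurable
  fix a d assume ad: "a \<in> space MA" "d \<in> space MD"
  show "measure S {w \<in> space S. (w, a, d) \<in> ?E} \<le> ?b"
  proof (cases "c \<le> sig2 n a")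
    case False
    then have e: "{w \<in> space S. (w, a, d) \<in> ?E} = {}" by (auto simp: Adata_def)
    show ?thesis unfolding e using b0 by simp
  next
    case True
    have "measure S {w \<in> space S. \<delta> \<le> \<bar>(1 / n) * (\<Sum>i<n. stdres n a (w i))\<bar>} \<le> ?b"
      by (rule iid_chebyshev[OF prob_P stdres_a_meas[OF ad(1)]])
         (use stdres_mean[OF ad(1)] stdres_var[OF ad(1) pos(1) True] n pos in auto)
    moreover have "{w \<in> space S. (w, a, d) \<in> ?E} = {w \<in> space S. \<delta> \<le> \<bar>(1 / n) * (\<Sum>i<n. stdres n a (w i))\<bar>}"
      using True ad by (auto simp: Adata_def space_Om)
    ultimately show ?thesis by simp
  qed
qed

definition Ustat :: "nat \<Rightarrow> ((nat \<Rightarrow> 'z obs) \<times> 'a \<times> 'b) \<Rightarrow> real" where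
  "Ustat n om = (1 / sqrt n) * (\<Sum>i<n. stdres n (Adata om) (fst om i))"

lemma Ustat_meas[measurable]: "Ustat n \<in> borel_measurable Om"
  unfolding Ustat_def[abs_def] by measurable

text \<open>Fubini writes the characteristic function as the mean of its conditional versions given
  (a, d). Where the variance is at least c, \<open>char_iid_approx\<close> applies with
  \<open>Kstd c\<close>; elsewhere both numbers lie in the unit disc, which costs 2.\<close>

lemma Ustat_char:
  assumes n: "0 < n" "t\<^sup>2 / 4 \<le> real n" and c: "0 < c"
  shows "cmod (char (distr Om borel (Ustat n)) t - complex_of_real ((1 + (- t\<^sup>2 / 2) / n) ^ n))
     \<le> t\<^sup>2 * (\<bar>t\<bar> / sqrt n) powr \<theta> * Kstd c + 2 * measure Om {om \<in> space Om. sig2 n (Adata om) < c}"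
proof -
  let ?z = "complex_of_real ((1 + (- t\<^sup>2 / 2) / n) ^ n)"
  let ?Y = "QA \<Otimes>\<^sub>M QD"
  let ?b = "t\<^sup>2 * (\<bar>t\<bar> / sqrt n) powr \<theta> * Kstd c"
  have Kc: "0 \<le> Kstd c" unfolding Kstd_def using K C_pos by simp
  have b0: "0 \<le> ?b" using Kc by simp
  define G where "G y = (\<integral>w. iexp (t * Ustat n (w, y)) \<partial>S)" for y
  have Um: "Ustat n \<in> borel_measurable (S \<Otimes>\<^sub>M ?Y)" using Ustat_meas unfolding Om_eq .
  have int: "integrable (S \<Otimes>\<^sub>M ?Y) (case_prod (\<lambda>w y. iexp (t * Ustat n (w, y))))"
    using Um by (intro OmP.P.integrable_const_bound[where B=1]) auto
  have Gi: "integrable ?Y G" unfolding G_def by (rule OmP.integrable_snd[OF int])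
  have "char (distr Om borel (Ustat n)) t = (\<integral>om. iexp (t * Ustat n om) \<partial>(S \<Otimes>\<^sub>M ?Y))"
    unfolding char_def using Um by (subst integral_distr) (auto simp: Om_eq)
  also have "\<dots> = (\<integral>y. G y \<partial>?Y)"
    unfolding G_def OmP.integral_snd[OF int] by (simp add: split_beta')
  finally have ch: "char (distr Om borel (Ustat n)) t = (\<integral>y. G y \<partial>?Y)" .
  have z1: "cmod ?z \<le> 1"
  proof -
    have "\<bar>1 + (- t\<^sup>2 / 2) / n\<bar> \<le> 1" using n by (auto simp: abs_le_iff field_simps)
    then show ?thesis unfolding norm_of_real power_abs by (intro power_le_one) auto
  qed
  have G1: "cmod (G y) \<le> 1" for y
  proof -
    have "cmod (G y) \<le> (\<integral>w. cmod (iexp (t * Ustat n (w, y))) \<partial>S)" unfolding G_def by (rule integral_norm_bound)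
    then show ?thesis by (simp add: S.prob_space)
  qed
  define Q where "Q = {y \<in> space ?Y. sig2 n (fst y) < c}"
  have [measurable]: "Q \<in> sets ?Y" unfolding Q_def by measurable
  have le: "cmod (G y - ?z) \<le> ?b + 2 * indicator Q y" if y: "y \<in> space ?Y" for y
  proof (cases "y \<in> Q")
    case True
    have "cmod (G y - ?z) \<le> cmod (G y) + cmod ?z" by (rule norm_triangle_ineq4)
    also have "\<dots> \<le> 2" using G1[of y] z1 by linarith
    finally show ?thesis using True b0 by simp
  next
    case False
    then have s: "c \<le> sig2 n (fst y)" using y by (auto simp: Q_def)
    have a: "fst y \<in> space MA" using y by (auto simp: space_pair_measure space_QA)
    have "cmod (G y - ?z) \<le> ?b"
      using char_iid_approx[OF prob_P stdres_a_meas[OF a] stdres_mean[OF a] stdres_var[OF a c s] \<theta> stdres_moment[OF a c s] n]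
      by (simp add: G_def Ustat_def Adata_def)
    then show ?thesis using False by simp
  qed
  have "cmod ((\<integral>y. G y \<partial>?Y) - ?z) = cmod (\<integral>y. G y - ?z \<partial>?Y)"
    using Gi by (simp add: QAD.prob_space)
  also have "\<dots> \<le> (\<integral>y. cmod (G y - ?z) \<partial>?Y)" by (rule integral_norm_bound)
  also have "\<dots> \<le> (\<integral>y. ?b + 2 * indicator Q y \<partial>?Y)"
    by (rule integral_mono[OF _ _ le]) (use Gi in \<open>auto simp: QAD.emeasure_eq_measure\<close>)
  also have "\<dots> = ?b + 2 * measure ?Y Q"
    by (simp add: QAD.prob_space QAD.emeasure_eq_measure)
  also have "measure ?Y Q = measure Om {om \<in> space Om. sig2 n (Adata om) < c}"
  proof -
    have eq: "{om \<in> space Om. sig2 n (Adata om) < c} = space S \<times> Q"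
      unfolding Q_def space_Om by (auto simp: Adata_def space_pair_measure space_QA space_QD)
    have "emeasure Om (space S \<times> Q) = emeasure S (space S) * emeasure ?Y Q"
      unfolding Om_eq by (rule QAD.emeasure_pair_measure_Times) auto
    then show ?thesis unfolding eq by (simp add: S.emeasure_space_1 measure_def)
  qed
  finally show ?thesis unfolding ch .
qed

end

section \<open>Decomposition of the statistic\<close>

definition sdev :: "nat \<Rightarrow> (nat \<Rightarrow> real) \<Rightarrow> real" where
  "sdev n x = sqrt ((1 / real n) * (\<Sum>i<n. (x i)\<^sup>2) - ((1 / real n) * (\<Sum>i<n. x i))\<^sup>2)"

lemma sdev_arg_eq:
  "(1 / real n) * (\<Sum>i<n. (x i)\<^sup>2) - ((1 / real n) * (\<Sum>i<n. x i))\<^sup>2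
     = (\<Sum>i<n. (x i - (1 / real n) * (\<Sum>i<n. x i))\<^sup>2) / real n"
proof (cases "n = 0")
  case False
  define m where "m = (1 / real n) * (\<Sum>i<n. x i)"
  have s: "(\<Sum>i<n. x i) = real n * m" using False by (simp add: m_def)
  have "(\<Sum>i<n. (x i - m)\<^sup>2) = (\<Sum>i<n. (x i)\<^sup>2) - 2 * m * (\<Sum>i<n. x i) + real n * m\<^sup>2"
    by (simp add: power2_diff sum.distrib sum_subtractf sum_distrib_left mult.commute mult.left_commute)
  also have "\<dots> = (\<Sum>i<n. (x i)\<^sup>2) - real n * m\<^sup>2" unfolding s by (simp add: power2_eq_square)
  finally show ?thesis using False unfolding m_def[symmetric] by (simp add: field_simps)
qed simp

text \<open>A Euclidean norm of a linearly centred vector is a seminorm. Hence perturbing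
  \<open>sdev\<close> never requires estimates of cross terms between the noise products and the
  errors.\<close>

lemma sdev_L2_set:
  "sdev n x = L2_set (\<lambda>i. x i - (1 / real n) * (\<Sum>i<n. x i)) {..<n} / sqrt n"
  unfolding sdev_def sdev_arg_eq by (simp add: L2_set_def real_sqrt_divide)

lemma sdev_le: "sdev n x \<le> sqrt ((1 / real n) * (\<Sum>i<n. (x i)\<^sup>2))"
  unfolding sdev_def by simp

lemma sdev_triangle: "sdev n (\<lambda>i. x i + y i) \<le> sdev n x + sdev n y"
proof -
  let ?m = "\<lambda>x. (1 / real n) * (\<Sum>i<n. x i)"
  have "L2_set (\<lambda>i. x i + y i - ?m (\<lambda>i. x i + y i)) {..<n} = L2_set (\<lambda>i. (x i - ?m x) + (y i - ?m y)) {..<n}"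
    by (intro L2_set_cong refl) (simp add: sum.distrib add_divide_distrib)
  also have "\<dots> \<le> L2_set (\<lambda>i. x i - ?m x) {..<n} + L2_set (\<lambda>i. y i - ?m y) {..<n}"
    by (rule L2_set_triangle_ineq)
  finally show ?thesis unfolding sdev_L2_set by (simp add: add_divide_distrib[symmetric] divide_right_mono)
qed

text \<open>Invariance under the shift b is what removes the unknown conditional mean from the
  denominator.\<close>

lemma sdev_affine: "sdev n (\<lambda>i. a * x i + b) = \<bar>a\<bar> * sdev n x" if "0 < n"
proof -
  have "(a * x i + b - (1 / real n) * (\<Sum>i<n. a * x i + b))\<^sup>2 = a\<^sup>2 * (x i - (1 / real n) * (\<Sum>i<n. x i))\<^sup>2" for i
  proof -
    have "(1 / real n) * (\<Sum>i<n. a * x i + b) = a * ((1 / real n) * (\<Sum>i<n. x i)) + b"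
      using that by (simp add: sum.distrib sum_distrib_left[symmetric] add_divide_distrib)
    then have "a * x i + b - (1 / real n) * (\<Sum>i<n. a * x i + b) = a * (x i - (1 / real n) * (\<Sum>i<n. x i))"
      by (simp add: algebra_simps)
    then show ?thesis by (simp add: power_mult_distrib)
  qed
  then show ?thesis
    unfolding sdev_def sdev_arg_eq by (simp add: sum_distrib_left[symmetric] real_sqrt_mult real_sqrt_divide)
qed

lemma sdev_perturb: "\<bar>sdev n (\<lambda>i. x i + y i) - sdev n x\<bar> \<le> sqrt ((1 / real n) * (\<Sum>i<n. (y i)\<^sup>2))"
proof -
  have "sdev n (\<lambda>i. x i + y i) \<le> sdev n x + sdev n y" by (rule sdev_triangle)
  moreover have "sdev n x \<le> sdev n (\<lambda>i. x i + y i) + sdev n (\<lambda>i. - y i)"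
    using sdev_triangle[of n "\<lambda>i. x i + y i" "\<lambda>i. - y i"] by simp
  moreover have "sdev n (\<lambda>i. - y i) = sdev n y" by (simp add: sdev_def sum_negf)
  ultimately show ?thesis using sdev_le[of n y] by linarith
qed

text \<open>With q the radicand, |sqrt q - 1| \<le> |q - 1| because sqrt q + 1 \<ge> 1.\<close>

lemma sdev_minus_1:
  "\<bar>sdev n x - 1\<bar> \<le> \<bar>(1 / real n) * (\<Sum>i<n. (x i)\<^sup>2) - 1\<bar> + ((1 / real n) * (\<Sum>i<n. x i))\<^sup>2"
proof -
  let ?q = "(1 / real n) * (\<Sum>i<n. (x i)\<^sup>2) - ((1 / real n) * (\<Sum>i<n. x i))\<^sup>2"
  have q: "0 \<le> ?q" unfolding sdev_arg_eq by (simp add: sum_nonneg)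
  have "\<bar>sqrt ?q - 1\<bar> * 1 \<le> \<bar>sqrt ?q - 1\<bar> * (sqrt ?q + 1)" using q by (intro mult_left_mono) auto
  also have "\<dots> = \<bar>(sqrt ?q - 1) * (sqrt ?q + 1)\<bar>" using q by (simp add: abs_mult)
  also have "(sqrt ?q - 1) * (sqrt ?q + 1) = ?q - 1" using q by (simp add: algebra_simps)
  finally have "\<bar>sqrt ?q - 1\<bar> \<le> \<bar>?q - 1\<bar>" by simp
  moreover have "\<bar>?q - 1\<bar> \<le> \<bar>(1 / real n) * (\<Sum>i<n. (x i)\<^sup>2) - 1\<bar> + ((1 / real n) * (\<Sum>i<n. x i))\<^sup>2"
    using zero_le_power2[of "(1 / real n) * (\<Sum>i<n. x i)"] by linarith
  ultimately show ?thesis unfolding sdev_def by linarith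
qed

text \<open>Crude, but for squared errors the right side divided by n is exactly n A_f A_g, so the
  product errors in the denominator need no assumption beyond the one made for the
  numerator.\<close>

lemma sum_mult_le_mult_sum:
  fixes x y :: "'i \<Rightarrow> real"
  assumes "finite A" "\<And>i. i \<in> A \<Longrightarrow> 0 \<le> x i" "\<And>i. i \<in> A \<Longrightarrow> 0 \<le> y i"
  shows "(\<Sum>i\<in>A. x i * y i) \<le> sum x A * sum y A"
proof -
  have "(\<Sum>i\<in>A. x i * y i) \<le> (\<Sum>i\<in>A. x i * sum y A)"
    using assms by (intro sum_mono mult_left_mono member_le_sum) auto
  then show ?thesis by (simp add: sum_distrib_right)
qed

context wgcm
begin

section \<open>Error terms of the residual products\<close>

definition errf where "errf n om i = f (zs om i) - fh n (Ddata om) (zs om i)"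
definition errg where "errg n om i = g (zs om i) - gh n (Ddata om) (zs om i)"
definition wt where "wt n om i = W n (Adata om) (zs om i)"
definition nuf where "nuf n om = (1 / sqrt (real n)) * (\<Sum>i<n. errf n om i * wt n om i * xi g (fst om i))"
definition nug where "nug n om = (1 / sqrt (real n)) * (\<Sum>i<n. errg n om i * wt n om i * eps f (fst om i))"
definition bfg where "bfg n om = (1 / sqrt (real n)) * (\<Sum>i<n. errf n om i * errg n om i * wt n om i)"
definition Qf where "Qf n om = (1 / real n) * (\<Sum>i<n. (errf n om i * xi g (fst om i))\<^sup>2)"
definition Qg where "Qg n om = (1 / real n) * (\<Sum>i<n. (errg n om i * eps f (fst om i))\<^sup>2)"
definition nAA where "nAA n om = real n * Aerr f fh n om * Aerr g gh n om"
text \<open>What remains of the residual product after subtracting \<open>prodres\<close>, since x -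
  fh = \<epsilon> + \<open>errf\<close> and y - gh = \<xi> + \<open>errg\<close>. The error of f
  multiplies \<xi>, which is why B_f carries the weight v and B_g the weight u.\<close>

definition rerr where "rerr n om i = (errf n om i * xi g (fst om i) + errg n om i * eps f (fst om i) + errf n om i * errg n om i) * wt n om i"

lemma errf_meas[measurable]: "(\<lambda>om. errf n om i) \<in> borel_measurable Om"
  and errg_meas[measurable]: "(\<lambda>om. errg n om i) \<in> borel_measurable Om"
  and wt_meas[measurable]: "(\<lambda>om. wt n om i) \<in> borel_measurable Om"
  unfolding errf_def errg_def wt_def by measurable

lemma xi_om_meas[measurable]: "(\<lambda>om. xi g (fst om i)) \<in> borel_measurable Om"
  and eps_om_meas[measurable]: "(\<lambda>om. eps f (fst om i)) \<in> borel_measurable Om"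
  by (rule measurable_compose[OF Om_component xi_meas], rule measurable_compose[OF Om_component eps_meas])

lemma nuf_meas[measurable]: "nuf n \<in> borel_measurable Om"
  and nug_meas[measurable]: "nug n \<in> borel_measurable Om"
  and bfg_meas[measurable]: "bfg n \<in> borel_measurable Om"
  and Qf_meas[measurable]: "Qf n \<in> borel_measurable Om"
  and Qg_meas[measurable]: "Qg n \<in> borel_measurable Om"
  and rerr_meas[measurable]: "(\<lambda>om. rerr n om i) \<in> borel_measurable Om"
  unfolding nuf_def[abs_def] nug_def[abs_def] bfg_def[abs_def] Qf_def[abs_def] Qg_def[abs_def] rerr_def by measurable

lemma nAA_meas[measurable]: "nAA n \<in> borel_measurable Om"
  unfolding nAA_def[abs_def] Aerr_def by measurable

lemma Berr_f_meas[measurable]: "Berr f fh v n \<in> borel_measurable Om"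
  and Berr_g_meas[measurable]: "Berr g gh u n \<in> borel_measurable Om"
  unfolding Berr_def[abs_def] by measurable

lemma measure_split_le:
  assumes [measurable]: "Measurable.pred Om A" "Measurable.pred Om B"
    and "measure Om {om \<in> space Om. A om \<and> \<not> B om} \<le> b"
  shows "measure Om {om \<in> space Om. A om} \<le> measure Om {om \<in> space Om. B om} + b"
proof -
  have "measure Om {om \<in> space Om. A om} \<le> measure Om ({om \<in> space Om. B om} \<union> {om \<in> space Om. A om \<and> \<not> B om})"
    by (rule Om.finite_measure_mono) auto
  also have "\<dots> \<le> measure Om {om \<in> space Om. B om} + measure Om {om \<in> space Om. A om \<and> \<not> B om}"
    by (rule measure_Un_le) measurable
  finally show ?thesis using assms(3) by linarith
qed

lemma f_err_meas: "(\<lambda>(d, z). f z - fh n d z) \<in> borel_measurable (MD \<Otimes>\<^sub>M borel)"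
  and g_err_meas: "(\<lambda>(d, z). g z - gh n d z) \<in> borel_measurable (MD \<Otimes>\<^sub>M borel)"
  by measurable

lemma nuf_bound:
  assumes "0 < n" "0 < \<delta>" "0 \<le> \<kappa>"
  shows "measure Om {om \<in> space Om. \<delta> < \<bar>nuf n om\<bar>} \<le> measure Om {om \<in> space Om. Berr f fh v n om > ennreal \<kappa>} + C\<^sup>2 * \<kappa> / \<delta>\<^sup>2"
  by (rule measure_split_le, measurable, unfold not_less)
     (use noise_sum_bounds(1)[OF noise_xi f_err_meas assms] in \<open>simp only: nuf_def Berr_def errf_def wt_def\<close>)

lemma nug_bound:
  assumes "0 < n" "0 < \<delta>" "0 \<le> \<kappa>"
  shows "measure Om {om \<in> space Om. \<delta> < \<bar>nug n om\<bar>} \<le> measure Om {om \<in> space Om. Berr g gh u n om > ennreal \<kappa>} + C\<^sup>2 * \<kappa> / \<delta>\<^sup>2"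
  by (rule measure_split_le, measurable, unfold not_less)
     (use noise_sum_bounds(1)[OF noise_eps g_err_meas assms] in \<open>simp only: nug_def Berr_def errg_def wt_def\<close>)

lemma Qf_nonneg: "0 \<le> Qf n om" and Qg_nonneg: "0 \<le> Qg n om" and nAA_nonneg: "0 \<le> nAA n om"
  unfolding Qf_def Qg_def nAA_def Aerr_def by (auto intro!: sum_nonneg mult_nonneg_nonneg divide_nonneg_nonneg)

lemma Qf_bound:
  assumes "0 < n" "0 < \<delta>" "0 \<le> \<kappa>"
  shows "measure Om {om \<in> space Om. \<delta> < \<bar>Qf n om\<bar>} \<le> measure Om {om \<in> space Om. Berr f fh v n om > ennreal \<kappa>} + \<kappa> / \<delta>"
  unfolding abs_of_nonneg[OF Qf_nonneg]
  by (rule measure_split_le, measurable, unfold not_less)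
     (use noise_sum_bounds(2)[OF noise_xi f_err_meas assms] in \<open>simp only: Qf_def Berr_def errf_def wt_def\<close>)

lemma Qg_bound:
  assumes "0 < n" "0 < \<delta>" "0 \<le> \<kappa>"
  shows "measure Om {om \<in> space Om. \<delta> < \<bar>Qg n om\<bar>} \<le> measure Om {om \<in> space Om. Berr g gh u n om > ennreal \<kappa>} + \<kappa> / \<delta>"
  unfolding abs_of_nonneg[OF Qg_nonneg]
  by (rule measure_split_le, measurable, unfold not_less)
     (use noise_sum_bounds(2)[OF noise_eps g_err_meas assms] in \<open>simp only: Qg_def Berr_def errg_def wt_def\<close>)

lemma nAA_eq: "nAA n om = (\<Sum>i<n. (errf n om i)\<^sup>2) * (\<Sum>i<n. (errg n om i)\<^sup>2) / real n"
  unfolding nAA_def Aerr_def errf_def errg_def by (cases "n = 0") (simp_all add: field_simps)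

lemma wt_le: "\<bar>wt n om i\<bar> \<le> C" unfolding wt_def by (rule W_le)

lemma bfg_le: "\<bar>bfg n om\<bar> \<le> C * \<bar>sqrt (nAA n om)\<bar>"
proof -
  let ?F = "\<Sum>i<n. (errf n om i)\<^sup>2" and ?G = "\<Sum>i<n. (errg n om i)\<^sup>2"
  have "(\<Sum>i<n. \<bar>errf n om i\<bar> * \<bar>errg n om i\<bar>)\<^sup>2 \<le> ?F * ?G"
    using Cauchy_Schwarz_ineq_sum[of "\<lambda>i. \<bar>errf n om i\<bar>" "\<lambda>i. \<bar>errg n om i\<bar>" "{..<n}"] by simp
  then have cs: "(\<Sum>i<n. \<bar>errf n om i\<bar> * \<bar>errg n om i\<bar>) \<le> sqrt (?F * ?G)" by (rule real_le_rsqrt)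
  have "\<bar>\<Sum>i<n. errf n om i * errg n om i * wt n om i\<bar> \<le> (\<Sum>i<n. \<bar>errf n om i * errg n om i * wt n om i\<bar>)"
    by (rule sum_abs)
  also have "\<dots> \<le> (\<Sum>i<n. \<bar>errf n om i\<bar> * \<bar>errg n om i\<bar> * C)"
    unfolding abs_mult by (intro sum_mono mult_left_mono wt_le) simp
  also have "\<dots> = C * (\<Sum>i<n. \<bar>errf n om i\<bar> * \<bar>errg n om i\<bar>)" by (simp add: sum_distrib_left mult.commute)
  also have "\<dots> \<le> C * sqrt (?F * ?G)" using cs C_pos by simp
  finally have "\<bar>bfg n om\<bar> \<le> (1 / sqrt n) * (C * sqrt (?F * ?G))"
    unfolding bfg_def abs_mult by (simp add: divide_right_mono)
  also have "\<dots> = C * sqrt (nAA n om)" unfolding nAA_eq by (simp add: real_sqrt_divide)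
  finally show ?thesis using C_pos by (smt (verit) mult_left_mono)
qed

lemma rerr_sum: "(1 / sqrt (real n)) * (\<Sum>i<n. rerr n om i) = nuf n om + nug n om + bfg n om"
  unfolding rerr_def nuf_def nug_def bfg_def
  by (simp add: distrib_left distrib_right sum.distrib add_divide_distrib mult.commute mult.left_commute)

lemma rerr_sq: "(1 / real n) * (\<Sum>i<n. (rerr n om i)\<^sup>2) \<le> 3 * C\<^sup>2 * (Qf n om + Qg n om + nAA n om)"
proof -
  have "(rerr n om i)\<^sup>2 \<le> 3 * C\<^sup>2 * ((errf n om i * xi g (fst om i))\<^sup>2 + (errg n om i * eps f (fst om i))\<^sup>2 + (errf n om i)\<^sup>2 * (errg n om i)\<^sup>2)" for i
  proof -
    have sq3: "(x + y + z)\<^sup>2 \<le> 3 * (x\<^sup>2 + y\<^sup>2 + z\<^sup>2)" for x y z :: real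
      using zero_le_power2[of "x - y"] zero_le_power2[of "x - z"] zero_le_power2[of "y - z"]
      by (simp add: power2_eq_square algebra_simps)
    have w: "(wt n om i)\<^sup>2 \<le> C\<^sup>2" using wt_le[of n om i] C_pos by (simp add: abs_le_square_iff[symmetric])
    have "(rerr n om i)\<^sup>2 = (errf n om i * xi g (fst om i) + errg n om i * eps f (fst om i) + errf n om i * errg n om i)\<^sup>2 * (wt n om i)\<^sup>2"
      by (simp add: rerr_def power_mult_distrib)
    also have "\<dots> \<le> (3 * ((errf n om i * xi g (fst om i))\<^sup>2 + (errg n om i * eps f (fst om i))\<^sup>2 + (errf n om i * errg n om i)\<^sup>2)) * C\<^sup>2"
      by (intro mult_mono sq3 w) auto
    finally show ?thesis by (simp add: power_mult_distrib algebra_simps)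
  qed
  then have "(\<Sum>i<n. (rerr n om i)\<^sup>2) \<le> (\<Sum>i<n. 3 * C\<^sup>2 * ((errf n om i * xi g (fst om i))\<^sup>2 + (errg n om i * eps f (fst om i))\<^sup>2 + (errf n om i)\<^sup>2 * (errg n om i)\<^sup>2))"
    by (intro sum_mono)
  also have "\<dots> = 3 * C\<^sup>2 * ((\<Sum>i<n. (errf n om i * xi g (fst om i))\<^sup>2) + (\<Sum>i<n. (errg n om i * eps f (fst om i))\<^sup>2) + (\<Sum>i<n. (errf n om i)\<^sup>2 * (errg n om i)\<^sup>2))"
    by (simp only: sum_distrib_left[symmetric] sum.distrib)
  also have "\<dots> \<le> 3 * C\<^sup>2 * ((\<Sum>i<n. (errf n om i * xi g (fst om i))\<^sup>2) + (\<Sum>i<n. (errg n om i * eps f (fst om i))\<^sup>2) + (\<Sum>i<n. (errf n om i)\<^sup>2) * (\<Sum>i<n. (errg n om i)\<^sup>2))"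
    by (intro mult_left_mono add_left_mono sum_mult_le_mult_sum) auto
  finally have "(1 / real n) * (\<Sum>i<n. (rerr n om i)\<^sup>2) \<le> (1 / real n) * \<dots>"
    by (intro mult_left_mono) auto
  also have "\<dots> = 3 * C\<^sup>2 * (Qf n om + Qg n om + nAA n om)"
    unfolding Qf_def Qg_def nAA_eq by (simp add: distrib_left add_divide_distrib)
  finally show ?thesis .
qed

abbreviation sgm where "sgm n om \<equiv> sqrt (sig2 n (Adata om))"
text \<open>The estimated standard deviation relative to the conditional one: the factor that must
  tend to 1 in \<open>slutsky_Phi\<close>.\<close>

definition Srat where "Srat n om = tauD fh gh W n om / sgm n om"
definition Rem where "Rem n om = (nuf n om + nug n om + bfg n om) / sgm n om"
definition merr where "merr n om = sqrt ((1 / real n) * (\<Sum>i<n. (rerr n om i)\<^sup>2)) / sgm n om"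
definition avsq where "avsq n om = (1 / real n) * (\<Sum>i<n. (stdres n (Adata om) (fst om i))\<^sup>2) - 1"
definition avm where "avm n om = (1 / real n) * (\<Sum>i<n. stdres n (Adata om) (fst om i))"

lemma sig2_nonneg: "0 \<le> sig2 n a" unfolding sigma2_bar_def by simp

lemma Rres_eq:
  assumes "0 < sig2 n (Adata om)"
  shows "Rres fh gh W n om i = sgm n om * (stdres n (Adata om) (fst om i) + rerr n om i / sgm n om) + rho n (Adata om)"
proof -
  have "Rres fh gh W n om i = prodres n (Adata om) (fst om i) + rerr n om i"
    by (simp add: Rres_def prodres_def rerr_def errf_def errg_def wt_def eps_def xi_def xs_def ys_def zs_def algebra_simps)
  also have "\<dots> = sgm n om * (stdres n (Adata om) (fst om i) + rerr n om i / sgm n om) + rho n (Adata om)"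
    using assms by (simp add: stdres_def distrib_left)
  finally show ?thesis .
qed

lemma Srat_eq:
  assumes "0 < sig2 n (Adata om)" "0 < n"
  shows "Srat n om = sdev n (\<lambda>i. stdres n (Adata om) (fst om i) + rerr n om i / sgm n om)"
proof -
  have "tauD fh gh W n om = sdev n (Rres fh gh W n om)" by (simp add: tauD_def sdev_def)
  also have "Rres fh gh W n om = (\<lambda>i. sgm n om * (stdres n (Adata om) (fst om i) + rerr n om i / sgm n om) + rho n (Adata om))"
    using Rres_eq[OF assms(1)] by (intro ext)
  also have "sdev n \<dots> = sgm n om * sdev n (\<lambda>i. stdres n (Adata om) (fst om i) + rerr n om i / sgm n om)"
    using assms by (subst sdev_affine) auto
  finally show ?thesis using assms by (simp add: Srat_def)
qed

text \<open>The seminorm property separates the errors, collected in \<open>merr\<close>, from the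
  standardised products, for which \<open>sdev_minus_1\<close> leaves two laws of large
  numbers.\<close>

lemma Srat_bound: "\<bar>Srat n om - 1\<bar> \<le> \<bar>merr n om + \<bar>avsq n om\<bar> + (avm n om)\<^sup>2\<bar>"
proof (cases "0 < sig2 n (Adata om) \<and> 0 < n")
  case True
  then have s: "0 < sgm n om" by simp
  have "\<bar>Srat n om - sdev n (\<lambda>i. stdres n (Adata om) (fst om i))\<bar> \<le> sqrt ((1 / real n) * (\<Sum>i<n. (rerr n om i / sgm n om)\<^sup>2))"
    unfolding Srat_eq[OF conjunct1[OF True] conjunct2[OF True]] by (rule sdev_perturb)
  also have "\<dots> = merr n om"
    using s True by (simp add: merr_def power_divide sum_divide_distrib[symmetric] real_sqrt_divide real_sqrt_mult)
  finally have "\<bar>Srat n om - sdev n (\<lambda>i. stdres n (Adata om) (fst om i))\<bar> \<le> merr n om" .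
  moreover have "\<bar>sdev n (\<lambda>i. stdres n (Adata om) (fst om i)) - 1\<bar> \<le> \<bar>avsq n om\<bar> + (avm n om)\<^sup>2"
    unfolding avsq_def avm_def by (rule sdev_minus_1)
  ultimately show ?thesis by linarith
next
  \<comment> \<open>Default values keep the bound true here: \<open>Srat\<close> is 0 and
    \<open>avsq\<close> is -1, while \<open>merr\<close> and \<open>avm\<close> are 0. So the bound
    holds at every point without side conditions.\<close>
  case False
  then consider "sig2 n (Adata om) = 0" | "n = 0" using sig2_nonneg[of n "Adata om"] by force
  then show ?thesis
    by cases (simp_all add: Srat_def merr_def avsq_def avm_def stdres_def tauD_def)
qed

text \<open>The decomposition can fail only where a division by zero occurs, and then \<open>Srat = 0\<close>.\<close>

lemma Tcent_Srat: "1 / 2 < \<bar>Srat n om - 1\<bar>" if "Tcent P f g fh gh W n om * Srat n om - (Ustat n om + Rem n om) \<noteq> 0"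
proof (rule ccontr)
  assume "\<not> 1 / 2 < \<bar>Srat n om - 1\<bar>"
  then have "Srat n om \<noteq> 0" by auto
  then have t: "tauD fh gh W n om \<noteq> 0" and s: "sgm n om \<noteq> 0" by (auto simp: Srat_def)
  from t have n: "0 < n" by (cases "n = 0") (auto simp: tauD_def)
  from s have s': "0 < sig2 n (Adata om)" using sig2_nonneg[of n "Adata om"] by (auto simp: less_le)
  have "Tcent P f g fh gh W n om * Srat n om = (tauN fh gh W n om - sqrt n * rho n (Adata om)) / sgm n om"
    using t by (simp add: Tcent_def Tstat_def Srat_def diff_divide_distrib[symmetric])
  also have "tauN fh gh W n om = (1 / sqrt n) * (\<Sum>i<n. sgm n om * stdres n (Adata om) (fst om i) + rerr n om i + rho n (Adata om))"
    unfolding tauN_def Rres_eq[OF s'] using s by (simp add: distrib_left)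
  also have "\<dots> = sgm n om * Ustat n om + (1 / sqrt n) * (\<Sum>i<n. rerr n om i) + (real n / sqrt n) * rho n (Adata om)"
    unfolding Ustat_def sum.distrib sum_distrib_left[symmetric] by (simp add: add_divide_distrib)
  also have "real n / sqrt n = sqrt n" by (simp add: real_div_sqrt)
  also have "(sgm n om * Ustat n om + (1 / sqrt n) * (\<Sum>i<n. rerr n om i) + sqrt n * rho n (Adata om) - sqrt n * rho n (Adata om)) / sgm n om
     = Ustat n om + Rem n om"
    unfolding rerr_sum Rem_def using s by (simp add: add_divide_distrib)
  finally show False using that by simp
qed

lemma Rres_meas[measurable]: "(\<lambda>om. Rres fh gh W n om i) \<in> borel_measurable Om"
  unfolding Rres_def by measurable

lemma tauD_meas[measurable]: "tauD fh gh W n \<in> borel_measurable Om"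
  unfolding tauD_def[abs_def] by measurable

lemma Tcent_meas[measurable]: "Tcent P f g fh gh W n \<in> borel_measurable Om"
  unfolding Tcent_def[abs_def] Tstat_def tauN_def by measurable

lemma Srat_meas[measurable]: "Srat n \<in> borel_measurable Om"
  and Rem_meas[measurable]: "Rem n \<in> borel_measurable Om"
  and merr_meas[measurable]: "merr n \<in> borel_measurable Om"
  and avsq_meas[measurable]: "avsq n \<in> borel_measurable Om"
  and avm_meas[measurable]: "avm n \<in> borel_measurable Om"
  unfolding Srat_def[abs_def] Rem_def[abs_def] merr_def[abs_def] avsq_def[abs_def] avm_def[abs_def] by measurable

end

section \<open>Sequences of distributions\<close>

text \<open>Let n grow for fixed \<kappa>, then let \<kappa> shrink: the limit superior of p is at
  most B * \<kappa> for every \<kappa>.\<close>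

lemma small_bound_tendsto_0:
  fixes p :: "nat \<Rightarrow> real" and q :: "real \<Rightarrow> nat \<Rightarrow> real"
  assumes p0: "\<And>n. 0 \<le> p n" and q: "\<And>\<kappa>. 0 < \<kappa> \<Longrightarrow> q \<kappa> \<longlonglongrightarrow> 0"
    and "0 \<le> B" and le: "\<And>\<kappa>. 0 < \<kappa> \<Longrightarrow> \<forall>\<^sub>F n in sequentially. p n \<le> q \<kappa> n + B * \<kappa>"
  shows "p \<longlonglongrightarrow> 0"
proof (rule tendstoI)
  fix e :: real assume "0 < e"
  \<comment> \<open>Adding 1 to B avoids division by zero when B = 0, a case that does
    occur.\<close>
  define \<kappa> where "\<kappa> = e / (2 * (B + 1))"
  have \<kappa>: "0 < \<kappa>" using \<open>0 < e\<close> \<open>0 \<le> B\<close> by (simp add: \<kappa>_def)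
  have "B * \<kappa> \<le> (B + 1) * \<kappa>" using \<kappa> by (intro mult_right_mono) auto
  also have "\<dots> = e / 2" using \<open>0 \<le> B\<close> by (simp add: \<kappa>_def field_simps)
  finally have B: "B * \<kappa> \<le> e / 2" .
  have "\<forall>\<^sub>F n in sequentially. q \<kappa> n < e / 2"
    using order_tendstoD(2)[OF q[OF \<kappa>], of "e / 2"] \<open>0 < e\<close> by simp
  with le[OF \<kappa>] show "\<forall>\<^sub>F n in sequentially. dist (p n) 0 < e"
  proof eventually_elim
    case (elim n)
    then show ?case using B p0[of n] by (simp add: dist_real_def)
  qed
qed

text \<open>Each index carries its own law, and the hypotheses concern only sample size n under
  \<open>P n\<close>. In \<open>tight\<close> the constant c is chosen before n; the lower bound on
  the variance is used in no other form.\<close>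

locale wgcm_seq =
  fixes MA :: "'a measure" and MD :: "'b measure"
    and W :: "nat \<Rightarrow> 'a \<Rightarrow> 'z::euclidean_space \<Rightarrow> real"
    and fh gh :: "nat \<Rightarrow> 'b \<Rightarrow> 'z \<Rightarrow> real"
    and P :: "nat \<Rightarrow> 'z obs measure" and QA :: "nat \<Rightarrow> 'a measure" and QD :: "nat \<Rightarrow> 'b measure"
    and f g :: "nat \<Rightarrow> 'z \<Rightarrow> real" and u v :: "nat \<Rightarrow> 'z \<Rightarrow> ennreal" and C \<theta> K :: real
  assumes wgcm: "\<And>n. wgcm MA MD W fh gh (P n) (QA n) (QD n) (f n) (g n) (u n) (v n) C \<theta> K"
    and A_lim: "\<And>\<delta>. 0 < \<delta> \<Longrightarrow> (\<lambda>n. measure (sample_space (P n) (QA n) (QD n))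
              {om \<in> space (sample_space (P n) (QA n) (QD n)).
                 \<bar>real n * Aerr (f n) fh n om * Aerr (g n) gh n om\<bar> > \<delta>}) \<longlonglongrightarrow> 0"
    and Bf_lim: "\<And>\<delta>. 0 < \<delta> \<Longrightarrow> (\<lambda>n. measure (sample_space (P n) (QA n) (QD n))
              {om \<in> space (sample_space (P n) (QA n) (QD n)). Berr (f n) fh (v n) n om > ennreal \<delta>}) \<longlonglongrightarrow> 0"
    and Bg_lim: "\<And>\<delta>. 0 < \<delta> \<Longrightarrow> (\<lambda>n. measure (sample_space (P n) (QA n) (QD n))
              {om \<in> space (sample_space (P n) (QA n) (QD n)). Berr (g n) gh (u n) n om > ennreal \<delta>}) \<longlonglongrightarrow> 0"
    and tight: "\<And>e. 0 < e \<Longrightarrow> \<exists>c>0. \<forall>n\<ge>1. measure (sample_space (P n) (QA n) (QD n))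
              {om \<in> space (sample_space (P n) (QA n) (QD n)). sigma2_bar (P n) (f n) (g n) W n (Adata om) < c} \<le> e"
begin

sublocale I: wgcm MA MD W fh gh "P n" "QA n" "QD n" "f n" "g n" "u n" "v n" C \<theta> K for n
  by (rule wgcm)

abbreviation Om where "Om n \<equiv> sample_space (P n) (QA n) (QD n)"

lemma probOm: "prob_space (Om n)" by (rule I.Om.prob_space_axioms)

lemma vanishes_by_Berr:
  fixes X :: "nat \<Rightarrow> (nat \<Rightarrow> 'z obs) \<times> 'a \<times> 'b \<Rightarrow> real" and H :: "nat \<Rightarrow> (nat \<Rightarrow> 'z obs) \<times> 'a \<times> 'b \<Rightarrow> ennreal"
  assumes X: "\<And>n. X n \<in> borel_measurable (Om n)"
    and H: "\<And>\<kappa>. 0 < \<kappa> \<Longrightarrow> (\<lambda>n. measure (Om n) {om \<in> space (Om n). H n om > ennreal \<kappa>}) \<longlonglongrightarrow> 0"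
    and B: "\<And>\<delta>. 0 < \<delta> \<Longrightarrow> 0 \<le> B \<delta>"
    and le: "\<And>n \<delta> \<kappa>. 0 < n \<Longrightarrow> 0 < \<delta> \<Longrightarrow> 0 \<le> \<kappa> \<Longrightarrow> measure (Om n) {om \<in> space (Om n). \<delta> < \<bar>X n om\<bar>}
      \<le> measure (Om n) {om \<in> space (Om n). H n om > ennreal \<kappa>} + B \<delta> * \<kappa>"
  shows "vanishes_in_prob Om X"
  unfolding vanishes_in_prob_def
proof (intro conjI allI impI X)
  fix \<delta> :: real assume d: "0 < \<delta>"
  show "(\<lambda>n. measure (Om n) {om \<in> space (Om n). \<delta> < \<bar>X n om\<bar>}) \<longlonglongrightarrow> 0"
  proof (rule small_bound_tendsto_0[OF measure_nonneg H B[OF d]])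
    show "\<forall>\<^sub>F n in sequentially. measure (Om n) {om \<in> space (Om n). \<delta> < \<bar>X n om\<bar>}
      \<le> measure (Om n) {om \<in> space (Om n). H n om > ennreal \<kappa>} + B \<delta> * \<kappa>" if "0 < \<kappa>" for \<kappa>
      using eventually_gt_at_top[of "0 :: nat"] by eventually_elim (rule le[OF _ d less_imp_le[OF that]])
  qed
qed

section \<open>Remainder terms and the denominator along the sequence\<close>

lemma vanishes_nuf: "vanishes_in_prob Om (\<lambda>n. I.nuf n n)"
  by (rule vanishes_by_Berr[where B="\<lambda>\<delta>. C\<^sup>2 / \<delta>\<^sup>2", OF _ Bf_lim])
     (use I.nuf_bound in simp_all)

lemma vanishes_nug: "vanishes_in_prob Om (\<lambda>n. I.nug n n)"
  by (rule vanishes_by_Berr[where B="\<lambda>\<delta>. C\<^sup>2 / \<delta>\<^sup>2", OF _ Bg_lim])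
     (use I.nug_bound in simp_all)

lemma vanishes_Qf: "vanishes_in_prob Om (\<lambda>n. I.Qf n n)"
  by (rule vanishes_by_Berr[where B="\<lambda>\<delta>. 1 / \<delta>", OF _ Bf_lim])
     (use I.Qf_bound in simp_all)

lemma vanishes_Qg: "vanishes_in_prob Om (\<lambda>n. I.Qg n n)"
  by (rule vanishes_by_Berr[where B="\<lambda>\<delta>. 1 / \<delta>", OF _ Bg_lim])
     (use I.Qg_bound in simp_all)

lemma vanishes_nAA: "vanishes_in_prob Om (\<lambda>n. I.nAA n n)"
  unfolding vanishes_in_prob_def using A_lim by (simp add: I.nAA_def)

lemma vanishes_bfg: "vanishes_in_prob Om (\<lambda>n. I.bfg n n)"
  by (rule vanishes_in_prob_le_mult[OF probOm vanishes_in_prob_sqrt[OF probOm vanishes_nAA] _ I.C_pos I.bfg_le]) simp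

text \<open>Where the variance is at least c, division magnifies by at most the constant 1 / sqrt c;
  \<open>tight\<close> makes the other event negligible.\<close>

lemma vanishes_div_sgm:
  assumes X: "vanishes_in_prob Om X"
  shows "vanishes_in_prob Om (\<lambda>n om. X n om / I.sgm n n om)"
proof (rule vanishes_in_prob_tight[where s="\<lambda>n om. I.sig2 n n (Adata om)", OF probOm _ _ tight])
  note [measurable] = vanishes_in_prob_meas[OF X]
  show "(\<lambda>om. X n om / I.sgm n n om) \<in> borel_measurable (Om n)"
    "(\<lambda>om. I.sig2 n n (Adata om)) \<in> borel_measurable (Om n)" for n by measurable
  fix c \<delta> :: real assume c: "0 < c" "0 < \<delta>"
  have le: "measure (Om n) {om \<in> space (Om n). \<delta> < \<bar>X n om / I.sgm n n om\<bar> \<and> c \<le> I.sig2 n n (Adata om)}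
     \<le> measure (Om n) {om \<in> space (Om n). \<delta> * sqrt c < \<bar>X n om\<bar>}" for n
  proof (rule I.Om.finite_measure_mono)
    show "{om \<in> space (Om n). \<delta> < \<bar>X n om / I.sgm n n om\<bar> \<and> c \<le> I.sig2 n n (Adata om)}
       \<subseteq> {om \<in> space (Om n). \<delta> * sqrt c < \<bar>X n om\<bar>}"
    proof clarify
      fix om assume d: "\<delta> < \<bar>X n om / I.sgm n n om\<bar>" and s: "c \<le> I.sig2 n n (Adata om)"
      have s': "sqrt c \<le> I.sgm n n om" "0 < sqrt c" using s c by auto
      then have "\<delta> * I.sgm n n om < \<bar>X n om\<bar>" using d by (simp add: pos_less_divide_eq)
      moreover have "\<delta> * sqrt c \<le> \<delta> * I.sgm n n om" using s' c by (intro mult_left_mono) auto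
      ultimately show "\<delta> * sqrt c < \<bar>X n om\<bar>" by linarith
    qed
  qed measurable
  have lim: "(\<lambda>n. measure (Om n) {om \<in> space (Om n). \<delta> * sqrt c < \<bar>X n om\<bar>}) \<longlonglongrightarrow> 0"
    using X c unfolding vanishes_in_prob_def by simp
  show "(\<lambda>n. measure (Om n) {om \<in> space (Om n). \<delta> < \<bar>X n om / I.sgm n n om\<bar> \<and> c \<le> I.sig2 n n (Adata om)}) \<longlonglongrightarrow> 0"
    by (rule tendsto_sandwich[OF always_eventually always_eventually tendsto_const[of 0] lim]) (use le in simp_all)
qed

lemma vanishes_Rem: "vanishes_in_prob Om (\<lambda>n. I.Rem n n)"
  using vanishes_div_sgm[OF vanishes_in_prob_add[OF probOm vanishes_in_prob_add[OF probOm vanishes_nuf vanishes_nug] vanishes_bfg]]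
  unfolding I.Rem_def .

lemma vanishes_merr: "vanishes_in_prob Om (\<lambda>n. I.merr n n)"
proof -
  have "vanishes_in_prob Om (\<lambda>n om. I.Qf n n om + I.Qg n n om + I.nAA n n om)"
    by (intro vanishes_in_prob_add probOm vanishes_Qf vanishes_Qg vanishes_nAA)
  then have "vanishes_in_prob Om (\<lambda>n om. (1 / real n) * (\<Sum>i<n. (I.rerr n n om i)\<^sup>2))"
  proof (rule vanishes_in_prob_le_mult[OF probOm, where B="3 * C\<^sup>2"])
    show "\<bar>(1 / real n) * (\<Sum>i<n. (I.rerr n n om i)\<^sup>2)\<bar> \<le> 3 * C\<^sup>2 * \<bar>I.Qf n n om + I.Qg n n om + I.nAA n n om\<bar>" for n om
    proof -
      have "0 \<le> (1 / real n) * (\<Sum>i<n. (I.rerr n n om i)\<^sup>2)" by (simp add: sum_nonneg)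
      then show ?thesis
        using I.rerr_sq[of n n om] I.Qf_nonneg[of n n om] I.Qg_nonneg[of n n om] I.nAA_nonneg[of n n om]
        by (simp add: abs_of_nonneg)
    qed
  qed (use I.C_pos in simp_all)
  from vanishes_div_sgm[OF vanishes_in_prob_sqrt[OF probOm this]]
  show ?thesis unfolding I.merr_def .
qed

lemma vanishes_avsq: "vanishes_in_prob Om (\<lambda>n. I.avsq n n)"
proof (rule vanishes_in_prob_tight[where s="\<lambda>n om. I.sig2 n n (Adata om)", OF probOm _ _ tight])
  fix c \<delta> :: real assume c: "0 < c" "0 < \<delta>"
  have Kc: "0 \<le> I.Kstd c" unfolding I.Kstd_def using I.K I.C_pos by simp
  \<comment> \<open>Truncation level solving
    \<open>L \<kappa> powr - (\<theta> / 2) = \<kappa>\<close>: the tail term of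
    \<open>stdres_lln\<close> becomes linear in \<kappa>, while the other term is O(1 / n) for fixed
    \<kappa>.\<close>
  define L where "L \<kappa> = \<kappa> powr (- 2 / \<theta>)" for \<kappa> :: real
  show "(\<lambda>n. measure (Om n) {om \<in> space (Om n). \<delta> < \<bar>I.avsq n n om\<bar> \<and> c \<le> I.sig2 n n (Adata om)}) \<longlonglongrightarrow> 0"
  proof (rule small_bound_tendsto_0[OF measure_nonneg])
    show "(\<lambda>n. 4 * (L \<kappa>)\<^sup>2 / \<delta>\<^sup>2 * (1 / real n)) \<longlonglongrightarrow> 0" for \<kappa>
      by (rule tendsto_mult_right_zero) (rule lim_1_over_n)
    show "0 \<le> 4 * I.Kstd c / \<delta>" using Kc c by simp
    fix \<kappa> :: real assume \<kappa>: "0 < \<kappa>"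
    have L: "0 < L \<kappa>" "L \<kappa> powr - (\<theta> / 2) = \<kappa>" using \<kappa> I.\<theta> by (auto simp: L_def powr_powr)
    show "\<forall>\<^sub>F n in sequentially. measure (Om n) {om \<in> space (Om n). \<delta> < \<bar>I.avsq n n om\<bar> \<and> c \<le> I.sig2 n n (Adata om)}
       \<le> 4 * (L \<kappa>)\<^sup>2 / \<delta>\<^sup>2 * (1 / real n) + 4 * I.Kstd c / \<delta> * \<kappa>"
      using eventually_gt_at_top[of "0 :: nat"]
    proof eventually_elim
      case (elim n)
      have "measure (Om n) {om \<in> space (Om n). \<delta> < \<bar>I.avsq n n om\<bar> \<and> c \<le> I.sig2 n n (Adata om)}
        \<le> measure (Om n) {om \<in> space (Om n). \<delta> \<le> \<bar>I.avsq n n om\<bar> \<and> c \<le> I.sig2 n n (Adata om)}"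
        by (rule I.Om.finite_measure_mono) auto
      also have "\<dots> \<le> 4 * (L \<kappa>)\<^sup>2 / (n * \<delta>\<^sup>2) + 4 * I.Kstd c * L \<kappa> powr - (\<theta> / 2) / \<delta>"
        using I.stdres_lln[OF elim c L(1)] unfolding I.avsq_def .
      also have "\<dots> = 4 * (L \<kappa>)\<^sup>2 / \<delta>\<^sup>2 * (1 / real n) + 4 * I.Kstd c / \<delta> * \<kappa>"
        unfolding L(2) by (simp add: field_simps)
      finally show ?case .
    qed
  qed
qed simp_all

lemma vanishes_avm_sq: "vanishes_in_prob Om (\<lambda>n om. (I.avm n n om)\<^sup>2)"
proof (rule vanishes_in_prob_tight[where s="\<lambda>n om. I.sig2 n n (Adata om)", OF probOm _ _ tight])
  fix c \<delta> :: real assume c: "0 < c" "0 < \<delta>"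
  show "(\<lambda>n. measure (Om n) {om \<in> space (Om n). \<delta> < \<bar>(I.avm n n om)\<^sup>2\<bar> \<and> c \<le> I.sig2 n n (Adata om)}) \<longlonglongrightarrow> 0"
  proof (rule small_bound_tendsto_0[OF measure_nonneg])
    show "(\<lambda>n. 1 / \<delta> * (1 / real n)) \<longlonglongrightarrow> 0"
      by (rule tendsto_mult_right_zero) (rule lim_1_over_n)
    show "\<forall>\<^sub>F n in sequentially. measure (Om n) {om \<in> space (Om n). \<delta> < \<bar>(I.avm n n om)\<^sup>2\<bar> \<and> c \<le> I.sig2 n n (Adata om)}
       \<le> 1 / \<delta> * (1 / real n) + 0 * \<kappa>" for \<kappa> :: real
      using eventually_gt_at_top[of "0 :: nat"]
    proof eventually_elim
      case (elim n)
      have "measure (Om n) {om \<in> space (Om n). \<delta> < \<bar>(I.avm n n om)\<^sup>2\<bar> \<and> c \<le> I.sig2 n n (Adata om)}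
        \<le> measure (Om n) {om \<in> space (Om n). sqrt \<delta> \<le> \<bar>I.avm n n om\<bar> \<and> c \<le> I.sig2 n n (Adata om)}"
      proof (rule I.Om.finite_measure_mono)
        have "sqrt \<delta> \<le> \<bar>x\<bar>" if "\<delta> < \<bar>x\<^sup>2\<bar>" for x :: real
          using real_sqrt_le_mono[of \<delta> "x\<^sup>2"] that by simp
        then show "{om \<in> space (Om n). \<delta> < \<bar>(I.avm n n om)\<^sup>2\<bar> \<and> c \<le> I.sig2 n n (Adata om)}
          \<subseteq> {om \<in> space (Om n). sqrt \<delta> \<le> \<bar>I.avm n n om\<bar> \<and> c \<le> I.sig2 n n (Adata om)}" by blast
      qed measurable
      also have "\<dots> \<le> 1 / (n * (sqrt \<delta>)\<^sup>2)"
        using I.stdres_mean_bound[OF elim c(1), of "sqrt \<delta>"] c unfolding I.avm_def by simp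
      also have "\<dots> = 1 / \<delta> * (1 / real n) + 0 * \<kappa>" using c by simp
      finally show ?case .
    qed
  qed simp
qed simp_all

lemma vanishes_Srat: "vanishes_in_prob Om (\<lambda>n om. I.Srat n n om - 1)"
proof -
  have "vanishes_in_prob Om (\<lambda>n om. \<bar>I.avsq n n om\<bar>)"
    using vanishes_avsq unfolding vanishes_in_prob_def by simp
  then have "vanishes_in_prob Om (\<lambda>n om. I.merr n n om + \<bar>I.avsq n n om\<bar> + (I.avm n n om)\<^sup>2)"
    by (intro vanishes_in_prob_add probOm vanishes_merr vanishes_avm_sq)
  then show ?thesis
    by (rule vanishes_in_prob_le_mult[OF probOm, where B=1]) (use I.Srat_bound in simp_all)
qed

text \<open>A deviation of any size occurs only where \<open>Srat\<close> is further than 1 / 2 from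
  1, an event of vanishing probability; how large the deviation is does not matter.\<close>

lemma vanishes_Tcent:
  "vanishes_in_prob Om (\<lambda>n om. Tcent (P n) (f n) (g n) fh gh W n om * I.Srat n n om - (I.Ustat n n om + I.Rem n n om))"
proof (rule vanishes_in_prob_bound[OF probOm vanishes_Srat])
  fix \<delta> :: real assume "0 < \<delta>"
  then show "\<exists>\<delta>'>0. \<forall>n. \<forall>om\<in>space (Om n).
       \<delta> < \<bar>Tcent (P n) (f n) (g n) fh gh W n om * I.Srat n n om - (I.Ustat n n om + I.Rem n n om)\<bar> \<longrightarrow>
       \<delta>' < \<bar>I.Srat n n om - 1\<bar>"
    by (intro exI[of _ "1 / 2"] conjI allI ballI impI I.Tcent_Srat) auto
qed measurable

lemma char_Ustat_tendsto:
  "(\<lambda>n. char (distr (Om n) borel (I.Ustat n n)) t) \<longlonglongrightarrow> char std_normal_distribution t"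
proof -
  define z where "z n = complex_of_real ((1 + (- t\<^sup>2 / 2) / real n) ^ n)" for n :: nat
  \<comment> \<open>\<open>tight\<close> gives each tolerance \<kappa> its own threshold
    \<open>c \<kappa>\<close>; with it the bound of \<open>Ustat_char\<close> is a null sequence
    plus 2 * \<kappa>.\<close>
  have "\<exists>c. \<forall>\<kappa>>0. 0 < c \<kappa> \<and> (\<forall>n\<ge>1. measure (Om n) {om \<in> space (Om n). I.sig2 n n (Adata om) < c \<kappa>} \<le> \<kappa>)"
    using tight by (intro choice) blast
  then obtain c where c: "\<And>\<kappa>. 0 < \<kappa> \<Longrightarrow> 0 < c \<kappa>"
    "\<And>\<kappa> n. 0 < \<kappa> \<Longrightarrow> 1 \<le> n \<Longrightarrow> measure (Om n) {om \<in> space (Om n). I.sig2 n n (Adata om) < c \<kappa>} \<le> \<kappa>" by blast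
  have "(\<lambda>n. cmod (char (distr (Om n) borel (I.Ustat n n)) t - z n)) \<longlonglongrightarrow> 0"
  proof (rule small_bound_tendsto_0)
    fix \<kappa> :: real assume \<kappa>: "0 < \<kappa>"
    have "(\<lambda>n. \<bar>t\<bar> / sqrt (real n)) \<longlonglongrightarrow> 0"
      by (intro tendsto_divide_0[OF tendsto_const] filterlim_at_top_imp_at_infinity
          filterlim_compose[OF sqrt_at_top] filterlim_real_sequentially)
    then have "(\<lambda>n. (\<bar>t\<bar> / sqrt (real n)) powr \<theta>) \<longlonglongrightarrow> 0"
      by (rule tendsto_zero_powrI[OF _ tendsto_const]) (use I.\<theta> in auto)
    then show "(\<lambda>n. t\<^sup>2 * (\<bar>t\<bar> / sqrt (real n)) powr \<theta> * I.Kstd (c \<kappa>)) \<longlonglongrightarrow> 0"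
      by (intro tendsto_mult_left_zero tendsto_mult_right_zero)
    obtain N :: nat where N: "t\<^sup>2 / 4 \<le> real N" using real_arch_simple by blast
    show "\<forall>\<^sub>F n in sequentially. cmod (char (distr (Om n) borel (I.Ustat n n)) t - z n)
       \<le> t\<^sup>2 * (\<bar>t\<bar> / sqrt (real n)) powr \<theta> * I.Kstd (c \<kappa>) + 2 * \<kappa>"
      using eventually_ge_at_top[of "max 1 N"]
    proof eventually_elim
      case (elim n)
      then have n: "0 < n" "1 \<le> n" "t\<^sup>2 / 4 \<le> real n" using N by auto
      show ?case
        unfolding z_def
        by (rule order_trans[OF I.Ustat_char[OF n(1,3) c(1)[OF \<kappa>]]]) (use c(2)[OF \<kappa> n(2)] in simp)
    qed
  qed simp_all
  moreover have "z \<longlonglongrightarrow> complex_of_real (exp (- t\<^sup>2 / 2))"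
    unfolding z_def by (rule isCont_tendsto_compose[OF _ tendsto_exp_limit_sequentially]) auto
  ultimately have "(\<lambda>n. (char (distr (Om n) borel (I.Ustat n n)) t - z n) + z n) \<longlonglongrightarrow> 0 + complex_of_real (exp (- t\<^sup>2 / 2))"
    by (intro tendsto_add) (simp_all only: tendsto_norm_zero_iff)
  then show ?thesis by (simp add: char_std_normal_distribution)
qed

lemma clt_Ustat: "(\<lambda>n. measure (Om n) {om \<in> space (Om n). I.Ustat n n om \<le> t}) \<longlonglongrightarrow> Phi t"
proof -
  have "weak_conv_m (\<lambda>n. distr (Om n) borel (I.Ustat n n)) std_normal_distribution"
    by (rule levy_continuity[OF I.Om.real_distribution_distr[OF I.Ustat_meas] real_dist_normal_dist char_Ustat_tendsto])
  then have "(\<lambda>n. cdf (distr (Om n) borel (I.Ustat n n)) t) \<longlonglongrightarrow> Phi t"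
    using isCont_Phi[of t] unfolding weak_conv_m_def weak_conv_def Phi_eq_cdf by blast
  moreover have "cdf (distr (Om n) borel (I.Ustat n n)) t = measure (Om n) {om \<in> space (Om n). I.Ustat n n om \<le> t}" for n
    unfolding cdf_def by (subst measure_distr) (auto intro!: arg_cong[where f="measure (Om n)"])
  ultimately show ?thesis by simp
qed

theorem kol_dist_tendsto: "(\<lambda>n. kol_dist (P n) (QA n) (QD n) (f n) (g n) fh gh W n) \<longlonglongrightarrow> 0"
proof (rule LIMSEQ_I)
  fix e :: real assume "0 < e"
  let ?F = "\<lambda>n t. measure (Om n) {om \<in> space (Om n). Tcent (P n) (f n) (g n) fh gh W n om \<le> t}"
  have F0: "0 \<le> ?F n t" and F1: "?F n t \<le> 1" for n t by (auto intro: I.Om.prob_le_1)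
  have "\<forall>\<^sub>F n in sequentially. \<forall>t. \<bar>?F n t - Phi t\<bar> \<le> e / 2"
  proof (rule polya_Phi[OF _ F0 F1])
    show "mono (?F n)" for n
      by (rule monoI, rule I.Om.finite_measure_mono) auto
    show "(\<lambda>n. ?F n t) \<longlonglongrightarrow> Phi t" for t
      by (rule slutsky_Phi[OF probOm I.Ustat_meas vanishes_Rem vanishes_Srat I.Tcent_meas vanishes_Tcent clt_Ustat])
  qed (use \<open>0 < e\<close> in simp)
  then have "\<forall>\<^sub>F n in sequentially. norm (kol_dist (P n) (QA n) (QD n) (f n) (g n) fh gh W n - 0) < e"
  proof eventually_elim
    case (elim n)
    have "kol_dist (P n) (QA n) (QD n) (f n) (g n) fh gh W n \<le> e / 2"
      unfolding kol_dist_def by (rule cSUP_least) (use elim in auto)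
    \<comment> \<open>A real \<open>SUP\<close> is an upper bound only for a set bounded above,
      which the uniform estimate provides; the value at t = 0 then yields nonnegativity of
      \<open>kol_dist\<close>.\<close>
    moreover have "\<bar>?F n 0 - Phi 0\<bar> \<le> kol_dist (P n) (QA n) (QD n) (f n) (g n) fh gh W n"
      unfolding kol_dist_def by (rule cSUP_upper) (use elim in \<open>auto intro!: bdd_aboveI2[where M="e / 2"]\<close>)
    ultimately show ?case using \<open>0 < e\<close> by simp
  qed
  then show "\<exists>no. \<forall>n\<ge>no. norm (kol_dist (P n) (QA n) (QD n) (f n) (g n) fh gh W n - 0) < e"
    by (simp add: eventually_sequentially)
qed

end

section \<open>Uniformity over a family of distributions\<close>

lemma powr_moment_reduce:
  fixes x :: real
  assumes "0 < \<eta>"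
  shows "ennreal (\<bar>x\<bar> powr (2 + min \<eta> 1)) \<le> 1 + ennreal (\<bar>x\<bar> powr (2 + \<eta>))"
proof -
  have "\<bar>x\<bar> powr (2 + min \<eta> 1) \<le> 1 + \<bar>x\<bar> powr (2 + \<eta>)"
  proof (cases "\<bar>x\<bar> \<le> 1")
    case True
    then have "\<bar>x\<bar> powr (2 + min \<eta> 1) \<le> 1 powr (2 + min \<eta> 1)" using assms by (intro powr_mono2) auto
    also have "1 powr (2 + min \<eta> 1) \<le> 1 + \<bar>x\<bar> powr (2 + \<eta>)" by simp
    finally show ?thesis .
  next
    case False
    then have "\<bar>x\<bar> powr (2 + min \<eta> 1) \<le> \<bar>x\<bar> powr (2 + \<eta>)" by (intro powr_mono) auto
    then show ?thesis by simp
  qed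
  then have "ennreal (\<bar>x\<bar> powr (2 + min \<eta> 1)) \<le> ennreal (1 + \<bar>x\<bar> powr (2 + \<eta>))" by (rule ennreal_leI)
  then show ?thesis by simp
qed

text \<open>Lowers the exponent into the range \<theta> \<le> 1. Arguments of absolute value at most
  1 are covered by the summand 1, which has integral 1 under a probability measure.\<close>

lemma moment_reduce:
  fixes h :: "'w \<Rightarrow> real"
  assumes P: "prob_space P" and [measurable]: "h \<in> borel_measurable P" and "0 < \<eta>" "K < \<infinity>"
    and le: "(\<integral>\<^sup>+w. ennreal (\<bar>h w\<bar> powr (2 + \<eta>)) \<partial>P) \<le> K"
  shows "(\<integral>\<^sup>+w. ennreal (\<bar>h w\<bar> powr (2 + min \<eta> 1)) \<partial>P) \<le> ennreal (1 + enn2real K)"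
proof -
  interpret prob_space P by fact
  have "(\<integral>\<^sup>+w. ennreal (\<bar>h w\<bar> powr (2 + min \<eta> 1)) \<partial>P) \<le> (\<integral>\<^sup>+w. 1 + ennreal (\<bar>h w\<bar> powr (2 + \<eta>)) \<partial>P)"
    by (intro nn_integral_mono powr_moment_reduce \<open>0 < \<eta>\<close>)
  also have "\<dots> = 1 + (\<integral>\<^sup>+w. ennreal (\<bar>h w\<bar> powr (2 + \<eta>)) \<partial>P)"
    by (subst nn_integral_add) (auto simp: emeasure_space_1)
  also have "\<dots> \<le> 1 + K" using le by (intro add_left_mono)
  also have "\<dots> = ennreal (1 + enn2real K)" using \<open>K < \<infinity>\<close> by simp
  finally show ?thesis .
qed

lemma residual_measurable:
  assumes "E0 P" "regression_versions P f g u v"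
  shows "(\<lambda>w. eps f w * xi g w) \<in> borel_measurable P"
proof -
  have [measurable]: "f \<in> borel_measurable borel" "g \<in> borel_measurable borel" and [measurable_cong]: "sets P = sets borel"
    using assms by (auto simp: regression_versions_def cond_exp_version_def E0_def)
  show ?thesis unfolding eps_def xi_def by measurable
qed

text \<open>For each n choose an x that violates the bound e if there is one, any element otherwise.
  Convergence along this single sequence excludes violations for large n, and no supremum over the
  family has to be formed.\<close>

lemma eventually_uniform_by_sequences:
  fixes \<phi> :: "'p \<Rightarrow> nat \<Rightarrow> real"
  assumes "\<And>p. (\<And>n. p n \<in> A) \<Longrightarrow> (\<lambda>n. \<phi> (p n) n) \<longlonglongrightarrow> 0" and "0 < e"
  shows "\<forall>\<^sub>F n in sequentially. \<forall>x\<in>A. \<phi> x n \<le> e"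
proof (cases "A = {}")
  case False
  then obtain x0 where x0: "x0 \<in> A" by blast
  define p where "p n = (if \<exists>x\<in>A. e < \<phi> x n then SOME x. x \<in> A \<and> e < \<phi> x n else x0)" for n
  have p: "p n \<in> A \<and> ((\<exists>x\<in>A. e < \<phi> x n) \<longrightarrow> e < \<phi> (p n) n)" for n
  proof (cases "\<exists>x\<in>A. e < \<phi> x n")
    case True
    then have "\<exists>x. x \<in> A \<and> e < \<phi> x n" by blast
    from someI_ex[OF this] show ?thesis using True by (simp add: p_def)
  next
    case False
    then show ?thesis using x0 by (simp add: p_def)
  qed
  then have "(\<lambda>n. \<phi> (p n) n) \<longlonglongrightarrow> 0" by (intro assms(1)) blast
  then have "\<forall>\<^sub>F n in sequentially. \<phi> (p n) n < e" using \<open>0 < e\<close> by (rule order_tendstoD(2))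
  then show ?thesis
  proof eventually_elim
    case (elim n)
    then show ?case using p[of n] by (meson not_le less_asym)
  qed
qed simp

lemma eventually_le_tendsto_0:
  fixes p :: "nat \<Rightarrow> real"
  assumes "\<And>n. 0 \<le> p n" "\<And>e. 0 < e \<Longrightarrow> \<forall>\<^sub>F n in sequentially. p n \<le> e"
  shows "p \<longlonglongrightarrow> 0"
proof (rule tendstoI)
  fix e :: real assume "0 < e"
  then have "\<forall>\<^sub>F n in sequentially. p n \<le> e / 2" by (intro assms(2)) simp
  then show "\<forall>\<^sub>F n in sequentially. dist (p n) 0 < e"
  proof (eventually_elim)
    case (elim n)
    then show ?case using assms(1)[of n] \<open>0 < e\<close> by (simp add: dist_real_def)
  qed
qed

theorem theorem4:
  fixes MA :: "'a measure" and MD :: "'b measure"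
    and W :: "nat \<Rightarrow> 'a \<Rightarrow> 'z::euclidean_space \<Rightarrow> real"
    and fh gh :: "nat \<Rightarrow> 'b \<Rightarrow> 'z \<Rightarrow> real"
    and QA :: "'z obs measure \<Rightarrow> 'a measure"
    and QD :: "'z obs measure \<Rightarrow> 'b measure"
  assumes W_meas: "\<And>n. (\<lambda>(a, z). W n a z) \<in> borel_measurable (MA \<Otimes>\<^sub>M borel)"
    and fh_meas: "\<And>n. (\<lambda>(d, z). fh n d z) \<in> borel_measurable (MD \<Otimes>\<^sub>M borel)"
    and gh_meas: "\<And>n. (\<lambda>(d, z). gh n d z) \<in> borel_measurable (MD \<Otimes>\<^sub>M borel)"
    and W_bdd: "\<exists>C>0. \<forall>n a z. \<bar>W n a z\<bar> \<le> C"
  shows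
   "(\<forall>P f g u v.
       E0 P \<and> regression_versions P f g u v
     \<and> prob_space (QA P) \<and> sets (QA P) = sets MA
     \<and> prob_space (QD P) \<and> sets (QD P) = sets MD
     \<and> (\<forall>\<delta>>0. (\<lambda>n. measure (sample_space P (QA P) (QD P))
              {om \<in> space (sample_space P (QA P) (QD P)).
                 \<bar>real n * Aerr f fh n om * Aerr g gh n om\<bar> > \<delta>}) \<longlonglongrightarrow> 0)
     \<and> (\<forall>\<delta>>0. (\<lambda>n. measure (sample_space P (QA P) (QD P))
              {om \<in> space (sample_space P (QA P) (QD P)).
                 Berr f fh v n om > ennreal \<delta>}) \<longlonglongrightarrow> 0)
     \<and> (\<forall>\<delta>>0. (\<lambda>n. measure (sample_space P (QA P) (QD P))
              {om \<in> space (sample_space P (QA P) (QD P)).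
                 Berr g gh u n om > ennreal \<delta>}) \<longlonglongrightarrow> 0)
     \<and> (\<exists>\<eta>>0. (\<integral>\<^sup>+w. ennreal (\<bar>eps f w * xi g w\<bar> powr (2 + \<eta>)) \<partial>P) < \<infinity>)
     \<and> (AE om in sample_space P (QA P) (QD P).
           \<exists>c>0. \<forall>n\<ge>1. c \<le> sigma2_bar P f g W n (Adata om))
     \<longrightarrow> (\<lambda>n. kol_dist P (QA P) (QD P) f g fh gh W n) \<longlonglongrightarrow> 0)
  \<and> (\<forall>Pfam F G U V.
       (\<forall>P\<in>Pfam. E0 P \<and> regression_versions P (F P) (G P) (U P) (V P)
          \<and> prob_space (QA P) \<and> sets (QA P) = sets MA
          \<and> prob_space (QD P) \<and> sets (QD P) = sets MD)
     \<and> (\<forall>\<delta>>0. \<forall>e>0. \<forall>\<^sub>F n in sequentially. \<forall>P\<in>Pfam.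
           measure (sample_space P (QA P) (QD P))
              {om \<in> space (sample_space P (QA P) (QD P)).
                 \<bar>real n * Aerr (F P) fh n om * Aerr (G P) gh n om\<bar> > \<delta>} \<le> e)
     \<and> (\<forall>\<delta>>0. \<forall>e>0. \<forall>\<^sub>F n in sequentially. \<forall>P\<in>Pfam.
           measure (sample_space P (QA P) (QD P))
              {om \<in> space (sample_space P (QA P) (QD P)).
                 Berr (F P) fh (V P) n om > ennreal \<delta>} \<le> e)
     \<and> (\<forall>\<delta>>0. \<forall>e>0. \<forall>\<^sub>F n in sequentially. \<forall>P\<in>Pfam.
           measure (sample_space P (QA P) (QD P))
              {om \<in> space (sample_space P (QA P) (QD P)).
                 Berr (G P) gh (U P) n om > ennreal \<delta>} \<le> e)
     \<and> (\<exists>\<eta>>0. \<exists>K<\<infinity>. \<forall>P\<in>Pfam.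
           (\<integral>\<^sup>+w. ennreal (\<bar>eps (F P) w * xi (G P) w\<bar> powr (2 + \<eta>)) \<partial>P) \<le> K)
     \<and> (\<exists>c>0. \<forall>P\<in>Pfam. AE om in sample_space P (QA P) (QD P).
           \<forall>n\<ge>1. c \<le> sigma2_bar P (F P) (G P) W n (Adata om))
     \<longrightarrow> (\<forall>e>0. \<forall>\<^sub>F n in sequentially. \<forall>P\<in>Pfam.
           kol_dist P (QA P) (QD P) (F P) (G P) fh gh W n \<le> e))"
proof (intro conjI allI impI, goal_cases)
  case (1 P f g u v)
  then have E0: "E0 P" and reg: "regression_versions P f g u v"
    and QA: "prob_space (QA P)" "sets (QA P) = sets MA" and QD: "prob_space (QD P)" "sets (QD P) = sets MD"
    and A: "\<And>\<delta>. 0 < \<delta> \<Longrightarrow> (\<lambda>n. measure (sample_space P (QA P) (QD P))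
              {om \<in> space (sample_space P (QA P) (QD P)).
                 \<bar>real n * Aerr f fh n om * Aerr g gh n om\<bar> > \<delta>}) \<longlonglongrightarrow> 0"
    and Bf: "\<And>\<delta>. 0 < \<delta> \<Longrightarrow> (\<lambda>n. measure (sample_space P (QA P) (QD P))
              {om \<in> space (sample_space P (QA P) (QD P)). Berr f fh v n om > ennreal \<delta>}) \<longlonglongrightarrow> 0"
    and Bg: "\<And>\<delta>. 0 < \<delta> \<Longrightarrow> (\<lambda>n. measure (sample_space P (QA P) (QD P))
              {om \<in> space (sample_space P (QA P) (QD P)). Berr g gh u n om > ennreal \<delta>}) \<longlonglongrightarrow> 0"
    and mom: "\<exists>\<eta>>0. (\<integral>\<^sup>+w. ennreal (\<bar>eps f w * xi g w\<bar> powr (2 + \<eta>)) \<partial>P) < \<infinity>"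
    and sig: "AE om in sample_space P (QA P) (QD P). \<exists>c>0. \<forall>n\<ge>1. c \<le> sigma2_bar P f g W n (Adata om)"
    by blast+
  obtain C where C: "0 < C" "\<And>n a z. \<bar>W n a z\<bar> \<le> C" using W_bdd by blast
  obtain \<eta> where \<eta>: "0 < \<eta>" "(\<integral>\<^sup>+w. ennreal (\<bar>eps f w * xi g w\<bar> powr (2 + \<eta>)) \<partial>P) < \<infinity>" using mom by blast
  define K where "K = 1 + enn2real (\<integral>\<^sup>+w. ennreal (\<bar>eps f w * xi g w\<bar> powr (2 + \<eta>)) \<partial>P)"
  have PP: "prob_space P" using E0 by (simp add: E0_def)
  have K: "(\<integral>\<^sup>+w. ennreal (\<bar>eps f w * xi g w\<bar> powr (2 + min \<eta> 1)) \<partial>P) \<le> ennreal K"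
    unfolding K_def by (rule moment_reduce[OF PP residual_measurable[OF E0 reg] \<eta> order_refl])
  interpret I: wgcm MA MD W fh gh P "QA P" "QD P" f g u v C "min \<eta> 1" K
    by (rule wgcm.intro[OF W_meas fh_meas gh_meas C E0 reg QA QD _ _ _ K]) (use \<eta> in \<open>simp_all add: K_def\<close>)
  have tight: "\<exists>c>0. \<forall>n\<ge>1. measure I.Om {om \<in> space I.Om. sigma2_bar P f g W n (Adata om) < c} \<le> e" if "0 < e" for e
  proof -
    \<comment> \<open>The random c of the hypothesis is replaced by the levels 1 / (k + 1).
      Uniformity in n is built in, as \<open>E k\<close> asks whether any n \<ge> 1 falls below the
      level; the events decrease to a null set.\<close>
    define E where "E k = {om \<in> space I.Om. \<exists>n\<ge>1. sigma2_bar P f g W n (Adata om) < 1 / real (Suc k)}" for k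
    have E_sets: "range E \<subseteq> sets I.Om" unfolding E_def by auto
    have dec: "decseq E"
    proof (rule decseq_SucI)
      have "1 / real (Suc (Suc k)) \<le> 1 / real (Suc k)" for k by (simp add: frac_le)
      then show "E (Suc k) \<subseteq> E k" for k unfolding E_def by (auto intro: less_le_trans)
    qed
    have "(\<lambda>k. measure I.Om (E k)) \<longlonglongrightarrow> measure I.Om (\<Inter>k. E k)"
      by (rule I.Om.finite_Lim_measure_decseq[OF E_sets dec])
    moreover have "measure I.Om (\<Inter>k. E k) = measure I.Om {}"
    proof (rule measure_eq_AE)
      show "AE om in I.Om. om \<in> (\<Inter>k. E k) \<longleftrightarrow> om \<in> {}"
        using sig
      proof eventually_elim
        case (elim om)
        then obtain c where c: "0 < c" "\<And>n. n \<ge> 1 \<Longrightarrow> c \<le> sigma2_bar P f g W n (Adata om)" by blast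
        obtain k where "1 / real (Suc k) < c" using nat_approx_posE[OF c(1)] by blast
        then have "om \<notin> E k" using c(2) unfolding E_def by (auto simp: not_less intro: order_trans[OF less_imp_le])
        then show ?case by blast
      qed
    qed (use E_sets in auto)
    ultimately have "(\<lambda>k. measure I.Om (E k)) \<longlonglongrightarrow> 0" by simp
    then have "\<forall>\<^sub>F k in sequentially. measure I.Om (E k) < e" using that by (rule order_tendstoD(2))
    then obtain k where k: "measure I.Om (E k) < e" by (auto simp: eventually_sequentially)
    have "measure I.Om {om \<in> space I.Om. sigma2_bar P f g W n (Adata om) < 1 / real (Suc k)} \<le> measure I.Om (E k)" if "n \<ge> 1" for n
      by (rule I.Om.finite_measure_mono) (use that E_sets in \<open>auto simp: E_def\<close>)
    then show ?thesis using k by (intro exI[of _ "1 / real (Suc k)"]) (auto intro: order_trans[OF _ less_imp_le])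
  qed
  \<comment> \<open>The constant sequence of laws reduces the claim for a single P to the theorem on
    sequences.\<close>
  interpret wgcm_seq MA MD W fh gh "\<lambda>_. P" "\<lambda>_. QA P" "\<lambda>_. QD P" "\<lambda>_. f" "\<lambda>_. g" "\<lambda>_. u" "\<lambda>_. v" C "min \<eta> 1" K
    by (intro wgcm_seq.intro I.wgcm_axioms A Bf Bg tight)
  show ?case by (rule kol_dist_tendsto)
next
  case (2 Pfam F G U V e)
  then have fam: "\<forall>P\<in>Pfam. E0 P \<and> regression_versions P (F P) (G P) (U P) (V P)
          \<and> prob_space (QA P) \<and> sets (QA P) = sets MA
          \<and> prob_space (QD P) \<and> sets (QD P) = sets MD"
    and A: "\<forall>\<delta>>0. \<forall>e>0. \<forall>\<^sub>F n in sequentially. \<forall>P\<in>Pfam.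
           measure (sample_space P (QA P) (QD P))
              {om \<in> space (sample_space P (QA P) (QD P)).
                 \<bar>real n * Aerr (F P) fh n om * Aerr (G P) gh n om\<bar> > \<delta>} \<le> e"
    and Bf: "\<forall>\<delta>>0. \<forall>e>0. \<forall>\<^sub>F n in sequentially. \<forall>P\<in>Pfam.
           measure (sample_space P (QA P) (QD P))
              {om \<in> space (sample_space P (QA P) (QD P)).
                 Berr (F P) fh (V P) n om > ennreal \<delta>} \<le> e"
    and Bg: "\<forall>\<delta>>0. \<forall>e>0. \<forall>\<^sub>F n in sequentially. \<forall>P\<in>Pfam.
           measure (sample_space P (QA P) (QD P))
              {om \<in> space (sample_space P (QA P) (QD P)).
                 Berr (G P) gh (U P) n om > ennreal \<delta>} \<le> e"
    and mom: "\<exists>\<eta>>0. \<exists>K<\<infinity>. \<forall>P\<in>Pfam.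
           (\<integral>\<^sup>+w. ennreal (\<bar>eps (F P) w * xi (G P) w\<bar> powr (2 + \<eta>)) \<partial>P) \<le> K"
    and sig: "\<exists>c>0. \<forall>P\<in>Pfam. AE om in sample_space P (QA P) (QD P).
           \<forall>n\<ge>1. c \<le> sigma2_bar P (F P) (G P) W n (Adata om)"
    and e: "0 < e"
    by - (elim conjE, assumption)+
  obtain C where C: "0 < C" "\<And>n a z. \<bar>W n a z\<bar> \<le> C" using W_bdd by blast
  obtain \<eta> K where \<eta>: "0 < \<eta>" "K < \<infinity>" and mom':
    "\<And>P. P \<in> Pfam \<Longrightarrow> (\<integral>\<^sup>+w. ennreal (\<bar>eps (F P) w * xi (G P) w\<bar> powr (2 + \<eta>)) \<partial>P) \<le> K" using mom by blast
  obtain c where c: "0 < c" "\<And>P. P \<in> Pfam \<Longrightarrow> AE om in sample_space P (QA P) (QD P).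
           \<forall>n\<ge>1. c \<le> sigma2_bar P (F P) (G P) W n (Adata om)" using sig by blast
  show ?case
  \<comment> \<open>Uniformity is tested on an arbitrary sequence \<open>p\<close> in
    \<open>Pfam\<close>: the uniform hypotheses become limits along \<open>p\<close>, with one
    moment bound shared by all its members.\<close>
  proof (rule eventually_uniform_by_sequences[OF _ e])
    fix p :: "nat \<Rightarrow> 'z obs measure" assume p: "\<And>n. p n \<in> Pfam"
    have loc: "wgcm MA MD W fh gh (p n) (QA (p n)) (QD (p n)) (F (p n)) (G (p n)) (U (p n)) (V (p n)) C (min \<eta> 1) (1 + enn2real K)" for n
    proof -
      have E0: "E0 (p n)" and reg: "regression_versions (p n) (F (p n)) (G (p n)) (U (p n)) (V (p n))"
        and Q: "prob_space (QA (p n))" "sets (QA (p n)) = sets MA" "prob_space (QD (p n))" "sets (QD (p n)) = sets MD"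
        using bspec[OF fam p[of n]] by blast+
      have PP: "prob_space (p n)" using E0 by (simp add: E0_def)
      show ?thesis
        by (rule wgcm.intro[OF W_meas fh_meas gh_meas C E0 reg Q _ _ _
              moment_reduce[OF PP residual_measurable[OF E0 reg] \<eta> mom'[OF p]]]) (use \<eta> in simp_all)
    qed
    interpret wgcm_seq MA MD W fh gh p "\<lambda>n. QA (p n)" "\<lambda>n. QD (p n)" "\<lambda>n. F (p n)" "\<lambda>n. G (p n)" "\<lambda>n. U (p n)" "\<lambda>n. V (p n)"
      C "min \<eta> 1" "1 + enn2real K"
    proof (rule wgcm_seq.intro[OF loc])
      fix \<delta> :: real assume d: "0 < \<delta>"
      show "(\<lambda>n. measure (sample_space (p n) (QA (p n)) (QD (p n)))
              {om \<in> space (sample_space (p n) (QA (p n)) (QD (p n))).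
                 \<bar>real n * Aerr (F (p n)) fh n om * Aerr (G (p n)) gh n om\<bar> > \<delta>}) \<longlonglongrightarrow> 0"
        by (rule eventually_le_tendsto_0[OF measure_nonneg]) (rule eventually_mono[OF A[rule_format, OF d]], assumption, use p in blast)
      show "(\<lambda>n. measure (sample_space (p n) (QA (p n)) (QD (p n)))
              {om \<in> space (sample_space (p n) (QA (p n)) (QD (p n))). Berr (F (p n)) fh (V (p n)) n om > ennreal \<delta>}) \<longlonglongrightarrow> 0"
        by (rule eventually_le_tendsto_0[OF measure_nonneg]) (rule eventually_mono[OF Bf[rule_format, OF d]], assumption, use p in blast)
      show "(\<lambda>n. measure (sample_space (p n) (QA (p n)) (QD (p n)))
              {om \<in> space (sample_space (p n) (QA (p n)) (QD (p n))). Berr (G (p n)) gh (U (p n)) n om > ennreal \<delta>}) \<longlonglongrightarrow> 0"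
        by (rule eventually_le_tendsto_0[OF measure_nonneg]) (rule eventually_mono[OF Bg[rule_format, OF d]], assumption, use p in blast)
      \<comment> \<open>Here c is deterministic and the event is null for every n \<ge> 1, so the
        same c serves every tolerance.\<close>
      have "measure (sample_space (p n) (QA (p n)) (QD (p n)))
              {om \<in> space (sample_space (p n) (QA (p n)) (QD (p n))). sigma2_bar (p n) (F (p n)) (G (p n)) W n (Adata om) < c} \<le> \<delta>" if "1 \<le> n" for n
      proof -
        interpret L: wgcm MA MD W fh gh "p n" "QA (p n)" "QD (p n)" "F (p n)" "G (p n)" "U (p n)" "V (p n)" C "min \<eta> 1" "1 + enn2real K"
          by (rule loc)
        have "measure L.Om {om \<in> space L.Om. sigma2_bar (p n) (F (p n)) (G (p n)) W n (Adata om) < c} = measure L.Om {}"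
        proof (rule measure_eq_AE)
          show "AE om in L.Om. om \<in> {om \<in> space L.Om. sigma2_bar (p n) (F (p n)) (G (p n)) W n (Adata om) < c} \<longleftrightarrow> om \<in> {}"
            using c(2)[OF p[of n]] by eventually_elim (use that in \<open>auto simp: not_less\<close>)
        qed auto
        then show ?thesis using d by simp
      qed
      then show "\<exists>c>0. \<forall>n\<ge>1. measure (sample_space (p n) (QA (p n)) (QD (p n)))
              {om \<in> space (sample_space (p n) (QA (p n)) (QD (p n))). sigma2_bar (p n) (F (p n)) (G (p n)) W n (Adata om) < c} \<le> \<delta>"
        using c(1) by blast
    qed
    show "(\<lambda>n. kol_dist (p n) (QA (p n)) (QD (p n)) (F (p n)) (G (p n)) fh gh W n) \<longlonglongrightarrow> 0"
      by (rule kol_dist_tendsto)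
  qed
qed

end
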